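(* (i) There is an algorithm for the random order two-sided Game of Googol, using only pairwise comparisons between values, which on every instance (every $n$ and every choice of numbers on the cards) accepts the largest face-down number with probability at least $0.5009$. Consequently the same guarantee holds for the random order single sample secretary problem. (ii) There is no algorithm for the random order single sample secretary problem that uses only pairwise comparisons between values and achieves, on every instance, a probability of success larger than $\gamma$. That is, for every such algorithm and every $\delta>0$ there is an instance on which it succeeds with probability less than $\gamma+\delta$. Consequently the same holds for the random order two-sided Game of Googol.
   Context: Random order two-sided Game of Googol: $n$ cards, each carrying a real number on each of its two sides, are chosen by an adversary. The cards are placed on a table in uniformly random order. Independently, each card shows each of its sides face-up with probability $1/2$. The algorithm first sees all face-up numbers. It then flips the cards one by one in the random order. Upon seeing each revealed face-down number, it must irrevocably accept that card or move on. It succeeds if it accepts the card whose (initially) face-down number is the largest among all face-down numbers. Random order single sample secretary problem: there are independent random variables $X_1,\dots,X_n$ with $X_i\sim\mathcal D_i$. The distributions $\mathcal D_i$ are unknown. The algorithm is given one independent sample $Y_i\sim\mathcal D_i$ for each $i$. The $X_i$ are revealed one by one in uniformly random order. After each one, the algorithm must irrevocably accept it or move on. It succeeds if it accepts the largest of $X_1,\dots,X_n$. "Using only pairwise comparisons" means the algorithm's decisions depend only on the outcomes of comparisons between observed values. $\gamma\approx 0.5024$ is the optimal asymptotic (as $n\to\infty$) success probability, for comparison-based algorithms, in the following secretary problem ("choosing the best of the current crop"): $n$ unknown values arrive in uniformly random order; the first $n/2$ arriving values can only be observed; the goal is to accept the maximum of the last $n/2$ values. *)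

theory Defs
  imports "HOL-Probability.Probability"
begin

definition same_comparisons :: "real list \<Rightarrow> real list \<Rightarrow> bool" where
  "same_comparisons vs ws \<longleftrightarrow> length vs = length ws \<and>
     (\<forall>i < length vs. \<forall>j < length vs. vs ! i < vs ! j \<longleftrightarrow> ws ! i < ws ! j)"

text \<open>
  Algorithms are randomised: an algorithm maps the information available when a value has just been
  revealed (nothing having been accepted before) to the probability of accepting that value.
  Below, \<open>v j\<close> is the value revealed at step \<open>j\<close>, acceptance is possible at the steps
  \<open>s \<le> j < n\<close>, and \<open>q j\<close> is the conditional acceptance probability at step \<open>j\<close>. If the maximum is
  attained several times, accepting any of the maximal values is a success.
\<close>

definition pick_max_prob :: "nat \<Rightarrow> nat \<Rightarrow> (nat \<Rightarrow> real) \<Rightarrow> (nat \<Rightarrow> real) \<Rightarrow> real" where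
  "pick_max_prob s n v q =
     (\<Sum>k | k \<in> {s..<n} \<and> (\<forall>j\<in>{s..<n}. v j \<le> v k). q k * (\<Prod>j\<in>{s..<k}. 1 - q j))"

definition random_order :: "nat \<Rightarrow> (nat \<Rightarrow> nat) pmf" where
  "random_order n = pmf_of_set {\<sigma>. \<sigma> permutes {..<n}}"


subsection \<open>Random order two-sided Game of Googol\<close>

text \<open>
  \<open>A us ds\<close>: \<open>us\<close> lists the face-up numbers of all cards in table order, \<open>ds\<close> the face-down numbers
  of the cards flipped so far, the current one last. The number of cards is \<open>length us\<close>.
\<close>

type_synonym googol_algorithm = "real list \<Rightarrow> real list \<Rightarrow> real"

definition googol_algorithm :: "googol_algorithm \<Rightarrow> bool" where
  "googol_algorithm A \<longleftrightarrow> (\<forall>us ds. A us ds \<in> {0..1})"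

definition googol_comparison_based :: "googol_algorithm \<Rightarrow> bool" where
  "googol_comparison_based A \<longleftrightarrow>
     (\<forall>us ds us' ds'. length us = length us' \<longrightarrow> same_comparisons (us @ ds) (us' @ ds') \<longrightarrow>
        A us ds = A us' ds')"

text \<open>
  Card \<open>i < n\<close> carries \<open>a i True\<close> and \<open>a i False\<close>; its side \<open>f i\<close> is face-up. Position \<open>k\<close> on the
  table holds card \<open>\<sigma> k\<close>.
\<close>

definition googol_success :: "googol_algorithm \<Rightarrow> nat \<Rightarrow> (nat \<Rightarrow> bool \<Rightarrow> real) \<Rightarrow> real" where
  "googol_success A n a =
     measure_pmf.expectation
       (pair_pmf (random_order n) (Pi_pmf {..<n} False (\<lambda>_. bernoulli_pmf (1/2))))
       (\<lambda>(\<sigma>, f).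
          let up = (\<lambda>k. a (\<sigma> k) (f (\<sigma> k)));
              down = (\<lambda>k. a (\<sigma> k) (\<not> f (\<sigma> k)))
          in pick_max_prob 0 n down (\<lambda>j. A (map up [0..<n]) (map down [0..<Suc j])))"


subsection \<open>Random order single sample secretary problem\<close>

text \<open>
  \<open>B ys h\<close>: \<open>ys\<close> is the list of samples, \<open>ys ! i\<close> being drawn from the \<open>i\<close>-th distribution, and \<open>h\<close>
  lists the pairs \<open>(i, x\<^sub>i)\<close> revealed so far, the current one last. As when a card is flipped, the
  algorithm knows which sample belongs to a revealed value. The indices are not values, so a
  comparison-based algorithm may depend on them.
\<close>

type_synonym sample_algorithm = "real list \<Rightarrow> (nat \<times> real) list \<Rightarrow> real"

definition sample_algorithm :: "sample_algorithm \<Rightarrow> bool" where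
  "sample_algorithm B \<longleftrightarrow> (\<forall>ys h. B ys h \<in> {0..1})"

definition sample_comparison_based :: "sample_algorithm \<Rightarrow> bool" where
  "sample_comparison_based B \<longleftrightarrow>
     (\<forall>ys h ys' h'. length ys = length ys' \<longrightarrow> map fst h = map fst h' \<longrightarrow>
        same_comparisons (ys @ map snd h) (ys' @ map snd h') \<longrightarrow> B ys h = B ys' h')"

definition sample_success :: "sample_algorithm \<Rightarrow> nat \<Rightarrow> (nat \<Rightarrow> real measure) \<Rightarrow> real" where
  "sample_success B n D =
     measure_pmf.expectation (random_order n) (\<lambda>\<sigma>.
       LINT (x, y) | ((\<Pi>\<^sub>M i\<in>{..<n}. D i) \<Otimes>\<^sub>M (\<Pi>\<^sub>M i\<in>{..<n}. D i)).
         pick_max_prob 0 n (\<lambda>k. x (\<sigma> k))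
           (\<lambda>j. B (map y [0..<n]) (map (\<lambda>k. (\<sigma> k, x (\<sigma> k))) [0..<Suc j])))"


subsection \<open>Choosing the best of the current crop\<close>

text \<open>
  There are \<open>2 * m\<close> values, the first \<open>m\<close> of which can only be observed. \<open>C vs\<close>: \<open>vs\<close> lists the
  values observed so far, the current one last. The values are distinct, so that their order of
  arrival is a uniformly random ranking and the success probability of a comparison-based algorithm
  does not depend on them.
\<close>

type_synonym crop_algorithm = "real list \<Rightarrow> real"

definition crop_algorithm :: "crop_algorithm \<Rightarrow> bool" where
  "crop_algorithm C \<longleftrightarrow> (\<forall>vs. C vs \<in> {0..1})"

definition crop_comparison_based :: "crop_algorithm \<Rightarrow> bool" where
  "crop_comparison_based C \<longleftrightarrow> (\<forall>vs vs'. same_comparisons vs vs' \<longrightarrow> C vs = C vs')"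

definition crop_success :: "crop_algorithm \<Rightarrow> nat \<Rightarrow> (nat \<Rightarrow> real) \<Rightarrow> real" where
  "crop_success C m w =
     measure_pmf.expectation (random_order (2 * m)) (\<lambda>\<sigma>.
       pick_max_prob m (2 * m) (\<lambda>k. w (\<sigma> k)) (\<lambda>j. C (map (\<lambda>k. w (\<sigma> k)) [0..<Suc j])))"

definition crop_optimum :: "nat \<Rightarrow> real" where
  "crop_optimum m =
     (SUP C \<in> {C. crop_algorithm C \<and> crop_comparison_based C}.
        INF w \<in> {w. inj_on w {..<2 * m}}. crop_success C m w)"

definition crop_gamma :: real where
  "crop_gamma = lim crop_optimum"

end

theory Submission
  imports Defs
begin

text \<open>
  Lower bound. Give the cards independent uniform times and flip them in this order; accept a face-down
  number that exceeds all previous ones and has \<open>r\<close> face-up numbers above it if its time is at least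
  \<open>\<tau>\<^sub>r\<close>, where \<open>\<tau>\<^sub>0 = 0 \<le> \<tau>\<^sub>1 \<le> \<tau>\<^sub>2 \<le> \<tau>\<^sub>3 \<le> \<tau>\<^sub>4 = \<tau>\<^sub>5 = \<dots>\<close>. For fixed faces let \<open>d\<^sub>r\<close> be the number of
  face-down numbers with at most \<open>r\<close> face-up numbers above them. Conditioning on the time \<open>s\<close> of the
  card to be accepted and summing by parts over the other cards, the success probability is at least
  \<open>\<Sum>\<^sub>r c\<^sub>r(d\<^sub>r)\<close> with \<open>c\<^sub>r(d) = \<integral>\<^sub>0\<^sup>1 (min 1 (\<tau>\<^sub>r\<^sub>+\<^sub>1 / s) - min 1 (\<tau>\<^sub>r / s)) (1 - s)\<^bsup>d - 1\<^esup> ds\<close> for \<open>d \<ge> 1\<close>.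
  The event \<open>d\<^sub>r \<ge> k\<close> says that at least \<open>k\<close> of the \<open>N = r + k\<close> largest sides are face-down, and its
  probability depends only on \<open>N\<close>, \<open>k\<close> and the number of cards with both sides among these \<open>N\<close>. Hence the
  bound splits into a sum over \<open>N\<close> that can be minimised term by term.

  Upper bound. On independent uniform values every comparison-based algorithm plays the crop problem, so
  \<open>crop_optimum n\<close> bounds its success for each \<open>n\<close>. The optimum converges: restricting a game with
  \<open>2 M\<close> values to its \<open>2 m\<close> largest ones gives a game whose number of observed values differs from
  \<open>m\<close> by \<open>O(sqrt m)\<close> on average, so that \<open>crop_optimum M \<le> crop_optimum m + O(1 / sqrt m)\<close>.
\<close>

text \<open>An algorithm returns an acceptance probability for each history, whereas the threshold
  rule draws all times and tie-breaking coins once, before the game. Conditioning such a mixture on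
  survival turns it into an admissible algorithm with the same success probability, as in Kuhn's
  theorem. Times live on a finite grid, so every expectation in the analysis of the rule is a finite
  average and the discretisation error stays explicit. Equal numbers are an obstacle: the two-sided
  game shows no card labels, and decisions may depend on comparisons only. Therefore the rule is
  first built for the sample problem, where indices are visible and can break ties; in the game,
  labels are drawn at random. In the other direction, letting a fair coin exchange sample and value
  of each index turns the sample problem, for arbitrary distributions, into an average of two-sided
  games. \<open>crop_gamma\<close> is a \<open>lim\<close>, which carries information only once
  convergence is known. Hence the comparison of games of different sizes is part of the upper bound;
  it yields convergence without monotonicity.\<close>

section \<open>Averages over finite sets\<close>

definition avg :: "'a set \<Rightarrow> ('a \<Rightarrow> real) \<Rightarrow> real" where
  "avg S F = (\<Sum>x\<in>S. F x) / real (card S)"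

lemma avg_cong: "(\<And>x. x \<in> S \<Longrightarrow> F x = G x) \<Longrightarrow> avg S F = avg S G"
  by (simp add: avg_def)

lemma avg_const: "finite S \<Longrightarrow> S \<noteq> {} \<Longrightarrow> avg S (\<lambda>_. c) = c"
  by (simp add: avg_def)

lemma avg_mono: "(\<And>x. x \<in> S \<Longrightarrow> F x \<le> G x) \<Longrightarrow> avg S F \<le> avg S G"
  by (auto simp: avg_def intro!: divide_right_mono sum_mono)

lemma avg_ge:
  assumes "finite S" "S \<noteq> {}" "\<And>x. x \<in> S \<Longrightarrow> c \<le> F x"
  shows "c \<le> avg S F"
  using avg_mono[of S "\<lambda>_. c" F] assms by (simp add: avg_const)

lemma avg_le:
  assumes "finite S" "S \<noteq> {}" "\<And>x. x \<in> S \<Longrightarrow> F x \<le> c"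
  shows "avg S F \<le> c"
  using avg_mono[of S F "\<lambda>_. c"] assms by (simp add: avg_const)

lemma avg_add: "avg S (\<lambda>x. F x + G x) = avg S F + avg S G"
  by (simp add: avg_def sum.distrib add_divide_distrib)

lemma avg_diff: "avg S (\<lambda>x. F x - G x) = avg S F - avg S G"
  by (simp add: avg_def sum_subtractf diff_divide_distrib)

lemma avg_cmult: "avg S (\<lambda>x. c * F x) = c * avg S F"
  by (simp add: avg_def sum_distrib_left)

lemma avg_sum: "avg S (\<lambda>x. \<Sum>i\<in>I. F i x) = (\<Sum>i\<in>I. avg S (F i))"
  unfolding avg_def by (subst sum.swap) (simp add: sum_divide_distrib)

lemma avg_swap: "avg S (\<lambda>x. avg R (F x)) = avg R (\<lambda>y. avg S (\<lambda>x. F x y))"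
  unfolding avg_def
  by (subst sum.swap[of _ S R] | simp only: sum_divide_distrib[symmetric])+
     (simp add: mult.commute divide_divide_eq_left)

lemma avg_Times: "avg (S \<times> R) F = avg S (\<lambda>x. avg R (\<lambda>y. F (x, y)))"
  unfolding avg_def
  by (simp add: sum.cartesian_product sum_divide_distrib[symmetric] card_cartesian_product)

lemma avg_bij:
  assumes "bij_betw h S R"
  shows "avg S (\<lambda>x. F (h x)) = avg R F"
  unfolding avg_def using sum.reindex_bij_betw[OF assms, of F] bij_betw_same_card[OF assms] by simp

lemma ex_le_avg:
  assumes "finite S" "S \<noteq> {}"
  shows "\<exists>x\<in>S. F x \<le> avg S F"
proof (rule ccontr)
  assume "\<not> ?thesis"
  then have "\<And>x. x \<in> S \<Longrightarrow> avg S F < F x" by auto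
  then have "(\<Sum>x\<in>S. avg S F) < (\<Sum>x\<in>S. F x)" using assms by (intro sum_strict_mono) auto
  then show False using assms by (simp add: avg_def)
qed

lemma expectation_pmf_of_set:
  fixes F :: "'a \<Rightarrow> real"
  assumes "finite S" "S \<noteq> {}"
  shows "measure_pmf.expectation (pmf_of_set S) F = avg S F"
  using assms by (simp add: integral_pmf_of_set avg_def)

lemma expectation_pair_pmf_of_set:
  fixes F :: "'a \<times> 'b \<Rightarrow> real"
  assumes "finite S" "S \<noteq> {}" "finite R" "R \<noteq> {}"
  shows "measure_pmf.expectation (pair_pmf (pmf_of_set S) (pmf_of_set R)) F
    = avg S (\<lambda>x. avg R (\<lambda>y. F (x, y)))"
proof -
  have "pair_pmf (pmf_of_set S) (pmf_of_set R) = pmf_of_set (S \<times> R)"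
  proof (rule pmf_eqI)
    fix x :: "'a \<times> 'b"
    show "pmf (pair_pmf (pmf_of_set S) (pmf_of_set R)) x = pmf (pmf_of_set (S \<times> R)) x"
      using assms
      by (cases x) (simp add: pmf_pair pmf_of_set indicator_def card_cartesian_product)
  qed
  then show ?thesis using assms by (simp add: expectation_pmf_of_set avg_Times)
qed

subsection \<open>Permutations\<close>

abbreviation perms :: "nat \<Rightarrow> (nat \<Rightarrow> nat) set" where
  "perms n \<equiv> {\<sigma>. \<sigma> permutes {..<n}}"

lemma finite_perms [simp]: "finite (perms n)"
  by (simp add: finite_permutations)

lemma perms_nonempty [simp]: "perms n \<noteq> {}"
  using permutes_id by blast

lemma perms_less: "\<sigma> permutes {..<n} \<Longrightarrow> \<sigma> i < n \<longleftrightarrow> i < (n::nat)"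
  using permutes_in_image[of \<sigma> "{..<n}" i] by simp

lemma expectation_random_order:
  "measure_pmf.expectation (random_order n) F = avg (perms n) (F :: _ \<Rightarrow> real)"
  unfolding random_order_def by (rule expectation_pmf_of_set[OF finite_perms perms_nonempty])

lemma bij_perms_comp_left: "\<rho> permutes {..<n} \<Longrightarrow> bij_betw (\<lambda>\<sigma>. \<rho> \<circ> \<sigma>) (perms n) (perms n)"
  by (rule bij_betwI[where g="\<lambda>\<sigma>. inv \<rho> \<circ> \<sigma>"])
     (auto intro: permutes_compose permutes_inv simp: o_assoc permutes_inv_o)

lemma bij_perms_comp_right: "\<rho> permutes {..<n} \<Longrightarrow> bij_betw (\<lambda>\<sigma>. \<sigma> \<circ> \<rho>) (perms n) (perms n)"
  by (rule bij_betwI[where g="\<lambda>\<sigma>. \<sigma> \<circ> inv \<rho>"])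
     (auto intro: permutes_compose permutes_inv simp: o_assoc[symmetric] permutes_inv_o)

lemma bij_perms_inv: "bij_betw inv (perms n) (perms n)"
  by (rule bij_betwI[where g=inv]) (auto intro: permutes_inv simp: permutes_inv_inv)

subsection \<open>Finite function spaces\<close>

definition funs :: "nat \<Rightarrow> 'a set \<Rightarrow> 'a \<Rightarrow> (nat \<Rightarrow> 'a) set" where
  "funs n S d = {f. (\<forall>i<n. f i \<in> S) \<and> (\<forall>i\<ge>n. f i = d)}"

lemma funs_eq_PiE_dflt: "funs n S d = PiE_dflt {..<n} d (\<lambda>_. S)"
  by (auto simp: funs_def PiE_dflt_def not_less)

lemma finite_funs [simp]: "finite S \<Longrightarrow> finite (funs n S d)"
  unfolding funs_eq_PiE_dflt by (rule finite_PiE_dflt) auto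

lemma funs_nonempty: "S \<noteq> {} \<Longrightarrow> funs n S d \<noteq> {}"
proof -
  assume "S \<noteq> {}"
  then obtain x where "x \<in> S" by auto
  then have "(\<lambda>i. if i < n then x else d) \<in> funs n S d" by (simp add: funs_def)
  then show ?thesis by auto
qed

text \<open>Resampling one coordinate: exchanging it with an independent fresh value is an
  involution on the product, hence preserves the average.\<close>

lemma avg_funs_update:
  assumes "finite S" "S \<noteq> {}" "i < n"
  shows "avg (funs n S d) F = avg S (\<lambda>v. avg (funs n S d) (\<lambda>t. F (t(i := v))))"
proof -
  let ?h = "\<lambda>(t, v). (t(i := v), t i)"
  have b: "bij_betw ?h (funs n S d \<times> S) (funs n S d \<times> S)"
    by (rule bij_betwI[where g="?h"]) (use assms in \<open>auto simp: funs_def\<close>)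
  have "avg (funs n S d) F = avg (funs n S d) (\<lambda>t. avg S (\<lambda>v. F t))"
    using assms by (simp add: avg_const)
  also have "\<dots> = avg (funs n S d \<times> S) (\<lambda>(t, v). F t)" by (simp add: avg_Times)
  also have "\<dots> = avg (funs n S d \<times> S) (\<lambda>x. (\<lambda>(t, v). F t) (?h x))" by (rule avg_bij[OF b, symmetric])
  also have "\<dots> = avg (funs n S d) (\<lambda>t. avg S (\<lambda>v. F (t(i := v))))" by (simp add: avg_Times)
  also have "\<dots> = avg S (\<lambda>v. avg (funs n S d) (\<lambda>t. F (t(i := v))))" by (rule avg_swap)
  finally show ?thesis .
qed

text \<open>Two independent copies exchange their coordinates in \<open>P\<close>. With
  \<open>P\<close> the cards whose two sides agree, this justifies replacing their faces by
  coins.\<close>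

lemma avg_funs_mix:
  "avg (funs n S d) (\<lambda>f. avg (funs n S d) (\<lambda>c. F (\<lambda>i. if P i then c i else f i)))
    = avg (funs n S d) F" if "finite S" "S \<noteq> {}"
proof -
  let ?h = "\<lambda>(f, c). ((\<lambda>i. if P i then c i else f i), (\<lambda>i. if P i then f i else c i))"
  have b: "bij_betw ?h (funs n S d \<times> funs n S d) (funs n S d \<times> funs n S d)"
    by (rule bij_betwI[where g="?h"]) (auto simp: funs_def fun_eq_iff)
  have "avg (funs n S d) F = avg (funs n S d) (\<lambda>f. avg (funs n S d) (\<lambda>c. F f))"
    using that by (simp add: avg_const funs_nonempty)
  also have "\<dots> = avg (funs n S d \<times> funs n S d) (\<lambda>(f, c). F f)" by (simp add: avg_Times)
  also have "\<dots> = avg (funs n S d \<times> funs n S d) (\<lambda>x. (\<lambda>(f, c). F f) (?h x))" by (rule avg_bij[OF b, symmetric])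
  finally show ?thesis by (simp add: avg_Times)
qed

lemma avg_funs_comp:
  assumes "\<pi> permutes {..<n}"
  shows "avg (funs n S d) (\<lambda>t. F (t \<circ> \<pi>)) = avg (funs n S d) F"
proof -
  have *: "t \<circ> \<pi> \<in> funs n S d" if "\<pi> permutes {..<n}" "t \<in> funs n S d" for t \<pi>
    using that perms_less[OF that(1)] by (auto simp: funs_def) (meson not_less)
  have "bij_betw (\<lambda>t. t \<circ> \<pi>) (funs n S d) (funs n S d)"
    by (rule bij_betwI[where g="\<lambda>t. t \<circ> inv \<pi>"])
       (use assms in \<open>auto intro!: * permutes_inv simp: o_assoc[symmetric] permutes_inv_o\<close>)
  from avg_bij[OF this] show ?thesis .
qed

abbreviation faces :: "nat \<Rightarrow> (nat \<Rightarrow> bool) set" where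
  "faces n \<equiv> funs n UNIV False"

lemma faces_nonempty [simp]: "faces n \<noteq> {}" by (simp add: funs_nonempty)

lemma Pi_pmf_faces: "Pi_pmf {..<n} False (\<lambda>_. bernoulli_pmf (1/2)) = pmf_of_set (faces n)"
  by (simp add: bernoulli_pmf_half_conv_pmf_of_set Pi_pmf_of_set funs_eq_PiE_dflt)

lemma avg_bool: "avg UNIV F = (F True + F False) / 2"
  by (simp add: avg_def UNIV_bool)

subsection \<open>Behavioural strategies from mixtures\<close>

text \<open>The last entry of \<open>h\<close> is the value under decision, so only the proper
  prefixes count. The mixture built from this is the conditional acceptance probability given that
  nothing has been accepted yet: each parameter is weighted by its survival probability.\<close>

definition survive :: "('h list \<Rightarrow> real) \<Rightarrow> 'h list \<Rightarrow> real" where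
  "survive Q h = (\<Prod>j<length h - 1. 1 - Q (take (Suc j) h))"

text \<open>The junk value \<open>0 / 0 = 0\<close> occurs only at histories which are reached with probability \<open>0\<close>.\<close>

definition mix :: "'t set \<Rightarrow> ('t \<Rightarrow> 'h list \<Rightarrow> real) \<Rightarrow> 'h list \<Rightarrow> real" where
  "mix \<Theta> Q h = avg \<Theta> (\<lambda>\<theta>. Q \<theta> h * survive (Q \<theta>) h) / avg \<Theta> (\<lambda>\<theta>. survive (Q \<theta>) h)"

lemma survive_bounds:
  assumes "\<And>h. Q h \<in> {0..1}"
  shows "survive Q h \<in> {0..1}"
  unfolding survive_def using assms by (auto intro!: prod_nonneg prod_le_1)

lemma mix_bounds:
  assumes "\<And>\<theta> h. \<theta> \<in> \<Theta> \<Longrightarrow> Q \<theta> h \<in> {0..1}"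
  shows "mix \<Theta> Q h \<in> {0..1}"
proof -
  have s: "survive (Q \<theta>) h \<in> {0..1}" if "\<theta> \<in> \<Theta>" for \<theta> using survive_bounds assms that by blast
  have 0: "0 \<le> avg \<Theta> (\<lambda>\<theta>. Q \<theta> h * survive (Q \<theta>) h)"
    unfolding avg_def using s assms by (intro divide_nonneg_nonneg sum_nonneg mult_nonneg_nonneg) auto
  have 1: "avg \<Theta> (\<lambda>\<theta>. Q \<theta> h * survive (Q \<theta>) h) \<le> avg \<Theta> (\<lambda>\<theta>. survive (Q \<theta>) h)"
    using s assms by (intro avg_mono mult_left_le_one_le) auto
  show ?thesis using 0 1 by (auto simp: mix_def divide_le_eq_1)
qed

lemma survive_map_upt:
  "survive Q (map g [0..<Suc k]) = (\<Prod>j<k. 1 - Q (map g [0..<Suc j]))"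
  unfolding survive_def by (intro prod.cong) (auto simp: take_map simp del: upt_Suc)

text \<open>The factors \<open>1 - mix\<close> are ratios of consecutive averaged survival
  probabilities, so their product telescopes.\<close>

lemma survive_mix:
  assumes b: "\<And>\<theta> h. \<theta> \<in> \<Theta> \<Longrightarrow> Q \<theta> h \<in> {0..1}" and "finite \<Theta>" "\<Theta> \<noteq> {}"
  shows "survive (mix \<Theta> Q) (map g [0..<Suc k]) = avg \<Theta> (\<lambda>\<theta>. survive (Q \<theta>) (map g [0..<Suc k]))"
proof (induction k)
  case 0
  then show ?case using assms by (simp add: survive_def avg_const)
next
  case (Suc k)
  let ?h = "map g [0..<Suc k]"
  let ?S = "avg \<Theta> (\<lambda>\<theta>. survive (Q \<theta>) ?h)" and ?R = "avg \<Theta> (\<lambda>\<theta>. Q \<theta> ?h * survive (Q \<theta>) ?h)"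
  have step: "survive P (map g [0..<Suc (Suc k)]) = survive P ?h * (1 - P ?h)" for P
    by (simp only: survive_map_upt prod.lessThan_Suc)
  have s: "survive (Q \<theta>) ?h \<in> {0..1}" if "\<theta> \<in> \<Theta>" for \<theta> using survive_bounds b that by blast
  \<comment> \<open>When the survival mass \<open>?S\<close> vanishes, \<open>?R\<close> lies
    between 0 and \<open>?S\<close> and vanishes too, so the junk value of the quotient does no
    harm.\<close>
  have R: "?R = mix \<Theta> Q ?h * ?S"
  proof (cases "?S = 0")
    case True
    have "0 \<le> ?R" unfolding avg_def using s b
      by (intro divide_nonneg_nonneg sum_nonneg mult_nonneg_nonneg) auto
    moreover have "?R \<le> ?S" using s b by (intro avg_mono mult_left_le_one_le) auto
    ultimately show ?thesis using True by simp
  next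
    case False
    then show ?thesis by (simp add: mix_def)
  qed
  have "survive (mix \<Theta> Q) (map g [0..<Suc (Suc k)]) = ?S - ?R"
    unfolding step Suc.IH by (subst R) (simp add: algebra_simps del: upt_Suc)
  also have "\<dots> = avg \<Theta> (\<lambda>\<theta>. survive (Q \<theta>) (map g [0..<Suc (Suc k)]))"
    unfolding avg_diff[symmetric] step by (simp add: algebra_simps)
  finally show ?case .
qed

text \<open>The acceptance mass at a step is the drop of the survival mass over that step, and
  \<open>survive_mix\<close> averages the survival mass before and after it.\<close>

lemma mix_survive_mix:
  assumes b: "\<And>\<theta> h. \<theta> \<in> \<Theta> \<Longrightarrow> Q \<theta> h \<in> {0..1}" and "finite \<Theta>" "\<Theta> \<noteq> {}"
  shows "mix \<Theta> Q (map g [0..<Suc k]) * survive (mix \<Theta> Q) (map g [0..<Suc k])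
    = avg \<Theta> (\<lambda>\<theta>. Q \<theta> (map g [0..<Suc k]) * survive (Q \<theta>) (map g [0..<Suc k]))"
proof -
  let ?h = "map g [0..<Suc k]"
  have *: "survive P (map g [0..<Suc (Suc k)]) = survive P ?h - P ?h * survive P ?h" for P
    by (simp only: survive_map_upt prod.lessThan_Suc) (simp add: algebra_simps)
  have "survive (mix \<Theta> Q) ?h - mix \<Theta> Q ?h * survive (mix \<Theta> Q) ?h
    = avg \<Theta> (\<lambda>\<theta>. survive (Q \<theta>) ?h) - avg \<Theta> (\<lambda>\<theta>. Q \<theta> ?h * survive (Q \<theta>) ?h)"
    unfolding *[symmetric] avg_diff[symmetric] by (rule survive_mix[OF assms])
  then show ?thesis using survive_mix[where g=g and k=k and Q=Q, OF assms] by linarith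
qed

lemma pick_max_prob_survive:
  "pick_max_prob 0 n v (\<lambda>j. Q (map g [0..<Suc j]))
    = (\<Sum>k | k < n \<and> (\<forall>j<n. v j \<le> v k). Q (map g [0..<Suc k]) * survive Q (map g [0..<Suc k]))"
  unfolding pick_max_prob_def survive_map_upt by (intro sum.cong) (auto simp: atLeast0LessThan)

text \<open>Parameters drawn once before the game are thus simulated by independent decisions at the
  single steps, without changing the success probability.\<close>

lemma pick_max_prob_mix:
  assumes "\<And>\<theta> h. \<theta> \<in> \<Theta> \<Longrightarrow> Q \<theta> h \<in> {0..1}" and "finite \<Theta>" "\<Theta> \<noteq> {}"
  shows "pick_max_prob 0 n v (\<lambda>j. mix \<Theta> Q (map g [0..<Suc j]))
    = avg \<Theta> (\<lambda>\<theta>. pick_max_prob 0 n v (\<lambda>j. Q \<theta> (map g [0..<Suc j])))"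
proof -
  have "pick_max_prob 0 n v (\<lambda>j. mix \<Theta> Q (map g [0..<Suc j]))
    = (\<Sum>k | k < n \<and> (\<forall>j<n. v j \<le> v k). avg \<Theta> (\<lambda>\<theta>. Q \<theta> (map g [0..<Suc k]) * survive (Q \<theta>) (map g [0..<Suc k])))"
    unfolding pick_max_prob_survive[where g=g and Q="mix \<Theta> Q"]
    by (intro sum.cong refl mix_survive_mix assms)
  also have "\<dots> = avg \<Theta> (\<lambda>\<theta>. pick_max_prob 0 n v (\<lambda>j. Q \<theta> (map g [0..<Suc j])))"
    unfolding avg_sum[symmetric] by (intro avg_cong pick_max_prob_survive[symmetric])
  finally show ?thesis .
qed

text \<open>Acceptances at different steps exclude each other; their masses telescope to one minus
  the final survival probability.\<close>

lemma pick_max_prob_bounds: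
  assumes "\<And>j. q j \<in> {0..1}"
  shows "pick_max_prob s n v q \<in> {0..1}"
proof -
  have tel: "(\<Sum>k\<in>{s..<n}. q k * (\<Prod>j\<in>{s..<k}. 1 - q j)) = 1 - (\<Prod>j\<in>{s..<n}. 1 - q j)"
  proof (induction n)
    case (Suc n)
    show ?case
    proof (cases "s \<le> n")
      case True
      then show ?thesis using Suc by (simp add: atLeastLessThanSuc algebra_simps)
    next
      case False
      then show ?thesis by (simp add: not_le)
    qed
  qed simp
  have nn: "0 \<le> q k * (\<Prod>j\<in>{s..<k}. 1 - q j)" for k
    using assms by (auto intro!: mult_nonneg_nonneg prod_nonneg)
  have "pick_max_prob s n v q \<le> (\<Sum>k\<in>{s..<n}. q k * (\<Prod>j\<in>{s..<k}. 1 - q j))"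
    unfolding pick_max_prob_def by (rule sum_mono2) (auto simp: nn)
  also have "\<dots> \<le> 1" unfolding tel using assms by (auto intro!: prod_nonneg)
  finally show ?thesis unfolding pick_max_prob_def by (auto intro!: sum_nonneg simp: nn)
qed

subsection \<open>Random times and thresholds\<close>

text \<open>
  Times are elements of \<open>{..<grid}\<close>, a discretisation of \<open>[0, 1]\<close>. The thresholds are close to those
  maximising the success probability in the limit where the largest sides all lie on different cards.
\<close>

definition grid :: nat where "grid = 40000"

definition tau :: "nat \<Rightarrow> nat" where
  "tau r = (if r = 0 then 0 else if r = 1 then 12000 else if r = 2 then 20000
            else if r = 3 then 25000 else 30000)"

lemma tau_mono: "r \<le> r' \<Longrightarrow> tau r \<le> tau r'"
  by (auto simp: tau_def)

lemma tau_le_grid: "tau r \<le> grid"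
  by (simp add: tau_def grid_def)

lemma tau_min: "tau r = tau (min r 4)"
  by (simp add: tau_def)

lemma grid_pos: "0 < grid" by (simp add: grid_def)

section \<open>Cards arriving before their thresholds\<close>

text \<open>A time has \<open>v + 1\<close> possible values up to \<open>v\<close>, of which
  \<open>min (v + 1) (tau r)\<close> lie below \<open>tau r\<close>. So this is the probability that
  a time is below \<open>tau r\<close>, given that it is at most \<open>v\<close>; the latter has
  probability \<open>hit v\<close>.\<close>

definition early :: "nat \<Rightarrow> nat \<Rightarrow> real" where
  "early v r = min 1 (real (tau r) / real (v + 1))"

definition gain :: "nat \<Rightarrow> nat \<Rightarrow> real" where
  "gain v r = early v (Suc r) - early v r"

definition hit :: "nat \<Rightarrow> real" where
  "hit v = real (v + 1) / real grid"

lemma gain_nonneg: "0 \<le> gain v r"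
proof -
  have "real (tau r) / real (v + 1) \<le> real (tau (Suc r)) / real (v + 1)"
    by (intro divide_right_mono) (simp_all add: tau_mono)
  then show ?thesis unfolding gain_def early_def by linarith
qed

text \<open>Telescoping in \<open>r\<close>; the range stops at 4 because \<open>tau\<close> is
  constant from there on.\<close>

lemma early_eq_sum_gain: "early v r = (\<Sum>i<4. gain v i * of_bool (i < r))"
proof -
  have "early v r = early v (min r 4)" unfolding early_def by (subst tau_min) simp
  also have "\<dots> = (\<Sum>i<min r 4. gain v i)"
    unfolding gain_def by (subst sum_lessThan_telescope) (simp add: early_def tau_def)
  also have "\<dots> = (\<Sum>i<4. gain v i * of_bool (i < r))"
    by (rule sum.mono_neutral_cong_left) auto
  finally show ?thesis .
qed

lemma sum_gain_le_1: "(\<Sum>i<4. gain v i) \<le> 1"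
proof -
  have "(\<Sum>i<4. gain v i) = early v 4" unfolding early_eq_sum_gain by (rule sum.cong) auto
  then show ?thesis by (simp add: early_def)
qed

lemma hit_bounds: "v < grid \<Longrightarrow> 0 \<le> hit v \<and> hit v \<le> 1"
  by (simp add: hit_def divide_le_eq_1 grid_pos)

lemma sum_threshold:
  fixes G :: real
  assumes "v < n"
  shows "(\<Sum>x<n. if x \<le> v then of_bool (x < k) else G) = real (min (v + 1) k) + real (n - (v + 1)) * G"
proof -
  have "(\<Sum>x<n. if x \<le> v then of_bool (x < k) else G)
    = (\<Sum>x<v+1. if x \<le> v then of_bool (x < k) else G)
      + (\<Sum>x\<in>{v+1..<n}. if x \<le> v then of_bool (x < k) else G)"
    using assms by (subst sum.union_disjoint[symmetric]) (auto intro!: sum.cong)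
  also have "(\<Sum>x\<in>{v+1..<n}. if x \<le> v then of_bool (x < k) else G) = real (n - (v + 1)) * G"
    by (subst sum.cong[of _ "{v+1..<n}" _ "\<lambda>_. G"]) auto
  also have "(\<Sum>x<v+1. if x \<le> v then of_bool (x < k) else G) = (\<Sum>x<v+1. of_bool (x < k))"
    by (intro sum.cong) auto
  also have "\<dots> = real (card ({..<v+1} \<inter> {x. x < k}))" by (subst sum_of_bool_eq) (auto simp: Int_def)
  also have "{..<v+1} \<inter> {x. x < k} = {..<min (v+1) k}" by auto
  finally show ?thesis by simp
qed

text \<open>The condition is vacuous if no card of \<open>A\<close> arrives by time
  \<open>v\<close>. Otherwise the best arrival came before its own threshold and could not be
  accepted.\<close>

definition good :: "nat \<Rightarrow> (nat \<Rightarrow> nat) \<Rightarrow> (nat \<Rightarrow> nat) \<Rightarrow> nat set \<Rightarrow> (nat \<Rightarrow> nat) \<Rightarrow> bool" where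
  "good v D u A t \<longleftrightarrow>
     (\<forall>y\<in>A. t y \<le> v \<and> (\<forall>j\<in>A. t j \<le> v \<longrightarrow> D j \<le> D y) \<longrightarrow> t y < tau (u y))"

abbreviation clock_times :: "nat \<Rightarrow> (nat \<Rightarrow> nat) set" where
  "clock_times n \<equiv> funs n {..<grid} 0"

lemma clock_times_nonempty [simp]: "clock_times n \<noteq> {}"
  by (rule funs_nonempty) (use grid_pos in auto)

lemma good_insert:
  assumes "\<And>j. j \<in> A \<Longrightarrow> D j < D b"
  shows "good v D u (insert b A) t = (if t b \<le> v then t b < tau (u b) else good v D u A t)"
  using assms unfolding good_def by (auto simp: not_le dest: leD intro: less_imp_le)

lemma good_update: "b \<notin> A \<Longrightarrow> good v D u A (t(b := x)) = good v D u A t"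
proof -
  assume "b \<notin> A"
  then have "\<And>y. y \<in> A \<Longrightarrow> (t(b := x)) y = t y" by auto
  then show ?thesis unfolding good_def by (simp cong: ball_cong)
qed

text \<open>Cards are added in increasing order of \<open>D\<close>, so the new card
  \<open>b\<close> has the smallest \<open>u\<close>. It arrives by time \<open>v\<close> with
  probability \<open>hit v\<close>, and then the event has conditional probability
  \<open>early v (u b)\<close>; otherwise the old event remains. The left-hand sum obeys the same
  recursion: for \<open>r < u b\<close> both counts are 0 and
  \<open>1 = hit v + (1 - hit v)\<close>, for \<open>u b \<le> r\<close> one more factor
  \<open>1 - hit v\<close> appears. The only loss is at the empty set, where the gains sum to at
  most 1.\<close>

lemma avg_good:
  assumes "finite A" "A \<subseteq> {..<n}" "inj_on D A" "v < grid"
    and "\<And>i j. i \<in> A \<Longrightarrow> j \<in> A \<Longrightarrow> D i \<le> D j \<Longrightarrow> u j \<le> u i"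
  shows "(\<Sum>r<4. gain v r * (1 - hit v) ^ card {i\<in>A. u i \<le> r})
    \<le> avg (clock_times n) (\<lambda>t. of_bool (good v D u A t))"
  using assms
proof (induction A rule: finite_ranking_induct[where f=D])
  case empty
  have "avg (clock_times n) (\<lambda>t. of_bool (good v D u {} t)) = 1"
    by (simp add: good_def avg_const)
  then show ?case using sum_gain_le_1 by simp
next
  case (insert b A)
  show ?case
  proof (cases "b \<in> A")
    case True
    then show ?thesis using insert by (simp add: insert_absorb)
  next
    case False
    have lt: "D j < D b" if "j \<in> A" for j
      using insert.hyps(2)[OF that] insert.prems(2) that False
      by (metis inj_on_contraD insertCI le_neq_implies_less)
    have IH: "(\<Sum>r<4. gain v r * (1 - hit v) ^ card {i\<in>A. u i \<le> r})
      \<le> avg (clock_times n) (\<lambda>t. of_bool (good v D u A t))" (is "?S \<le> ?G")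
      by (rule insert.IH) (use insert.prems in \<open>auto intro: inj_on_subset\<close>)
    have "avg (clock_times n) (\<lambda>t. of_bool (good v D u (insert b A) t))
      = avg {..<grid} (\<lambda>x. avg (clock_times n) (\<lambda>t. of_bool (good v D u (insert b A) (t(b := x)))))"
      by (rule avg_funs_update) (use insert.prems grid_pos in auto)
    also have "\<dots> = avg {..<grid} (\<lambda>x. if x \<le> v then of_bool (x < tau (u b)) else ?G)"
      by (rule avg_cong) (auto simp: good_insert[where D=D and A=A and b=b, OF lt] good_update[OF False] avg_const)
    also have "\<dots> = hit v * early v (u b) + (1 - hit v) * ?G"
    proof -
      have "real (min (v + 1) (tau (u b))) = real (v + 1) * early v (u b)"
        unfolding early_def of_nat_min
        using min_mult_distrib_left[of "real (v + 1)" 1 "real (tau (u b)) / real (v + 1)"] by simp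
      then show ?thesis unfolding avg_def sum_threshold[OF insert.prems(3)]
        using insert.prems(3) grid_pos by (simp add: hit_def field_simps of_nat_diff)
    qed
    finally have eq: "avg (clock_times n) (\<lambda>t. of_bool (good v D u (insert b A) t)) = \<dots>" .
    have "(\<Sum>r<4. gain v r * (1 - hit v) ^ card {i\<in>insert b A. u i \<le> r})
      = (\<Sum>r<4. gain v r * (hit v * of_bool (r < u b) + (1 - hit v) * (1 - hit v) ^ card {i\<in>A. u i \<le> r}))"
    proof (intro sum.cong refl arg_cong2[where f="(*)"])
      fix r
      show "(1 - hit v) ^ card {i\<in>insert b A. u i \<le> r}
        = hit v * of_bool (r < u b) + (1 - hit v) * (1 - hit v) ^ card {i\<in>A. u i \<le> r}"
      proof (cases "r < u b")
        case True
        have "u b \<le> u i" if "i \<in> A" for i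
          using insert.prems(4)[of i b] lt[OF that] that by auto
        then have "{i\<in>A. u i \<le> r} = {}" "{i\<in>insert b A. u i \<le> r} = {}" using True by fastforce+
        then have "card {i\<in>A. u i \<le> r} = 0" "card {i\<in>insert b A. u i \<le> r} = 0" by (simp_all only: card.empty)
        then show ?thesis using True by simp
      next
        case f: False
        then have "{i\<in>insert b A. u i \<le> r} = insert b {i\<in>A. u i \<le> r}" by auto
        then show ?thesis using f False insert.hyps(1) by simp
      qed
    qed
    also have "\<dots> = hit v * early v (u b) + (1 - hit v) * ?S"
      unfolding early_eq_sum_gain sum_distrib_left sum.distrib[symmetric]
      by (intro sum.cong refl) (simp add: algebra_simps)
    also have "\<dots> \<le> hit v * early v (u b) + (1 - hit v) * ?G"
      using IH hit_bounds[OF insert.prems(3)] by (simp add: mult_left_mono)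
    finally show ?thesis unfolding eq .
  qed
qed

text \<open>
  \<open>cc r d\<close> is the discretised \<open>c\<^sub>r(d)\<close> of the introduction; for \<open>d = 0\<close>, where \<open>d - 1 = 0\<close> on the
  naturals, the correction accounts for winning cards that arrive before their threshold.
\<close>

definition cc :: "nat \<Rightarrow> nat \<Rightarrow> real" where
  "cc r d = avg {..<grid} (\<lambda>v. gain v r * (1 - hit v) ^ (d - 1))
     - of_bool (d = 0) * real (tau (Suc r) - tau r) / real grid"

text \<open>
  If \<open>w\<close> holds the largest face-down number and the largest face-down number among the other cards
  with times up to that of \<open>w\<close> came too early to be accepted, then nothing is accepted before \<open>w\<close>,
  because a smaller number has at least as many face-up numbers above it.
\<close>

definition wins :: "nat \<Rightarrow> (nat \<Rightarrow> nat) \<Rightarrow> (nat \<Rightarrow> nat) \<Rightarrow> nat \<Rightarrow> (nat \<Rightarrow> nat) \<Rightarrow> bool" where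
  "wins n D u w t \<longleftrightarrow> tau (u w) \<le> t w \<and> good (t w) D u ({..<n} - {w}) t"

text \<open>With the time of \<open>w\<close> fixed to \<open>v\<close>, \<open>avg_good\<close>
  applies to the other cards, of which \<open>?d r - 1\<close> count at a level \<open>r\<close>
  that contains \<open>w\<close>. If \<open>v\<close> is below the threshold of \<open>w\<close>,
  the event fails, and the bound survives because \<open>?S v - 1 \<le> 0\<close>.\<close>

lemma avg_wins:
  assumes "inj_on D {..<n}" "w < n" "\<And>i. i < n \<Longrightarrow> D i \<le> D w"
    and anti: "\<And>i j. i < n \<Longrightarrow> j < n \<Longrightarrow> D i \<le> D j \<Longrightarrow> u j \<le> u i"
  shows "(\<Sum>r<4. cc r (card {i. i < n \<and> u i \<le> r})) \<le> avg (clock_times n) (\<lambda>t. of_bool (wins n D u w t))"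
proof -
  let ?A = "{..<n} - {w}"
  let ?d = "\<lambda>r. card {i. i < n \<and> u i \<le> r}"
  let ?S = "\<lambda>v. \<Sum>r<4. gain v r * (1 - hit v) ^ (?d r - 1)"
  have uw: "u w \<le> u i" if "i < n" for i using anti assms that by blast
  have d0: "?d r = 0 \<longleftrightarrow> r < u w" for r
    using uw assms(2) by (auto simp: card_eq_0_iff not_le intro: less_le_trans)
  have e: "card {i\<in>?A. u i \<le> r} = ?d r - 1" for r
  proof (cases "u w \<le> r")
    case True
    then have "{i. i < n \<and> u i \<le> r} = insert w {i\<in>?A. u i \<le> r}" using assms(2) by auto
    then show ?thesis by simp
  next
    case False
    then have "{i\<in>?A. u i \<le> r} = {}" using uw by fastforce
    then have "card {i\<in>?A. u i \<le> r} = 0" by (simp only: card.empty)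
    moreover have "?d r = 0" unfolding d0 using False by simp
    ultimately show ?thesis by linarith
  qed
  have S: "?S v \<le> avg (clock_times n) (\<lambda>t. of_bool (good v D u ?A t))" if "v < grid" for v
    unfolding e[symmetric]
    by (rule avg_good) (use that assms(1) anti in \<open>auto intro: inj_on_subset\<close>)
  have S1: "?S v \<le> 1" if "v < grid" for v
  proof -
    have "?S v \<le> (\<Sum>r<4. gain v r)"
      using hit_bounds[OF that] gain_nonneg by (intro sum_mono mult_left_le power_le_one) auto
    then show ?thesis using sum_gain_le_1[of v] by linarith
  qed
  \<comment> \<open>\<open>?d r = 0\<close> means \<open>r < u w\<close>, so the probability that
    \<open>w\<close> comes before its threshold telescopes into exactly the corrections contained in
    \<open>cc\<close>.\<close>
  have tau: "avg {..<grid} (\<lambda>v. of_bool (v < tau (u w))) = (\<Sum>r<4. of_bool (?d r = 0) * real (tau (Suc r) - tau r) / real grid)"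
  proof -
    have "(\<Sum>v<grid. of_bool (v < tau (u w)) :: real) = real (card {..<tau (u w)})"
    proof -
      have "{..<grid} \<inter> {v. v < tau (u w)} = {..<tau (u w)}" using tau_le_grid[of "u w"] by auto
      then show ?thesis by (subst sum_of_bool_eq) simp_all
    qed
    also have "\<dots> = real (tau (min (u w) 4)) " by (subst tau_min) simp
    also have "\<dots> = (\<Sum>r<min (u w) 4. real (tau (Suc r) - tau r))"
      using sum_lessThan_telescope[of "\<lambda>r. real (tau r)" "min (u w) 4"]
      by (simp add: of_nat_diff tau_mono) (simp add: tau_def)
    also have "\<dots> = (\<Sum>r<4. of_bool (?d r = 0) * real (tau (Suc r) - tau r))"
      unfolding d0 by (rule sum.mono_neutral_cong_left) auto
    finally have *: "(\<Sum>v<grid. of_bool (v < tau (u w)) :: real) = \<dots>" .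
    show ?thesis unfolding avg_def * by (simp only: sum_divide_distrib card_lessThan)
  qed
  have "(\<Sum>r<4. cc r (?d r)) = avg {..<grid} (\<lambda>v. ?S v - of_bool (v < tau (u w)))"
    unfolding cc_def sum_subtractf avg_diff tau avg_sum ..
  also have "\<dots> \<le> avg {..<grid} (\<lambda>v. avg (clock_times n) (\<lambda>t. of_bool (wins n D u w (t(w := v)))))"
  proof (rule avg_mono)
    fix v assume v: "v \<in> {..<grid}"
    have "wins n D u w (t(w := v)) \<longleftrightarrow> tau (u w) \<le> v \<and> good v D u ?A t" for t
      unfolding wins_def by (simp add: good_update)
    then show "?S v - of_bool (v < tau (u w)) \<le> avg (clock_times n) (\<lambda>t. of_bool (wins n D u w (t(w := v))))"
      using S[of v] S1[of v] v by (cases "tau (u w) \<le> v") (simp_all add: avg_const)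
  qed
  also have "\<dots> = avg (clock_times n) (\<lambda>t. of_bool (wins n D u w t))"
    by (rule avg_funs_update[symmetric]) (use assms grid_pos in auto)
  finally show ?thesis .
qed

subsection \<open>Random faces\<close>

text \<open>Expectation of \<open>F\<close> at the number of heads in \<open>m\<close> fair coin
  tosses.\<close>

fun bin_avg :: "nat \<Rightarrow> (nat \<Rightarrow> real) \<Rightarrow> real" where
  "bin_avg 0 F = F 0"
| "bin_avg (Suc m) F = (bin_avg m F + bin_avg m (\<lambda>k. F (Suc k))) / 2"

lemma avg_faces_card:
  assumes "finite S" "S \<subseteq> {..<n}"
  shows "avg (faces n) (\<lambda>g. F (card {i\<in>S. g i \<noteq> b i})) = bin_avg (card S) F"
  using assms
proof (induction S arbitrary: F rule: finite_induct)
  case empty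
  then show ?case by (simp add: avg_const)
next
  case (insert j S)
  have *: "card {i\<in>insert j S. (g(j := x)) i \<noteq> b i} = (if x \<noteq> b j then Suc (card {i\<in>S. g i \<noteq> b i}) else card {i\<in>S. g i \<noteq> b i})" for g x
  proof -
    have "{i\<in>insert j S. (g(j := x)) i \<noteq> b i} = (if x \<noteq> b j then insert j {i\<in>S. g i \<noteq> b i} else {i\<in>S. g i \<noteq> b i})"
      using insert.hyps by auto
    then show ?thesis using insert.hyps by simp
  qed
  have "avg (faces n) (\<lambda>g. F (card {i\<in>insert j S. g i \<noteq> b i}))
    = avg UNIV (\<lambda>x. avg (faces n) (\<lambda>g. F (card {i\<in>insert j S. (g(j := x)) i \<noteq> b i})))"
    by (rule avg_funs_update) (use insert.prems in auto)
  also have "\<dots> = (bin_avg (card S) F + bin_avg (card S) (\<lambda>k. F (Suc k))) / 2"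
  proof -
    have 1: "avg (faces n) (\<lambda>g. F (card {i\<in>S. g i \<noteq> b i})) = bin_avg (card S) F"
      and 2: "avg (faces n) (\<lambda>g. F (Suc (card {i\<in>S. g i \<noteq> b i}))) = bin_avg (card S) (\<lambda>k. F (Suc k))"
      using insert.IH[of F] insert.IH[of "\<lambda>k. F (Suc k)"] insert.prems by auto
    show ?thesis unfolding avg_bool * using 1 2 by (cases "b j") (simp_all add: field_simps)
  qed
  finally show ?case using insert.hyps by simp
qed

lemma card_disjoint_sum:
  "finite A \<Longrightarrow> finite B \<Longrightarrow> A \<inter> B = {} \<Longrightarrow> C = A \<union> B \<Longrightarrow> card C = card A + card B"
  by (simp add: card_Un_disjoint)

text \<open>\<open>\<kappa> i b\<close> is the rank, from below, of side \<open>b\<close> of card \<open>i\<close> among all \<open>2 * n\<close> sides.\<close>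

definition ranking :: "nat \<Rightarrow> (nat \<Rightarrow> bool \<Rightarrow> nat) \<Rightarrow> bool" where
  "ranking n \<kappa> \<longleftrightarrow> bij_betw (\<lambda>(i, b). \<kappa> i b) ({..<n} \<times> UNIV) {..<2 * n}"

definition ups_above :: "nat \<Rightarrow> (nat \<Rightarrow> bool \<Rightarrow> nat) \<Rightarrow> (nat \<Rightarrow> bool) \<Rightarrow> nat \<Rightarrow> nat" where
  "ups_above n \<kappa> g i = card {l. l < n \<and> \<kappa> i (\<not> g i) < \<kappa> l (g l)}"

text \<open>This is \<open>d\<^sub>r\<close> of the introduction, for the faces
  \<open>g\<close>.\<close>

definition high_downs :: "nat \<Rightarrow> (nat \<Rightarrow> bool \<Rightarrow> nat) \<Rightarrow> (nat \<Rightarrow> bool) \<Rightarrow> nat \<Rightarrow> nat" where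
  "high_downs n \<kappa> g r = card {i. i < n \<and> ups_above n \<kappa> g i \<le> r}"

text \<open>The inequality says that the side is one of the \<open>N\<close> largest; it avoids the
  truncated difference \<open>2 * n - N\<close>.\<close>

definition top_pairs :: "nat \<Rightarrow> (nat \<Rightarrow> bool \<Rightarrow> nat) \<Rightarrow> nat \<Rightarrow> nat" where
  "top_pairs n \<kappa> N = card {i. i < n \<and> (\<forall>b. 2 * n \<le> \<kappa> i b + N)}"

lemma ranking_inj:
  assumes "ranking n \<kappa>" "i < n" "j < n" "\<kappa> i b = \<kappa> j c"
  shows "i = j \<and> b = c"
proof -
  have "inj_on (\<lambda>(i, b). \<kappa> i b) ({..<n} \<times> UNIV)" using assms(1) by (simp add: ranking_def bij_betw_def)
  from inj_onD[OF this, of "(i, b)" "(j, c)"] assms show ?thesis by simp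
qed

lemma card_top:
  assumes "ranking n \<kappa>" "N \<le> 2 * n"
  shows "card {(i, b). i < n \<and> 2 * n \<le> \<kappa> i b + N} = N"
proof -
  let ?k = "\<lambda>(i, b). \<kappa> i b" and ?Z = "{(i, b). i < n \<and> 2 * n \<le> \<kappa> i b + N}"
  have inj: "inj_on ?k ?Z" and im: "?k ` ({..<n} \<times> UNIV) = {..<2 * n}"
    using assms(1) by (auto simp: ranking_def bij_betw_def intro: inj_on_subset)
  have "?k ` ?Z = {2 * n - N..<2 * n}"
  proof (intro equalityI subsetI)
    fix x assume "x \<in> ?k ` ?Z"
    then obtain i b where ib: "x = \<kappa> i b" "i < n" "2 * n \<le> \<kappa> i b + N" by auto
    have "?k (i, b) \<in> {..<2 * n}" unfolding im[symmetric] by (rule imageI) (use ib in auto)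
    then show "x \<in> {2 * n - N..<2 * n}" using ib by auto
  next
    fix x assume x: "x \<in> {2 * n - N..<2 * n}"
    then have "x \<in> ?k ` ({..<n} \<times> UNIV)" unfolding im by simp
    then obtain i b where ib: "i < n" "x = ?k (i, b)" by auto
    show "x \<in> ?k ` ?Z" by (rule image_eqI[where x="(i, b)"]) (use x ib in auto)
  qed
  then show ?thesis using card_image[OF inj] assms(2) by simp
qed

lemma card_top_split:
  fixes \<kappa> :: "nat \<Rightarrow> bool \<Rightarrow> nat"
  shows "card {(i, b). i < n \<and> 2 * n \<le> \<kappa> i b + N}
    = card {i. i < n \<and> 2 * n \<le> \<kappa> i (g i) + N} + card {i. i < n \<and> 2 * n \<le> \<kappa> i (\<not> g i) + N}"
proof -
  let ?U = "{i. i < n \<and> 2 * n \<le> \<kappa> i (g i) + N}" and ?D = "{i. i < n \<and> 2 * n \<le> \<kappa> i (\<not> g i) + N}"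
  have "{(i, b). i < n \<and> 2 * n \<le> \<kappa> i b + N} = (\<lambda>i. (i, g i)) ` ?U \<union> (\<lambda>i. (i, \<not> g i)) ` ?D"
  proof (intro equalityI subsetI)
    fix x assume x: "x \<in> {(i, b). i < n \<and> 2 * n \<le> \<kappa> i b + N}"
    obtain i b where ib: "x = (i, b)" by (cases x)
    show "x \<in> (\<lambda>i. (i, g i)) ` ?U \<union> (\<lambda>i. (i, \<not> g i)) ` ?D"
    proof (cases "b = g i")
      case True
      then show ?thesis using x ib by simp
    next
      case False
      then have "b = (\<not> g i)" by auto
      then show ?thesis using x ib by simp
    qed
  qed auto
  moreover have "card ((\<lambda>i. (i, g i)) ` ?U) = card ?U" "card ((\<lambda>i. (i, \<not> g i)) ` ?D) = card ?D"
    by (auto intro!: card_image inj_onI)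
  moreover have "(\<lambda>i. (i, g i)) ` ?U \<inter> (\<lambda>i. (i, \<not> g i)) ` ?D = {}" by auto
  ultimately show ?thesis by (simp add: card_Un_disjoint)
qed

text \<open>If fewer than \<open>k\<close> of the \<open>r + k\<close> largest sides are face-down,
  then more than \<open>r\<close> of them are face-up, and no face-down side outside them can count.
  If at least \<open>k\<close> are face-down, then at most \<open>r\<close> are face-up, and all
  these face-down sides count.\<close>

lemma high_downs_ge_iff:
  assumes "ranking n \<kappa>" "r + k \<le> 2 * n"
  shows "k \<le> high_downs n \<kappa> g r \<longleftrightarrow> k \<le> card {i. i < n \<and> 2 * n \<le> \<kappa> i (\<not> g i) + (r + k)}"
proof
  let ?U = "{i. i < n \<and> 2 * n \<le> \<kappa> i (g i) + (r + k)}" and ?D = "{i. i < n \<and> 2 * n \<le> \<kappa> i (\<not> g i) + (r + k)}"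
  have sum: "card ?U + card ?D = r + k"
    using card_top[OF assms] card_top_split[of n \<kappa> "r + k" g] by simp
  show "k \<le> card ?D" if "k \<le> high_downs n \<kappa> g r"
  proof (rule ccontr)
    assume "\<not> k \<le> card ?D"
    then have lt: "card ?D < high_downs n \<kappa> g r" and U: "r < card ?U" using that sum by linarith+
    have "\<not> {i. i < n \<and> ups_above n \<kappa> g i \<le> r} \<subseteq> ?D"
      using card_mono[of ?D "{i. i < n \<and> ups_above n \<kappa> g i \<le> r}"] lt unfolding high_downs_def by auto
    then obtain q where q: "q < n" "ups_above n \<kappa> g q \<le> r" "q \<notin> ?D" by blast
    have "card ?U \<le> ups_above n \<kappa> g q" unfolding ups_above_def
      using q by (intro card_mono) auto
    then show False using q U by simp
  qed
  show "k \<le> high_downs n \<kappa> g r" if k: "k \<le> card ?D"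
  proof -
    have "ups_above n \<kappa> g i \<le> r" if "i \<in> ?D" for i
    proof -
      have "ups_above n \<kappa> g i \<le> card ?U" unfolding ups_above_def using that by (intro card_mono) auto
      then show ?thesis using sum k by linarith
    qed
    then have "card ?D \<le> high_downs n \<kappa> g r" unfolding high_downs_def by (intro card_mono) auto
    then show ?thesis using k by linarith
  qed
qed

text \<open>If \<open>k \<le> n\<close>, then \<open>n \<le> r\<close>, so every face-down number
  counts.\<close>

lemma high_downs_large:
  assumes "2 * n < r + k"
  shows "k \<le> high_downs n \<kappa> g r \<longleftrightarrow> k \<le> n"
proof
  have "high_downs n \<kappa> g r \<le> card {..<n}" unfolding high_downs_def by (intro card_mono) auto
  then show "k \<le> n" if "k \<le> high_downs n \<kappa> g r" using that by simp
  show "k \<le> high_downs n \<kappa> g r" if "k \<le> n"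
  proof -
    have "ups_above n \<kappa> g i \<le> card {..<n}" for i unfolding ups_above_def by (intro card_mono) auto
    then have "ups_above n \<kappa> g i \<le> n" for i by simp
    moreover have "n \<le> r" using assms that by linarith
    ultimately have "ups_above n \<kappa> g i \<le> r" for i using le_trans by blast
    then have "{i. i < n \<and> ups_above n \<kappa> g i \<le> r} = {..<n}" by auto
    then show ?thesis using that unfolding high_downs_def by simp
  qed
qed

definition top_prob :: "nat \<Rightarrow> (nat \<Rightarrow> bool \<Rightarrow> nat) \<Rightarrow> nat \<Rightarrow> nat \<Rightarrow> real" where
  "top_prob n \<kappa> N k = (if N \<le> 2 * n
     then bin_avg (N - 2 * top_pairs n \<kappa> N) (\<lambda>j. of_bool (k \<le> top_pairs n \<kappa> N + j))
     else of_bool (k \<le> n))"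

lemma top_pairs_le: 
  assumes "ranking n \<kappa>" "N \<le> 2 * n"
  shows "2 * top_pairs n \<kappa> N \<le> N"
proof -
  let ?P = "{i. i < n \<and> (\<forall>b. 2 * n \<le> \<kappa> i b + N)}"
  have "top_pairs n \<kappa> N \<le> card {i. i < n \<and> 2 * n \<le> \<kappa> i True + N}"
    "top_pairs n \<kappa> N \<le> card {i. i < n \<and> 2 * n \<le> \<kappa> i False + N}"
    unfolding top_pairs_def by (intro card_mono; auto)+
  then show ?thesis using card_top[OF assms] card_top_split[of n \<kappa> N "\<lambda>_. True"] by simp
qed

text \<open>For \<open>N = r + k \<le> 2 * n\<close>, a card with both sides among the
  \<open>N\<close> largest contributes one face-down side whatever its face, and a card with exactly
  one such side contributes a fair coin. There are \<open>N - 2 * top_pairs n \<kappa> N\<close>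
  cards of the second kind.\<close>

lemma avg_high_downs:
  assumes "ranking n \<kappa>"
  shows "avg (faces n) (\<lambda>g. of_bool (k \<le> high_downs n \<kappa> g r)) = top_prob n \<kappa> (r + k) k"
proof (cases "r + k \<le> 2 * n")
  case True
  let ?N = "r + k"
  let ?P = "{i. i < n \<and> (\<forall>b. 2 * n \<le> \<kappa> i b + ?N)}"
  let ?S = "{i. i < n \<and> (2 * n \<le> \<kappa> i True + ?N \<longleftrightarrow> \<not> 2 * n \<le> \<kappa> i False + ?N)}"
  let ?b = "\<lambda>i. 2 * n \<le> \<kappa> i True + ?N"
  \<comment> \<open>For a card in \<open>?S\<close>, \<open>?b i\<close> is the side among the
    \<open>?N\<close> largest; it is face-down exactly when
    \<open>g i \<noteq> ?b i\<close>.\<close>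
  have X: "card {i. i < n \<and> 2 * n \<le> \<kappa> i (\<not> g i) + ?N} = top_pairs n \<kappa> ?N + card {i\<in>?S. g i \<noteq> ?b i}" for g
  proof -
    have "{i. i < n \<and> 2 * n \<le> \<kappa> i (\<not> g i) + ?N} = ?P \<union> {i\<in>?S. g i \<noteq> ?b i}"
    proof (rule set_eqI)
      fix i
      show "i \<in> {i. i < n \<and> 2 * n \<le> \<kappa> i (\<not> g i) + ?N} \<longleftrightarrow> i \<in> ?P \<union> {i\<in>?S. g i \<noteq> ?b i}"
        by (cases "g i") (auto simp: all_bool_eq)
    qed
    moreover have "?P \<inter> {i\<in>?S. g i \<noteq> ?b i} = {}" by auto
    ultimately show ?thesis unfolding top_pairs_def by (simp add: card_Un_disjoint)
  qed
  have "?N = card {i. i < n \<and> 2 * n \<le> \<kappa> i True + ?N} + card {i. i < n \<and> 2 * n \<le> \<kappa> i False + ?N}"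
    using card_top[OF assms True] card_top_split[of n \<kappa> ?N "\<lambda>_. True"] by simp
  also have "card {i. i < n \<and> 2 * n \<le> \<kappa> i True + ?N}
    = card ?P + card {i. i < n \<and> 2 * n \<le> \<kappa> i True + ?N \<and> \<not> 2 * n \<le> \<kappa> i False + ?N}"
    by (rule card_disjoint_sum) (auto simp: all_bool_eq)
  also have "card {i. i < n \<and> 2 * n \<le> \<kappa> i False + ?N}
    = card ?P + card {i. i < n \<and> \<not> 2 * n \<le> \<kappa> i True + ?N \<and> 2 * n \<le> \<kappa> i False + ?N}"
    by (rule card_disjoint_sum) (auto simp: all_bool_eq)
  finally have "?N = 2 * card ?P + (card {i. i < n \<and> 2 * n \<le> \<kappa> i True + ?N \<and> \<not> 2 * n \<le> \<kappa> i False + ?N}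
     + card {i. i < n \<and> \<not> 2 * n \<le> \<kappa> i True + ?N \<and> 2 * n \<le> \<kappa> i False + ?N})" by linarith
  also have "card {i. i < n \<and> 2 * n \<le> \<kappa> i True + ?N \<and> \<not> 2 * n \<le> \<kappa> i False + ?N}
     + card {i. i < n \<and> \<not> 2 * n \<le> \<kappa> i True + ?N \<and> 2 * n \<le> \<kappa> i False + ?N} = card ?S"
    by (rule card_disjoint_sum[symmetric]) auto
  finally have S: "card ?S = ?N - 2 * top_pairs n \<kappa> ?N" by (simp add: top_pairs_def)
  show ?thesis unfolding high_downs_ge_iff[OF assms True] X
    using avg_faces_card[of ?S n "\<lambda>j. of_bool (k \<le> top_pairs n \<kappa> ?N + j)" ?b] True S
    by (auto simp: top_prob_def)
next
  case False
  then show ?thesis by (simp add: high_downs_large avg_const top_prob_def)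
qed

text \<open>One additional side completes at most one card. This couples the numbers of complete
  cards at \<open>N = 4\<close> and \<open>N = 5\<close>.\<close>

lemma top_pairs_Suc:
  assumes "ranking n \<kappa>"
  shows "top_pairs n \<kappa> (Suc N) \<le> Suc (top_pairs n \<kappa> N)"
proof -
  let ?P = "\<lambda>N. {i. i < n \<and> (\<forall>b. 2 * n \<le> \<kappa> i b + N)}"
  have *: "i = j" if "i \<in> ?P (Suc N) - ?P N" "j \<in> ?P (Suc N) - ?P N" for i j
  proof -
    from that obtain b c where "\<not> 2 * n \<le> \<kappa> i b + N" "\<not> 2 * n \<le> \<kappa> j c + N" "i < n" "j < n" by auto
    moreover from that have "2 * n \<le> \<kappa> i b + Suc N" "2 * n \<le> \<kappa> j c + Suc N" by auto
    ultimately have "\<kappa> i b = \<kappa> j c" by linarith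
    then show ?thesis using ranking_inj assms \<open>i < n\<close> \<open>j < n\<close> by blast
  qed
  have "card (?P (Suc N) - ?P N) \<le> 1" using * by (auto simp: card_le_Suc0_iff_eq)
  moreover have "card (?P (Suc N)) \<le> card (?P N \<union> (?P (Suc N) - ?P N))" by (intro card_mono) auto
  moreover have "card (?P N \<union> (?P (Suc N) - ?P N)) \<le> card (?P N) + card (?P (Suc N) - ?P N)" by (rule card_Un_le)
  ultimately show "top_pairs n \<kappa> (Suc N) \<le> Suc (top_pairs n \<kappa> N)" unfolding top_pairs_def by linarith
qed

subsection \<open>Numerical bounds\<close>

lemma power_Suc_diff_ge:
  fixes q h :: real
  assumes "0 \<le> q" "0 \<le> h"
  shows "real (Suc k) * h * q ^ k \<le> (q + h) ^ Suc k - q ^ Suc k"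
proof (induction k)
  case (Suc k)
  have "real (Suc (Suc k)) * h * q ^ Suc k \<le> (q + h) * (q ^ Suc k + real (Suc k) * h * q ^ k) - q ^ Suc (Suc k)"
    using assms by (simp add: algebra_simps)
  also have "\<dots> \<le> (q + h) * (q + h) ^ Suc k - q ^ Suc (Suc k)"
    using Suc assms by (intro diff_right_mono mult_left_mono) auto
  finally show ?case by simp
qed (use assms in simp)

text \<open>The right-hand side is the mean of \<open>x ^ k\<close> over the interval from
  \<open>q\<close> to \<open>q + 1 / T\<close>.\<close>

lemma power_le_diff_Suc:
  fixes q :: real
  assumes "0 \<le> q" "0 < T"
  shows "q ^ k \<le> T / real (Suc k) * ((q + 1 / T) ^ Suc k - q ^ Suc k)"
proof -
  have "q ^ k = T / real (Suc k) * (real (Suc k) * (1 / T) * q ^ k)" using assms by simp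
  also have "\<dots> \<le> T / real (Suc k) * ((q + 1 / T) ^ Suc k - q ^ Suc k)"
    using power_Suc_diff_ge[of q "1 / T" k] assms by (intro mult_left_mono) auto
  finally show ?thesis .
qed

text \<open>A Riemann sum at right endpoints is compared with the integral of a decreasing function,
  one grid cell at a time.\<close>

lemma sum_power_tail_le:
  fixes T :: nat
  assumes "A \<le> T"
  shows "(\<Sum>v\<in>{A..<T}. (1 - real (v + 1) / real T) ^ j) \<le> real T / real (Suc j) * (1 - real A / real T) ^ Suc j"
  using assms
proof (induction rule: inc_induct)
  case base
  then show ?case by (cases "T = 0") auto
next
  case (step A)
  then have T: "0 < T" by simp
  have "(\<Sum>v\<in>{A..<T}. (1 - real (v + 1) / real T) ^ j)
    = (1 - real (A + 1) / real T) ^ j + (\<Sum>v\<in>{Suc A..<T}. (1 - real (v + 1) / real T) ^ j)"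
    using step.hyps by (simp add: sum.atLeast_Suc_lessThan)
  also have "(1 - real (A + 1) / real T) ^ j
    \<le> real T / real (Suc j) * ((1 - real (A + 1) / real T + 1 / real T) ^ Suc j - (1 - real (A + 1) / real T) ^ Suc j)"
    using step.hyps T by (intro power_le_diff_Suc) (auto simp: field_simps)
  also have "1 - real (A + 1) / real T + 1 / real T = 1 - real A / real T" using T by (simp add: field_simps)
  finally show ?case using step.IH by (simp add: right_diff_distrib)
qed

text \<open>Raising \<open>B\<close> by one adds the tail sum from \<open>B\<close> on, so a double
  sum is compared with a double integral. The outer sum takes a decreasing function at left
  endpoints, which causes the shift by \<open>1 / T\<close>.\<close>

lemma sum_min_power_le:
  fixes T :: nat
  assumes "A \<le> B" "B \<le> T"
  shows "(\<Sum>v<T. (real (min (v + 1) B) - real (min (v + 1) A)) * (1 - real (v + 1) / real T) ^ j)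
    \<le> real T ^ 2 / (real (Suc j) * real (Suc (Suc j)))
        * ((1 - real A / real T + 1 / real T) ^ Suc (Suc j) - (1 - real B / real T + 1 / real T) ^ Suc (Suc j))"
  using assms
proof (induction rule: dec_induct)
  case base
  then show ?case by simp
next
  case (step B)
  then have T: "0 < T" "B < T" by simp_all
  let ?p = "\<lambda>v. (1 - real (v + 1) / real T) ^ j"
  let ?q = "1 - real B / real T"
  have "(\<Sum>v<T. (real (min (v + 1) (Suc B)) - real (min (v + 1) A)) * ?p v)
    = (\<Sum>v<T. (real (min (v + 1) B) - real (min (v + 1) A)) * ?p v + of_bool (B \<le> v) * ?p v)"
    by (intro sum.cong refl) (auto simp: min_def algebra_simps not_le split: if_splits)
  also have "\<dots> = (\<Sum>v<T. (real (min (v + 1) B) - real (min (v + 1) A)) * ?p v) + (\<Sum>v<T. of_bool (B \<le> v) * ?p v)"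
    by (rule sum.distrib)
  finally have S: "(\<Sum>v<T. (real (min (v + 1) (Suc B)) - real (min (v + 1) A)) * ?p v)
    = (\<Sum>v<T. (real (min (v + 1) B) - real (min (v + 1) A)) * ?p v) + (\<Sum>v<T. of_bool (B \<le> v) * ?p v)" .
  have "(\<Sum>v<T. of_bool (B \<le> v) * ?p v) = (\<Sum>v\<in>{B..<T}. ?p v)"
    by (rule sum.mono_neutral_cong_right) auto
  also have "\<dots> \<le> real T / real (Suc j) * ?q ^ Suc j" using T by (intro sum_power_tail_le) simp
  also have "\<dots> \<le> real T / real (Suc j) * (real T / real (Suc (Suc j)) * ((?q + 1 / real T) ^ Suc (Suc j) - ?q ^ Suc (Suc j)))"
    using T by (intro mult_left_mono power_le_diff_Suc) auto
  also have "\<dots> = real T ^ 2 / (real (Suc j) * real (Suc (Suc j))) * ((?q + 1 / real T) ^ Suc (Suc j) - ?q ^ Suc (Suc j))"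
    by (simp add: power2_eq_square)
  also have "?q ^ Suc (Suc j) = (1 - real (Suc B) / real T + 1 / real T) ^ Suc (Suc j)"
    using T by (intro arg_cong2[where f=power] refl) (simp add: field_simps)
  finally show ?case unfolding S using step.IH[OF Suc_leD[OF step.prems]]
    by (simp only: right_diff_distrib)
qed

section \<open>Coefficients of the summation by parts\<close>

definition CC :: "nat \<Rightarrow> nat \<Rightarrow> real" where
  "CC r j = avg {..<grid} (\<lambda>v. gain v r * (1 - hit v) ^ j)"

text \<open>For \<open>k \<ge> 2\<close>, the drop of \<open>cc r\<close> from
  \<open>d = k - 1\<close> to \<open>d = k\<close>.\<close>

definition ee :: "nat \<Rightarrow> nat \<Rightarrow> real" where
  "ee r k = CC r (k - 2) - CC r (k - 1)"

text \<open>The factor \<open>hit v\<close> cancels the denominator \<open>v + 1\<close> in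
  \<open>early\<close>. Hence the drops \<open>ee\<close> are sums of piecewise linear functions
  times powers and have closed-form bounds, whereas \<open>CC\<close> itself approximates integrals
  with logarithms.\<close>

lemma gain_hit: "gain v r * hit v = (real (min (v + 1) (tau (Suc r))) - real (min (v + 1) (tau r))) / real grid"
proof -
  have "early v r * real (v + 1) = real (min (v + 1) (tau r))" for r
    unfolding early_def of_nat_min
    using min_mult_distrib_left[of "real (v + 1)" 1 "real (tau r) / real (v + 1)"] by (simp add: mult.commute)
  then show ?thesis unfolding gain_def hit_def by (simp add: left_diff_distrib diff_divide_distrib)
qed

lemma ee_le:
  "ee r (j + 2) \<le> ((1 - real (tau r) / real grid + 1 / real grid) ^ (j + 2)
      - (1 - real (tau (Suc r)) / real grid + 1 / real grid) ^ (j + 2)) / (real (j + 1) * real (j + 2))"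
proof -
  let ?g = "real grid"
  let ?S = "\<Sum>v<grid. (real (min (v + 1) (tau (Suc r))) - real (min (v + 1) (tau r))) * (1 - real (v + 1) / ?g) ^ j"
  have "ee r (j + 2) = avg {..<grid} (\<lambda>v. gain v r * hit v * (1 - hit v) ^ j)"
    unfolding ee_def CC_def avg_diff[symmetric] by (intro avg_cong) (simp add: algebra_simps)
  also have "\<dots> = ?S / ?g ^ 2"
    unfolding gain_hit avg_def by (simp add: hit_def sum_divide_distrib power2_eq_square)
  also have "\<dots> \<le> ?g ^ 2 / (real (Suc j) * real (Suc (Suc j)))
        * ((1 - real (tau r) / ?g + 1 / ?g) ^ Suc (Suc j) - (1 - real (tau (Suc r)) / ?g + 1 / ?g) ^ Suc (Suc j)) / ?g ^ 2"
    by (intro divide_right_mono sum_min_power_le tau_mono tau_le_grid) auto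
  also have "\<dots> = ((1 - real (tau r) / ?g + 1 / ?g) ^ Suc (Suc j) - (1 - real (tau (Suc r)) / ?g + 1 / ?g) ^ Suc (Suc j)) / (real (Suc j) * real (Suc (Suc j)))"
    using grid_pos by simp
  finally show ?thesis by (simp del: power_Suc)
qed

lemma CC_nonneg: "0 \<le> CC r j"
  unfolding CC_def avg_def using hit_bounds gain_nonneg
  by (intro divide_nonneg_nonneg sum_nonneg mult_nonneg_nonneg) auto

text \<open>A gain is at most 1 and vanishes before \<open>tau r\<close>. This crude estimate serves
  for the remainder terms of the summation by parts.\<close>

lemma CC_le: "CC r j \<le> (1 - real (tau r) / real grid) ^ Suc j / real (Suc j)"
proof -
  let ?g = "real grid"
  have z: "gain v r = 0" if "v < tau r" for v
  proof -
    have "real (v + 1) \<le> real (tau r)" "real (v + 1) \<le> real (tau (Suc r))"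
      using that tau_mono[of r "Suc r"] by linarith+
    then show ?thesis by (simp add: gain_def early_def min_def field_simps)
  qed
  have l: "gain v r \<le> 1" for v
    using divide_nonneg_nonneg[of "real (tau r)" "real (v + 1)"] unfolding gain_def early_def by linarith
  have "(\<Sum>v<grid. gain v r * (1 - hit v) ^ j) = (\<Sum>v\<in>{tau r..<grid}. gain v r * (1 - hit v) ^ j)"
    using z by (intro sum.mono_neutral_right) auto
  also have "\<dots> \<le> (\<Sum>v\<in>{tau r..<grid}. 1 * (1 - hit v) ^ j)"
    using l hit_bounds by (intro sum_mono mult_right_mono) auto
  also have "\<dots> \<le> ?g / real (Suc j) * (1 - real (tau r) / ?g) ^ Suc j"
    using sum_power_tail_le[OF tau_le_grid] by (simp add: hit_def)
  finally have "(\<Sum>v<grid. gain v r * (1 - hit v) ^ j) / ?g \<le> ?g / real (Suc j) * (1 - real (tau r) / ?g) ^ Suc j / ?g"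
    by (intro divide_right_mono) auto
  moreover have "CC r j = (\<Sum>v<grid. gain v r * (1 - hit v) ^ j) / ?g" by (simp add: CC_def avg_def)
  moreover have "?g / real (Suc j) * (1 - real (tau r) / ?g) ^ Suc j / ?g = (1 - real (tau r) / ?g) ^ Suc j / real (Suc j)"
    using grid_pos by (simp del: power_Suc)
  ultimately show ?thesis by linarith
qed

text \<open>Summation by parts in \<open>d\<close>; from \<open>M + 1\<close> on only nonnegativity of \<open>CC\<close> is used.\<close>

lemma cc_ge:
  assumes "1 \<le> M"
  shows "CC r 0 - real (tau (Suc r) - tau r) / real grid
      + real (tau (Suc r) - tau r) / real grid * of_bool (1 \<le> d)
      - (\<Sum>k=2..M. ee r k * of_bool (k \<le> d)) - CC r (M - 1) * of_bool (M + 1 \<le> d) \<le> cc r d"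
proof -
  have tel: "(\<Sum>k=2..m. ee r k) = CC r 0 - CC r (m - 1)" if "1 \<le> m" for m
    using that
  proof (induction m rule: dec_induct)
    case (step m)
    have "(\<Sum>k=2..Suc m. ee r k) = (\<Sum>k=2..m. ee r k) + ee r (Suc m)"
      using step.hyps by (simp add: sum.cl_ivl_Suc)
    moreover have "Suc m - 2 = m - 1" by simp
    ultimately show ?case using step by (simp add: ee_def)
  qed simp
  have cc: "cc r d = CC r (d - 1) - of_bool (d = 0) * real (tau (Suc r) - tau r) / real grid"
    by (simp add: cc_def CC_def)
  consider "d = 0" | "1 \<le> d" "d \<le> M" | "M < d" by linarith
  then show ?thesis
  proof cases
    case 1
    then show ?thesis using cc by simp
  next
    case 2
    have "(\<Sum>k=2..M. ee r k * of_bool (k \<le> d)) = (\<Sum>k=2..d. ee r k)"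
      using 2 by (intro sum.mono_neutral_cong_right) auto
    then show ?thesis using 2 tel[of d] by (simp add: cc)
  next
    case 3
    have "(\<Sum>k=2..M. ee r k * of_bool (k \<le> d)) = (\<Sum>k=2..M. ee r k)"
      using 3 by (intro sum.cong) auto
    then show ?thesis using 3 assms tel[of M] CC_nonneg[of r "d - 1"] by (simp add: cc)
  qed
qed

text \<open>The numerical bounds below are the values of \<open>ee_le\<close> and \<open>CC_le\<close>, rounded up.\<close>

lemma ee_bounds:
  "ee 0 2 \<le> 2550075 / 10000000"
  "ee 0 3 \<le> 1095064 / 10000000"
  "ee 0 4 \<le> 633305 / 10000000"
  "ee 0 5 \<le> 416013 / 10000000"
  "ee 0 6 \<le> 294159 / 10000000"
  "ee 0 7 \<le> 218524 / 10000000"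
  "ee 0 8 \<le> 168310 / 10000000"
  "ee 0 9 \<le> 133314 / 10000000"
  "ee 1 2 \<le> 1200050 / 10000000"
  "ee 1 3 \<le> 363364 / 10000000"
  "ee 1 4 \<le> 148019 / 10000000"
  "ee 1 5 \<le> 68422 / 10000000"
  "ee 1 6 \<le> 34015 / 10000000"
  "ee 1 7 \<le> 17753 / 10000000"
  "ee 1 8 \<le> 9600 / 10000000"
  "ee 2 2 \<le> 546907 / 10000000"
  "ee 2 3 \<le> 120457 / 10000000"
  "ee 2 4 \<le> 35610 / 10000000"
  "ee 2 5 \<le> 11920 / 10000000"
  "ee 2 6 \<le> 4283 / 10000000"
  "ee 2 7 \<le> 1613 / 10000000"
  "ee 3 2 \<le> 390657 / 10000000"
  "ee 3 3 \<le> 61859 / 10000000"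
  "ee 3 4 \<le> 13228 / 10000000"
  "ee 3 5 \<le> 3221 / 10000000"
  "ee 3 6 \<le> 846 / 10000000"
  subgoal using ee_le[of 0 0] by (simp add: tau_def grid_def power_divide numeral_2_eq_2)
  subgoal using ee_le[of 0 1] by (simp add: tau_def grid_def power_divide numeral_3_eq_3)
  subgoal using ee_le[of 0 2] by (simp add: tau_def grid_def power_divide)
  subgoal using ee_le[of 0 3] by (simp add: tau_def grid_def power_divide)
  subgoal using ee_le[of 0 4] by (simp add: tau_def grid_def power_divide)
  subgoal using ee_le[of 0 5] by (simp add: tau_def grid_def power_divide)
  subgoal using ee_le[of 0 6] by (simp add: tau_def grid_def power_divide)
  subgoal using ee_le[of 0 7] by (simp add: tau_def grid_def power_divide)
  subgoal using ee_le[of 1 0] by (simp add: tau_def grid_def power_divide numeral_2_eq_2)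
  subgoal using ee_le[of 1 1] by (simp add: tau_def grid_def power_divide numeral_3_eq_3)
  subgoal using ee_le[of 1 2] by (simp add: tau_def grid_def power_divide)
  subgoal using ee_le[of 1 3] by (simp add: tau_def grid_def power_divide)
  subgoal using ee_le[of 1 4] by (simp add: tau_def grid_def power_divide)
  subgoal using ee_le[of 1 5] by (simp add: tau_def grid_def power_divide)
  subgoal using ee_le[of 1 6] by (simp add: tau_def grid_def power_divide)
  subgoal using ee_le[of 2 0] by (simp add: tau_def grid_def power_divide numeral_2_eq_2)
  subgoal using ee_le[of 2 1] by (simp add: tau_def grid_def power_divide numeral_3_eq_3)
  subgoal using ee_le[of 2 2] by (simp add: tau_def grid_def power_divide)
  subgoal using ee_le[of 2 3] by (simp add: tau_def grid_def power_divide)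
  subgoal using ee_le[of 2 4] by (simp add: tau_def grid_def power_divide)
  subgoal using ee_le[of 2 5] by (simp add: tau_def grid_def power_divide)
  subgoal using ee_le[of 3 0] by (simp add: tau_def grid_def power_divide numeral_2_eq_2)
  subgoal using ee_le[of 3 1] by (simp add: tau_def grid_def power_divide numeral_3_eq_3)
  subgoal using ee_le[of 3 2] by (simp add: tau_def grid_def power_divide)
  subgoal using ee_le[of 3 3] by (simp add: tau_def grid_def power_divide)
  subgoal using ee_le[of 3 4] by (simp add: tau_def grid_def power_divide)
  done

lemma CC_bounds:
  "CC 0 8 \<le> 1111112 / 10000000"
  "CC 1 7 \<le> 72061 / 10000000"
  "CC 2 6 \<le> 11161 / 10000000"
  "CC 3 5 \<le> 4635 / 10000000"
  subgoal by (rule order_trans[OF CC_le]) (simp add: tau_def grid_def power_divide del: power_Suc)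
  subgoal by (rule order_trans[OF CC_le]) (simp add: tau_def grid_def power_divide del: power_Suc)
  subgoal by (rule order_trans[OF CC_le]) (simp add: tau_def grid_def power_divide del: power_Suc)
  subgoal by (rule order_trans[OF CC_le]) (simp add: tau_def grid_def power_divide del: power_Suc)
  done

lemma inverse_ge_tangent:
  fixes x c :: real
  assumes "0 < x" "0 < c"
  shows "2 / c - x / c ^ 2 \<le> 1 / x"
proof -
  have "0 \<le> (x - c) ^ 2 / (x * c ^ 2)" using assms by simp
  also have "\<dots> = 1 / x - (2 / c - x / c ^ 2)" using assms by (simp add: field_simps power2_eq_square)
  finally show ?thesis by simp
qed

text \<open>The sum of the values of the tangent to \<open>1 / x\<close> at \<open>c\<close>, which
  lies below by convexity.\<close>

lemma sum_inverse_ge: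
  fixes c :: real
  assumes "a \<le> b" "0 < c"
  shows "real (b - a) * (2 / c) - (real b * (real b + 1) - real a * (real a + 1)) / 2 / c ^ 2
    \<le> (\<Sum>v\<in>{a..<b}. 1 / real (v + 1))"
  using assms(1)
proof (induction rule: dec_induct)
  case (step b)
  have "real (Suc b - a) = real (b - a) + 1" using step.hyps by (simp add: Suc_diff_le)
  then have "real (Suc b - a) * (2 / c) - (real (Suc b) * (real (Suc b) + 1) - real a * (real a + 1)) / 2 / c ^ 2
    = real (b - a) * (2 / c) - (real b * (real b + 1) - real a * (real a + 1)) / 2 / c ^ 2 + (2 / c - real (b + 1) / c ^ 2)"
    using assms(2) by (simp add: field_simps power2_eq_square)
  then show ?case using step inverse_ge_tangent[of "real (b + 1)" c] assms(2) by simp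
qed simp

text \<open>The sum telescopes to the mean of \<open>early v 4\<close>, a Riemann sum for the
  integral of \<open>min 1 (3 / (4 * s))\<close> over the unit interval, which is
  \<open>3 / 4 + 3 / 4 * ln (4 / 3)\<close>. The number 0.28755 is a lower estimate of
  \<open>ln (4 / 3)\<close>, about 0.28768, from tangents at the midpoints of four blocks.\<close>

lemma sum_CC_0: "(\<Sum>r<4. CC r 0) \<ge> 3 / 4 + 3 / 4 * (28755 / 100000)"
proof -
  have "(\<Sum>r<4. CC r 0) = avg {..<grid} (\<lambda>v. early v 4)"
    unfolding CC_def avg_sum[symmetric] early_eq_sum_gain by (intro avg_cong sum.cong) auto
  also have "\<dots> = ((\<Sum>v<30000. early v 4) + (\<Sum>v\<in>{30000..<40000}. early v 4)) / 40000"
    unfolding avg_def grid_def by (subst sum.union_disjoint[symmetric]) (auto intro!: sum.cong arg_cong2[where f="(/)"])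
  also have "(\<Sum>v<30000. early v 4) = 30000"
    by (subst sum.cong[of _ "{..<30000}" _ "\<lambda>_. 1"]) (auto simp: early_def tau_def field_simps)
  also have "(\<Sum>v\<in>{30000..<40000}. early v 4) = 30000 * (\<Sum>v\<in>{30000..<40000}. 1 / real (v + 1))"
    unfolding sum_distrib_left by (intro sum.cong refl) (auto simp: early_def tau_def field_simps)
  also have "(\<Sum>v\<in>{30000..<40000}. 1 / real (v + 1))
    = (\<Sum>v\<in>{30000..<32500}. 1 / real (v + 1)) + (\<Sum>v\<in>{32500..<35000}. 1 / real (v + 1))
      + (\<Sum>v\<in>{35000..<37500}. 1 / real (v + 1)) + (\<Sum>v\<in>{37500..<40000}. 1 / real (v + 1))"
    by (simp only: sum.atLeastLessThan_concat flip: add.assoc)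
  finally have *: "(\<Sum>r<4. CC r 0) = (30000 + 30000 * \<dots>) / 40000" .
  show ?thesis unfolding *
    using sum_inverse_ge[of 30000 32500 31250] sum_inverse_ge[of 32500 35000 33750]
      sum_inverse_ge[of 35000 37500 36250] sum_inverse_ge[of 37500 40000 38750]
    by (simp add: power2_eq_square)
qed

section \<open>Minimisation for each number of top sides\<close>

text \<open>The probability of at least \<open>c\<close> heads in \<open>m\<close> fair coin
  tosses.\<close>

fun tail :: "nat \<Rightarrow> nat \<Rightarrow> real" where
  "tail m 0 = 1"
| "tail 0 (Suc c) = 0"
| "tail (Suc m) (Suc c) = (tail m (Suc c) + tail m c) / 2"

lemma bin_avg_tail: "bin_avg m (\<lambda>j. of_bool (k \<le> p + j)) = tail m (k - p)"
proof (induction m arbitrary: p)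
  case 0
  then show ?case by (cases "k - p") auto
next
  case (Suc m)
  have "bin_avg m (\<lambda>j. of_bool (k \<le> p + Suc j)) = tail m (k - Suc p)"
    using Suc[of "Suc p"] by simp
  then show ?case using Suc[of p] by (cases "k - p") (auto simp: Suc_diff_Suc diff_Suc split: nat.split)
qed

text \<open>
  \<open>shape N P\<close> describes the possible functions \<open>P = top_prob n \<kappa> N\<close>: either \<open>p\<close> cards have both
  sides among the \<open>N\<close> largest, or \<open>2 * n < N\<close>. The case \<open>p = 0\<close> is the worst one for every \<open>N\<close> except
  \<open>5\<close>, where the loss for \<open>p = 2\<close> is compensated by the gain at \<open>N = 4\<close>.
\<close>

definition shape :: "nat \<Rightarrow> (nat \<Rightarrow> real) \<Rightarrow> bool" where
  "shape N P \<longleftrightarrow> (\<exists>p. 2 * p \<le> N \<and> (\<forall>k. P k = tail (N - 2 * p) (k - p)))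
     \<or> (\<exists>n\<ge>1. 2 * n < N \<and> (\<forall>k. P k = of_bool (k \<le> n)))"

text \<open>Here and in the following bounds the terms with \<open>r + k = N\<close> of all four
  levels \<open>r\<close> are collected. The coefficient for \<open>k = 1\<close> is
  \<open>(tau (r + 1) - tau r) / grid\<close>; the others are the negated bounds for
  \<open>ee\<close> or, at \<open>N = 10\<close>, for \<open>CC\<close>. Only finitely many
  \<open>p\<close> and \<open>n\<close> fit a given \<open>N\<close>.\<close>

lemma shape_1_bound:
  assumes "shape 1 P"
  shows "3 / 20 \<le> 3 / 10 * P 1"
  using assms unfolding shape_def
proof (elim disjE exE conjE)
  fix p assume "2 * p \<le> 1" and P: "\<forall>k. P k = tail (1 - 2 * p) (k - p)"
  then have "p = 0" by arith
  then show ?thesis by ((elim disjE)?; simp add: P eval_nat_numeral)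
next
  fix n assume "1 \<le> n" "2 * n < 1" and P: "\<forall>k. P k = of_bool (k \<le> n)"
  then show ?thesis by simp
qed

lemma shape_2_bound:
  assumes "shape 2 P"
  shows "8624 / 100000 \<le> 1 / 5 * P 1 - 2550075 / 10000000 * P 2"
  using assms unfolding shape_def
proof (elim disjE exE conjE)
  fix p assume "2 * p \<le> 2" and P: "\<forall>k. P k = tail (2 - 2 * p) (k - p)"
  then have "p = 0 \<or> p = 1" by arith
  then show ?thesis by ((elim disjE)?; simp add: P eval_nat_numeral)
next
  fix n assume "1 \<le> n" "2 * n < 2" and P: "\<forall>k. P k = of_bool (k \<le> n)"
  then show ?thesis by simp
qed

lemma shape_3_bound:
  assumes "shape 3 P"
  shows "3568 / 100000 \<le> 1 / 8 * P 1 - 1095064 / 10000000 * P 3 - 1200050 / 10000000 * P 2"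
  using assms unfolding shape_def
proof (elim disjE exE conjE)
  fix p assume "2 * p \<le> 3" and P: "\<forall>k. P k = tail (3 - 2 * p) (k - p)"
  then have "p = 0 \<or> p = 1" by arith
  then show ?thesis by ((elim disjE)?; simp add: P eval_nat_numeral)
next
  fix n assume "1 \<le> n" "2 * n < 3" and P: "\<forall>k. P k = of_bool (k \<le> n)"
  then have "n = 1" by arith
  then show ?thesis by ((elim disjE)?; simp add: P)
qed

lemma shape_6_bound:
  assumes "shape 6 P"
  shows "- (650 / 100000) \<le> - 294159 / 10000000 * P 6 - 68422 / 10000000 * P 5 - 35610 / 10000000 * P 4 - 61859 / 10000000 * P 3"
  using assms unfolding shape_def
proof (elim disjE exE conjE)
  fix p assume "2 * p \<le> 6" and P: "\<forall>k. P k = tail (6 - 2 * p) (k - p)"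
  then have "p = 0 \<or> p = 1 \<or> p = 2 \<or> p = 3" by arith
  then show ?thesis by ((elim disjE)?; simp add: P eval_nat_numeral)
next
  fix n assume "1 \<le> n" "2 * n < 6" and P: "\<forall>k. P k = of_bool (k \<le> n)"
  then have "n = 1 \<or> n = 2" by arith
  then show ?thesis by ((elim disjE)?; simp add: P)
qed

lemma shape_7_bound:
  assumes "shape 7 P"
  shows "- (132 / 100000) \<le> - 218524 / 10000000 * P 7 - 34015 / 10000000 * P 6 - 11920 / 10000000 * P 5 - 13228 / 10000000 * P 4"
  using assms unfolding shape_def
proof (elim disjE exE conjE)
  fix p assume "2 * p \<le> 7" and P: "\<forall>k. P k = tail (7 - 2 * p) (k - p)"
  then have "p = 0 \<or> p = 1 \<or> p = 2 \<or> p = 3" by arith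
  then show ?thesis by ((elim disjE)?; simp add: P eval_nat_numeral)
next
  fix n assume "1 \<le> n" "2 * n < 7" and P: "\<forall>k. P k = of_bool (k \<le> n)"
  then have "n = 1 \<or> n = 2 \<or> n = 3" by arith
  then show ?thesis by ((elim disjE)?; simp add: P)
qed

lemma shape_8_bound:
  assumes "shape 8 P"
  shows "- (31 / 100000) \<le> - 168310 / 10000000 * P 8 - 17753 / 10000000 * P 7 - 4283 / 10000000 * P 6 - 3221 / 10000000 * P 5"
  using assms unfolding shape_def
proof (elim disjE exE conjE)
  fix p assume "2 * p \<le> 8" and P: "\<forall>k. P k = tail (8 - 2 * p) (k - p)"
  then have "p = 0 \<or> p = 1 \<or> p = 2 \<or> p = 3 \<or> p = 4" by arith
  then show ?thesis by ((elim disjE)?; simp add: P eval_nat_numeral)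
next
  fix n assume "1 \<le> n" "2 * n < 8" and P: "\<forall>k. P k = of_bool (k \<le> n)"
  then have "n = 1 \<or> n = 2 \<or> n = 3" by arith
  then show ?thesis by ((elim disjE)?; simp add: P)
qed

lemma shape_9_bound:
  assumes "shape 9 P"
  shows "- (9 / 100000) \<le> - 133314 / 10000000 * P 9 - 9600 / 10000000 * P 8 - 1613 / 10000000 * P 7 - 846 / 10000000 * P 6"
  using assms unfolding shape_def
proof (elim disjE exE conjE)
  fix p assume "2 * p \<le> 9" and P: "\<forall>k. P k = tail (9 - 2 * p) (k - p)"
  then have "p = 0 \<or> p = 1 \<or> p = 2 \<or> p = 3 \<or> p = 4" by arith
  then show ?thesis by ((elim disjE)?; simp add: P eval_nat_numeral)
next
  fix n assume "1 \<le> n" "2 * n < 9" and P: "\<forall>k. P k = of_bool (k \<le> n)"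
  then have "n = 1 \<or> n = 2 \<or> n = 3 \<or> n = 4" by arith
  then show ?thesis by ((elim disjE)?; simp add: P)
qed

lemma shape_10_bound:
  assumes "shape 10 P"
  shows "- (33 / 100000) \<le> - 1111112 / 10000000 * P 10 - 72061 / 10000000 * P 9 - 11161 / 10000000 * P 8 - 4635 / 10000000 * P 7"
  using assms unfolding shape_def
proof (elim disjE exE conjE)
  fix p assume "2 * p \<le> 10" and P: "\<forall>k. P k = tail (10 - 2 * p) (k - p)"
  then have "p = 0 \<or> p = 1 \<or> p = 2 \<or> p = 3 \<or> p = 4 \<or> p = 5" by arith
  then show ?thesis by ((elim disjE)?; simp add: P eval_nat_numeral)
next
  fix n assume "1 \<le> n" "2 * n < 10" and P: "\<forall>k. P k = of_bool (k \<le> n)"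
  then have "n = 1 \<or> n = 2 \<or> n = 3 \<or> n = 4" by arith
  then show ?thesis by ((elim disjE)?; simp add: P)
qed

text \<open>The bound fails for \<open>p = 0\<close>, \<open>p' = 2\<close>, and this is the one
  pair that \<open>p' \<le> Suc p\<close> excludes: two complete cards among the five largest sides
  force one among the four largest.\<close>

lemma shape_45_bound:
  assumes 4: "2 * p \<le> 4 \<and> (\<forall>k. P k = tail (4 - 2 * p) (k - p))"
    and 5: "2 * p' \<le> 5 \<and> (\<forall>k. P' k = tail (5 - 2 * p') (k - p'))" and "p' \<le> Suc p"
  shows "222 / 10000 \<le> 1 / 8 * P 1 - 633305 / 10000000 * P 4 - 363364 / 10000000 * P 3 - 546907 / 10000000 * P 2 + (- 416013 / 10000000 * P' 5 - 148019 / 10000000 * P' 4 - 120457 / 10000000 * P' 3 - 390657 / 10000000 * P' 2)"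
proof -
  have "p = 0 \<or> p = 1 \<or> p = 2" "p' = 0 \<or> p' = 1 \<or> p' = 2" using 4 5 by arith+
  then show ?thesis using 4 5 assms(3) by (elim disjE) (simp_all add: eval_nat_numeral)
qed

text \<open>For one card both 4 and 5 exceed the number of sides; for two cards only 5 does.\<close>

lemma shape_45_bound_small:
  assumes "n = 1 \<and> P = (\<lambda>k. of_bool (k \<le> n)) \<or> n = 2 \<and> 2 * p \<le> 4 \<and> P = (\<lambda>k. tail (4 - 2 * p) (k - p))"
    and P': "P' = (\<lambda>k. of_bool (k \<le> n))"
  shows "222 / 10000 \<le> 1 / 8 * P 1 - 633305 / 10000000 * P 4 - 363364 / 10000000 * P 3 - 546907 / 10000000 * P 2 + (- 416013 / 10000000 * P' 5 - 148019 / 10000000 * P' 4 - 120457 / 10000000 * P' 3 - 390657 / 10000000 * P' 2)"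
  using assms(1)
proof (elim disjE conjE)
  assume "n = 1" "P = (\<lambda>k. of_bool (k \<le> n))"
  then show ?thesis using P' by simp
next
  assume n: "n = 2" and p: "2 * p \<le> 4" and P: "P = (\<lambda>k. tail (4 - 2 * p) (k - p))"
  from p have "p = 0 \<or> p = 1 \<or> p = 2" by arith
  then show ?thesis by (elim disjE) (simp_all add: P P' n eval_nat_numeral)
qed

section \<open>The constant of the lower bound\<close>

lemma top_prob_shape:
  assumes "ranking n \<kappa>" "1 \<le> n"
  shows "shape N (top_prob n \<kappa> N)"
proof (cases "N \<le> 2 * n")
  case True
  then show ?thesis unfolding shape_def top_prob_def bin_avg_tail
    using top_pairs_le[OF assms(1) True] by auto
next
  case False
  then show ?thesis unfolding shape_def top_prob_def using assms(2) by auto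
qed

lemma tail_nonneg: "0 \<le> tail m c"
  by (induction m c rule: tail.induct) auto

lemma top_prob_nonneg: "0 \<le> top_prob n \<kappa> N k"
  unfolding top_prob_def bin_avg_tail by (auto simp: tail_nonneg)

text \<open>\<open>cc_ge\<close> is used with \<open>M = 9 - r\<close>, so that the remainder of
  every level falls on \<open>N = 10\<close> and can be collected there.\<close>

lemma avg_cc_ge:
  assumes "ranking n \<kappa>" "r < 4"
  shows "CC r 0 - real (tau (Suc r) - tau r) / real grid
      + real (tau (Suc r) - tau r) / real grid * top_prob n \<kappa> (r + 1) 1
      - (\<Sum>k=2..9-r. ee r k * top_prob n \<kappa> (r + k) k) - CC r (8 - r) * top_prob n \<kappa> 10 (10 - r)
    \<le> avg (faces n) (\<lambda>g. cc r (high_downs n \<kappa> g r))"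
proof -
  let ?d = "\<lambda>g. high_downs n \<kappa> g r"
  have "avg (faces n) (\<lambda>g. CC r 0 - real (tau (Suc r) - tau r) / real grid
      + real (tau (Suc r) - tau r) / real grid * of_bool (1 \<le> ?d g)
      - (\<Sum>k=2..9-r. ee r k * of_bool (k \<le> ?d g)) - CC r (8 - r) * of_bool (10 - r \<le> ?d g))
    \<le> avg (faces n) (\<lambda>g. cc r (?d g))"
  proof (rule avg_mono)
    fix g
    have "9 - r - 1 = 8 - r" "9 - r + 1 = 10 - r" "1 \<le> 9 - r" using assms(2) by simp_all
    then show "CC r 0 - real (tau (Suc r) - tau r) / real grid
      + real (tau (Suc r) - tau r) / real grid * of_bool (1 \<le> ?d g)
      - (\<Sum>k=2..9-r. ee r k * of_bool (k \<le> ?d g)) - CC r (8 - r) * of_bool (10 - r \<le> ?d g) \<le> cc r (?d g)"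
      using cc_ge[of "9 - r" r "?d g"] by simp
  qed
  then show ?thesis
    unfolding avg_diff avg_add avg_cmult avg_sum avg_high_downs[OF assms(1)]
    using assms(2) by (simp add: avg_const)
qed

lemma avg_sum_cc:
  assumes "ranking n \<kappa>" "1 \<le> n"
  shows "0.5009 \<le> avg (faces n) (\<lambda>g. \<Sum>r<4. cc r (high_downs n \<kappa> g r))"
proof -
  let ?P = "top_prob n \<kappa>"
  note P0 = top_prob_nonneg[of n \<kappa>]
  have s0: "{2..9::nat} = {2, 3, 4, 5, 6, 7, 8, 9}" by auto
  have r0: "CC 0 0 - 3 / 10 + 3 / 10 * ?P 1 1 - 2550075 / 10000000 * ?P 2 2 - 1095064 / 10000000 * ?P 3 3 - 633305 / 10000000 * ?P 4 4 - 416013 / 10000000 * ?P 5 5 - 294159 / 10000000 * ?P 6 6 - 218524 / 10000000 * ?P 7 7 - 168310 / 10000000 * ?P 8 8 - 133314 / 10000000 * ?P 9 9 - 1111112 / 10000000 * ?P 10 10 \<le> avg (faces n) (\<lambda>g. cc 0 (high_downs n \<kappa> g 0))"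
    using avg_cc_ge[OF assms(1), of 0] s0
      mult_right_mono[OF ee_bounds(1) P0[of 2 2]]
      mult_right_mono[OF ee_bounds(2) P0[of 3 3]]
      mult_right_mono[OF ee_bounds(3) P0[of 4 4]]
      mult_right_mono[OF ee_bounds(4) P0[of 5 5]]
      mult_right_mono[OF ee_bounds(5) P0[of 6 6]]
      mult_right_mono[OF ee_bounds(6) P0[of 7 7]]
      mult_right_mono[OF ee_bounds(7) P0[of 8 8]]
      mult_right_mono[OF ee_bounds(8) P0[of 9 9]]
      mult_right_mono[OF CC_bounds(1) P0[of 10 10]]
    by (simp add: tau_def grid_def)
  have s1: "{2..8::nat} = {2, 3, 4, 5, 6, 7, 8}" by auto
  have r1: "CC 1 0 - 1 / 5 + 1 / 5 * ?P 2 1 - 1200050 / 10000000 * ?P 3 2 - 363364 / 10000000 * ?P 4 3 - 148019 / 10000000 * ?P 5 4 - 68422 / 10000000 * ?P 6 5 - 34015 / 10000000 * ?P 7 6 - 17753 / 10000000 * ?P 8 7 - 9600 / 10000000 * ?P 9 8 - 72061 / 10000000 * ?P 10 9 \<le> avg (faces n) (\<lambda>g. cc 1 (high_downs n \<kappa> g 1))"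
    using avg_cc_ge[OF assms(1), of 1, unfolded one_add_one] s1
      mult_right_mono[OF ee_bounds(9) P0[of 3 2]]
      mult_right_mono[OF ee_bounds(10) P0[of 4 3]]
      mult_right_mono[OF ee_bounds(11) P0[of 5 4]]
      mult_right_mono[OF ee_bounds(12) P0[of 6 5]]
      mult_right_mono[OF ee_bounds(13) P0[of 7 6]]
      mult_right_mono[OF ee_bounds(14) P0[of 8 7]]
      mult_right_mono[OF ee_bounds(15) P0[of 9 8]]
      mult_right_mono[OF CC_bounds(2) P0[of 10 9]]
    by (simp add: tau_def grid_def)
  have s2: "{2..7::nat} = {2, 3, 4, 5, 6, 7}" by auto
  have r2: "CC 2 0 - 1 / 8 + 1 / 8 * ?P 3 1 - 546907 / 10000000 * ?P 4 2 - 120457 / 10000000 * ?P 5 3 - 35610 / 10000000 * ?P 6 4 - 11920 / 10000000 * ?P 7 5 - 4283 / 10000000 * ?P 8 6 - 1613 / 10000000 * ?P 9 7 - 11161 / 10000000 * ?P 10 8 \<le> avg (faces n) (\<lambda>g. cc 2 (high_downs n \<kappa> g 2))"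
    using avg_cc_ge[OF assms(1), of 2] s2
      mult_right_mono[OF ee_bounds(16) P0[of 4 2]]
      mult_right_mono[OF ee_bounds(17) P0[of 5 3]]
      mult_right_mono[OF ee_bounds(18) P0[of 6 4]]
      mult_right_mono[OF ee_bounds(19) P0[of 7 5]]
      mult_right_mono[OF ee_bounds(20) P0[of 8 6]]
      mult_right_mono[OF ee_bounds(21) P0[of 9 7]]
      mult_right_mono[OF CC_bounds(3) P0[of 10 8]]
    by (simp add: tau_def grid_def)
  have s3: "{2..6::nat} = {2, 3, 4, 5, 6}" by auto
  have r3: "CC 3 0 - 1 / 8 + 1 / 8 * ?P 4 1 - 390657 / 10000000 * ?P 5 2 - 61859 / 10000000 * ?P 6 3 - 13228 / 10000000 * ?P 7 4 - 3221 / 10000000 * ?P 8 5 - 846 / 10000000 * ?P 9 6 - 4635 / 10000000 * ?P 10 7 \<le> avg (faces n) (\<lambda>g. cc 3 (high_downs n \<kappa> g 3))"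
    using avg_cc_ge[OF assms(1), of 3] s3
      mult_right_mono[OF ee_bounds(22) P0[of 5 2]]
      mult_right_mono[OF ee_bounds(23) P0[of 6 3]]
      mult_right_mono[OF ee_bounds(24) P0[of 7 4]]
      mult_right_mono[OF ee_bounds(25) P0[of 8 5]]
      mult_right_mono[OF ee_bounds(26) P0[of 9 6]]
      mult_right_mono[OF CC_bounds(4) P0[of 10 7]]
    by (simp add: tau_def grid_def)
  have s: "shape N (?P N)" for N by (rule top_prob_shape[OF assms])
  have 45: "222 / 10000 \<le> 1 / 8 * ?P 4 1 - 633305 / 10000000 * ?P 4 4 - 363364 / 10000000 * ?P 4 3 - 546907 / 10000000 * ?P 4 2 + (- 416013 / 10000000 * ?P 5 5 - 148019 / 10000000 * ?P 5 4 - 120457 / 10000000 * ?P 5 3 - 390657 / 10000000 * ?P 5 2)"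
  proof (cases "5 \<le> 2 * n")
    case True
    have t4: "2 * top_pairs n \<kappa> 4 \<le> 4 \<and> (\<forall>k. ?P 4 k = tail (4 - 2 * top_pairs n \<kappa> 4) (k - top_pairs n \<kappa> 4))"
      using top_pairs_le[OF assms(1), of 4] True by (simp add: top_prob_def bin_avg_tail)
    have t5: "2 * top_pairs n \<kappa> 5 \<le> 5 \<and> (\<forall>k. ?P 5 k = tail (5 - 2 * top_pairs n \<kappa> 5) (k - top_pairs n \<kappa> 5))"
      using top_pairs_le[OF assms(1), of 5] True by (simp add: top_prob_def bin_avg_tail)
    have "top_pairs n \<kappa> 5 \<le> Suc (top_pairs n \<kappa> 4)" using top_pairs_Suc[OF assms(1), of 4] by simp
    then show ?thesis by (rule shape_45_bound[OF t4 t5])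
  next
    case False
    then have "n = 1 \<or> n = 2" using assms(2) by arith
    then show ?thesis
    proof
      assume n: "n = 1"
      show ?thesis by (rule shape_45_bound_small[where n=n]) (simp_all add: n top_prob_def fun_eq_iff)
    next
      assume n: "n = 2"
      have "2 * top_pairs n \<kappa> 4 \<le> 4" using top_pairs_le[OF assms(1), of 4] n by simp
      moreover have "?P 4 = (\<lambda>k. tail (4 - 2 * top_pairs n \<kappa> 4) (k - top_pairs n \<kappa> 4))"
        by (simp add: n top_prob_def bin_avg_tail fun_eq_iff)
      moreover have "?P 5 = (\<lambda>k. of_bool (k \<le> n))" by (simp add: n top_prob_def fun_eq_iff)
      ultimately show ?thesis using n by (intro shape_45_bound_small) auto
    qed
  qed
  have "avg (faces n) (\<lambda>g. \<Sum>r<4. cc r (high_downs n \<kappa> g r))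
    = (\<Sum>r<4. avg (faces n) (\<lambda>g. cc r (high_downs n \<kappa> g r)))" by (rule avg_sum)
  also have "\<dots> = avg (faces n) (\<lambda>g. cc 0 (high_downs n \<kappa> g 0)) + avg (faces n) (\<lambda>g. cc 1 (high_downs n \<kappa> g 1))
    + avg (faces n) (\<lambda>g. cc 2 (high_downs n \<kappa> g 2)) + avg (faces n) (\<lambda>g. cc 3 (high_downs n \<kappa> g 3))"
    by (simp add: eval_nat_numeral)
  finally have eq: "avg (faces n) (\<lambda>g. \<Sum>r<4. cc r (high_downs n \<kappa> g r)) = \<dots>" .
  have base: "3 / 4 + 3 / 4 * (28755 / 100000) \<le> CC 0 0 + CC 1 0 + CC 2 0 + CC 3 0"
    using sum_CC_0 by (simp add: eval_nat_numeral)
  \<comment> \<open>The total is about 0.5012: the constants \<open>CC r 0\<close> minus 3/4 give at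
    least 0.2156, and the bounds for the shapes add up to 0.2855.\<close>
  have "5009 / 10000 \<le> avg (faces n) (\<lambda>g. \<Sum>r<4. cc r (high_downs n \<kappa> g r))" unfolding eq
    using r0 r1 r2 r3 base 45 shape_1_bound[OF s] shape_2_bound[OF s] shape_3_bound[OF s] shape_6_bound[OF s]
      shape_7_bound[OF s] shape_8_bound[OF s] shape_9_bound[OF s] shape_10_bound[OF s]
    by linarith
  then show ?thesis by simp
qed

subsection \<open>The algorithm\<close>

text \<open>Ties between different cards are broken by the card index; a tie between the two sides of
  card \<open>i\<close> is broken by the coin \<open>c i\<close>.\<close>

definition beats :: "nat \<times> real \<Rightarrow> nat \<times> real \<Rightarrow> bool" where
  "beats z z' \<longleftrightarrow> snd z' < snd z \<or> snd z' = snd z \<and> fst z' < fst z"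

definition count_above :: "real list \<Rightarrow> (nat \<Rightarrow> bool) \<Rightarrow> nat \<times> real \<Rightarrow> nat" where
  "count_above ys c z = card {l. l < length ys \<and>
     (snd z < ys ! l \<or> ys ! l = snd z \<and> (fst z < l \<or> l = fst z \<and> c l))}"

definition det_rule :: "(nat \<Rightarrow> nat) \<Rightarrow> (nat \<Rightarrow> bool) \<Rightarrow> real list \<Rightarrow> (nat \<times> real) list \<Rightarrow> real" where
  "det_rule \<theta> c ys h = of_bool (h \<noteq> [] \<and> (\<forall>j<length h - 1. beats (h ! (length h - 1)) (h ! j))
     \<and> tau (count_above ys c (h ! (length h - 1))) \<le> \<theta> (length h - 1))"

text \<open>The order of revelation is already uniformly random, so assigning the sorted times to
  the successive positions gives the cards independent uniform times.\<close>

definition arrival_times :: "nat \<Rightarrow> (nat \<Rightarrow> nat) \<Rightarrow> nat \<Rightarrow> nat" where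
  "arrival_times n t k = sort (map t [0..<n]) ! k"

text \<open>Stated for the sample problem because there the index of each value is visible and can
  break ties.\<close>

definition sample_rule :: sample_algorithm where
  "sample_rule ys = mix (clock_times (length ys) \<times> faces (length ys))
     (\<lambda>(t, c). det_rule (arrival_times (length ys) t) c ys)"

lemma same_comparisons_take: "same_comparisons v w \<Longrightarrow> same_comparisons (take k v) (take k w)"
  by (auto simp: same_comparisons_def)

lemma same_comparisons_append:
  assumes "same_comparisons (ys @ xs) (ys' @ xs')" "length ys = length ys'"
  shows "length xs = length xs'"
    and "k < length xs \<Longrightarrow> l < length xs \<Longrightarrow> xs ! k < xs ! l \<longleftrightarrow> xs' ! k < xs' ! l"
    and "k < length xs \<Longrightarrow> l < length ys \<Longrightarrow> xs ! k < ys ! l \<longleftrightarrow> xs' ! k < ys' ! l"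
    and "k < length xs \<Longrightarrow> l < length ys \<Longrightarrow> ys ! l < xs ! k \<longleftrightarrow> ys' ! l < xs' ! k"
proof -
  have c: "i < length (ys @ xs) \<Longrightarrow> j < length (ys @ xs) \<Longrightarrow> (ys @ xs) ! i < (ys @ xs) ! j \<longleftrightarrow> (ys' @ xs') ! i < (ys' @ xs') ! j" for i j
    using assms(1) unfolding same_comparisons_def by blast
  show "length xs = length xs'" using assms by (auto simp: same_comparisons_def)
  show "k < length xs \<Longrightarrow> l < length xs \<Longrightarrow> xs ! k < xs ! l \<longleftrightarrow> xs' ! k < xs' ! l"
    using c[of "length ys + k" "length ys + l"] assms(2) by (simp add: nth_append)
  show "k < length xs \<Longrightarrow> l < length ys \<Longrightarrow> xs ! k < ys ! l \<longleftrightarrow> xs' ! k < ys' ! l"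
    using c[of "length ys + k" l] assms(2) by (simp add: nth_append)
  show "k < length xs \<Longrightarrow> l < length ys \<Longrightarrow> ys ! l < xs ! k \<longleftrightarrow> ys' ! l < xs' ! k"
    using c[of l "length ys + k"] assms(2) by (simp add: nth_append)
qed

lemma det_rule_cong:
  assumes "length ys = length ys'" "map fst h = map fst h'"
    and "same_comparisons (ys @ map snd h) (ys' @ map snd h')"
  shows "det_rule \<theta> c ys h = det_rule \<theta> c ys' h'"
proof (cases "h = []")
  case True
  then show ?thesis using assms(2) by (simp add: det_rule_def)
next
  case False
  have len: "length h = length h'" using assms(2) by (rule map_eq_imp_length_eq)
  define m where "m = length h - 1"
  have "0 < length h" using False by simp
  then have m: "m < length h" "m < length h'" using len by (simp_all add: m_def)
  have fst: "fst (h ! k) = fst (h' ! k)" if "k < length h" for k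
    using arg_cong[OF assms(2), of "\<lambda>x. x ! k"] that len by simp
  note c = same_comparisons_append[OF assms(3,1)]
  have xx: "snd (h ! k) < snd (h ! l) \<longleftrightarrow> snd (h' ! k) < snd (h' ! l)" if "k < length h" "l < length h" for k l
    using c(2)[of k l] that len by simp
  have xy: "snd (h ! m) < ys ! l \<longleftrightarrow> snd (h' ! m) < ys' ! l" if "l < length ys" for l
    using c(3)[of m l] that len m by simp
  have yx: "ys ! l < snd (h ! m) \<longleftrightarrow> ys' ! l < snd (h' ! m)" if "l < length ys" for l
    using c(4)[of m l] that len m by simp
  have "beats (h ! m) (h ! j) \<longleftrightarrow> beats (h' ! m) (h' ! j)" if "j < m" for j
  proof -
    have j: "j < length h" using that m by simp
    have "snd (h ! j) = snd (h ! m) \<longleftrightarrow> snd (h' ! j) = snd (h' ! m)"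
      using xx[OF j m(1)] xx[OF m(1) j] by (metis linorder_neq_iff)
    then show ?thesis unfolding beats_def using xx[OF j m(1)] fst[OF j] fst[OF m(1)] by simp
  qed
  moreover have "count_above ys c (h ! m) = count_above ys' c (h' ! m)"
  proof -
    have "ys ! l = snd (h ! m) \<longleftrightarrow> ys' ! l = snd (h' ! m)" if "l < length ys" for l
      using xy[OF that] yx[OF that] by (metis linorder_neq_iff)
    then show ?thesis unfolding count_above_def using xy assms(1) fst[OF m(1)]
      by (intro arg_cong[where f=card] Collect_cong) auto
  qed
  ultimately show ?thesis using False len by (auto simp: det_rule_def m_def)
qed

lemma det_rule_bounds: "det_rule \<theta> c ys h \<in> {0..1}"
  by (simp add: det_rule_def)

lemma mix_cong:
  assumes "length h = length h'" "\<And>\<theta> k. \<theta> \<in> \<Theta> \<Longrightarrow> Q \<theta> (take k h) = Q' \<theta> (take k h')"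
  shows "mix \<Theta> Q h = mix \<Theta> Q' h'"
proof -
  have q: "Q \<theta> h = Q' \<theta> h'" if "\<theta> \<in> \<Theta>" for \<theta> using assms(2)[OF that, of "length h"] assms(1) by simp
  have "survive (Q \<theta>) h = survive (Q' \<theta>) h'" if "\<theta> \<in> \<Theta>" for \<theta>
    unfolding survive_def using assms that by (intro prod.cong) auto
  then show ?thesis unfolding mix_def using q by (intro arg_cong2[where f="(/)"] avg_cong) auto
qed

lemma sample_rule_algorithm: "sample_algorithm sample_rule"
  unfolding sample_algorithm_def sample_rule_def
  by (intro allI mix_bounds) (auto simp: det_rule_def)

lemma sample_rule_comparison_based: "sample_comparison_based sample_rule"
  unfolding sample_comparison_based_def
proof (intro allI impI)
  fix ys ys' :: "real list" and h h' :: "(nat \<times> real) list"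
  assume len: "length ys = length ys'" and fst: "map fst h = map fst h'"
    and cmp: "same_comparisons (ys @ map snd h) (ys' @ map snd h')"
  have "det_rule \<theta> c ys (take k h) = det_rule \<theta> c ys' (take k h')" for \<theta> c k
  proof (rule det_rule_cong[OF len])
    show "map fst (take k h) = map fst (take k h')" using fst by (metis take_map)
    show "same_comparisons (ys @ map snd (take k h)) (ys' @ map snd (take k h'))"
      using same_comparisons_take[OF cmp, of "length ys + k"] len by (simp add: take_map)
  qed
  then show "sample_rule ys h = sample_rule ys' h'"
    unfolding sample_rule_def len
    by (intro mix_cong) (use map_eq_imp_length_eq[OF fst] in auto)
qed

subsection \<open>Ranking the sides\<close>

text \<open>A strict total order of the sides that refines the order of the numbers. It agrees with
  the conventions of \<open>beats\<close> and \<open>count_above\<close>, so the rule acts as if all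
  numbers were distinct.\<close>

definition side_less :: "(nat \<Rightarrow> bool \<Rightarrow> real) \<Rightarrow> nat \<times> bool \<Rightarrow> nat \<times> bool \<Rightarrow> bool" where
  "side_less a x y \<longleftrightarrow> a (fst x) (snd x) < a (fst y) (snd y) \<or>
     a (fst x) (snd x) = a (fst y) (snd y) \<and> (fst x < fst y \<or> fst x = fst y \<and> \<not> snd x \<and> snd y)"

definition side_rank :: "nat \<Rightarrow> (nat \<Rightarrow> bool \<Rightarrow> real) \<Rightarrow> nat \<Rightarrow> bool \<Rightarrow> nat" where
  "side_rank n a i b = card {y \<in> {..<n} \<times> UNIV. side_less a y (i, b)}"

lemma side_rank_less_iff:
  assumes "i < n" "j < n"
  shows "side_rank n a i b < side_rank n a j c \<longleftrightarrow> side_less a (i, b) (j, c)"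
proof -
  have tr: "side_less a x y \<Longrightarrow> side_less a y z \<Longrightarrow> side_less a x z" for x y z
    unfolding side_less_def by auto
  have irr: "\<not> side_less a x x" for x unfolding side_less_def by auto
  have mono: "side_rank n a i b < side_rank n a j c" if "side_less a (i, b) (j, c)" "i < n" for i b j c
  proof -
    let ?A = "\<lambda>x. {y \<in> {..<n} \<times> (UNIV :: bool set). side_less a y x}"
    have "?A (i, b) \<subseteq> ?A (j, c)" using tr that(1) by blast
    moreover have "(i, b) \<in> ?A (j, c)" "(i, b) \<notin> ?A (i, b)" using that irr by auto
    ultimately have "?A (i, b) \<subset> ?A (j, c)" by blast
    then show ?thesis unfolding side_rank_def by (intro psubset_card_mono) auto
  qed
  show ?thesis
  proof
    assume *: "side_rank n a i b < side_rank n a j c"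
    show "side_less a (i, b) (j, c)"
    proof (rule ccontr)
      assume "\<not> side_less a (i, b) (j, c)"
      then have "(i, b) = (j, c) \<or> side_less a (j, c) (i, b)" unfolding side_less_def by auto
      then show False using * mono[of j c i b] assms by auto
    qed
  qed (use mono assms in blast)
qed

lemma ranking_side_rank: "ranking n (side_rank n a)"
proof -
  let ?I = "{..<n} \<times> (UNIV :: bool set)" and ?k = "\<lambda>(i, b). side_rank n a i b"
  have c: "card ?I = 2 * n" by (simp add: card_cartesian_product)
  have inj: "inj_on ?k ?I"
  proof (rule inj_onI)
    fix x y assume "x \<in> ?I" "y \<in> ?I" "?k x = ?k y"
    then have "\<not> side_less a x y" "\<not> side_less a y x"
      using side_rank_less_iff[of "fst x" n "fst y" a "snd x" "snd y"]
        side_rank_less_iff[of "fst y" n "fst x" a "snd y" "snd x"] by (auto simp: case_prod_beta)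
    then have "fst x = fst y \<and> snd x = snd y" unfolding side_less_def by (metis linorder_neq_iff)
    then show "x = y" by (simp add: prod_eq_iff)
  qed
  have "side_rank n a i b < 2 * n" if "i < n" for i b
  proof -
    have "{y \<in> ?I. side_less a y (i, b)} \<subseteq> ?I - {(i, b)}" by (auto simp: side_less_def)
    then have "side_rank n a i b \<le> card (?I - {(i, b)})" unfolding side_rank_def by (intro card_mono) auto
    then show ?thesis using that c by (simp add: card_Diff_singleton)
  qed
  then have "?k ` ?I \<subseteq> {..<2 * n}" by auto
  then have "?k ` ?I = {..<2 * n}" using card_image[OF inj] c by (intro card_subset_eq) auto
  then show ?thesis using inj by (simp add: ranking_def bij_betw_def)
qed

subsection \<open>Winning\<close>

definition winner :: "nat \<Rightarrow> (nat \<Rightarrow> bool \<Rightarrow> nat) \<Rightarrow> (nat \<Rightarrow> bool) \<Rightarrow> nat" where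
  "winner n \<kappa> g = (ARG_MAX (\<lambda>i. \<kappa> i (\<not> g i)) i. i < n)"

lemma winner:
  assumes "1 \<le> n"
  shows "winner n \<kappa> g < n" "i < n \<Longrightarrow> \<kappa> i (\<not> g i) \<le> \<kappa> (winner n \<kappa> g) (\<not> g (winner n \<kappa> g))"
proof -
  have "\<kappa> j (\<not> g j) \<le> Max ((\<lambda>i. \<kappa> i (\<not> g i)) ` {..<n})" if "j < n" for j using that by simp
  then have *: "\<And>y. y < n \<Longrightarrow> \<kappa> y (\<not> g y) < Suc (Max ((\<lambda>i. \<kappa> i (\<not> g i)) ` {..<n}))" by (simp add: less_Suc_eq_le)
  show "winner n \<kappa> g < n" unfolding winner_def
    by (rule arg_max_natI[of "\<lambda>i. i < n" 0]) (use assms * in auto)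
  show "i < n \<Longrightarrow> \<kappa> i (\<not> g i) \<le> \<kappa> (winner n \<kappa> g) (\<not> g (winner n \<kappa> g))" unfolding winner_def
    by (rule arg_max_nat_le[of "\<lambda>i. i < n"]) (use * in auto)
qed

lemma ups_above_anti: "\<kappa> i (\<not> g i) \<le> \<kappa> j (\<not> g j) \<Longrightarrow> ups_above n \<kappa> g j \<le> ups_above n \<kappa> g i"
  unfolding ups_above_def by (intro card_mono) auto

lemma avg_faces_wins:
  assumes "ranking n \<kappa>" "1 \<le> n"
  shows "0.5009 \<le> avg (faces n) (\<lambda>g. avg (clock_times n) (\<lambda>t.
    of_bool (wins n (\<lambda>i. \<kappa> i (\<not> g i)) (ups_above n \<kappa> g) (winner n \<kappa> g) t)))"
proof -
  have "0.5009 \<le> avg (faces n) (\<lambda>g. \<Sum>r<4. cc r (high_downs n \<kappa> g r))" by (rule avg_sum_cc[OF assms])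
  also have "\<dots> \<le> avg (faces n) (\<lambda>g. avg (clock_times n) (\<lambda>t.
    of_bool (wins n (\<lambda>i. \<kappa> i (\<not> g i)) (ups_above n \<kappa> g) (winner n \<kappa> g) t)))"
  proof (rule avg_mono)
    fix g
    show "(\<Sum>r<4. cc r (high_downs n \<kappa> g r)) \<le> avg (clock_times n) (\<lambda>t.
      of_bool (wins n (\<lambda>i. \<kappa> i (\<not> g i)) (ups_above n \<kappa> g) (winner n \<kappa> g) t))"
      unfolding high_downs_def
    proof (rule avg_wins)
      show "inj_on (\<lambda>i. \<kappa> i (\<not> g i)) {..<n}"
        by (rule inj_onI) (use ranking_inj[OF assms(1)] in blast)
    qed (use winner[OF assms(2)] ups_above_anti in blast)+
  qed
  finally show ?thesis .
qed

lemma arrival_times_mono: "i \<le> j \<Longrightarrow> j < n \<Longrightarrow> arrival_times n t i \<le> arrival_times n t j"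
  unfolding arrival_times_def by (rule sorted_nth_mono) auto

lemma arrival_times_perm:
  "\<exists>\<rho>. \<rho> permutes {..<n} \<and> (\<forall>k<n. arrival_times n t k = t (\<rho> k))"
proof -
  have "mset (sort (map t [0..<n])) = mset (map t [0..<n])" by simp
  then obtain \<rho> where \<rho>: "\<rho> permutes {..<length (map t [0..<n])}"
    "permute_list \<rho> (map t [0..<n]) = sort (map t [0..<n])" by (rule mset_eq_permutation)
  have "arrival_times n t k = t (\<rho> k)" if "k < n" for k
    unfolding arrival_times_def \<rho>(2)[symmetric] using \<rho>(1) that perms_less[of \<rho> n k] by (simp add: permute_list_nth)
  then show ?thesis using \<rho>(1) by auto
qed

definition sample_pick :: "sample_algorithm \<Rightarrow> nat \<Rightarrow> (nat \<Rightarrow> nat) \<Rightarrow> (nat \<Rightarrow> real) \<Rightarrow> (nat \<Rightarrow> real) \<Rightarrow> real" where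
  "sample_pick B n \<sigma> x y = pick_max_prob 0 n (\<lambda>k. x (\<sigma> k))
     (\<lambda>j. B (map y [0..<n]) (map (\<lambda>k. (\<sigma> k, x (\<sigma> k))) [0..<Suc j]))"

text \<open>If both sides of a card agree, the numbers do not reveal which one is up, and the rule
  pretends that the coin chose it. The visible numbers are unchanged, and the pretended faces are
  again uniform.\<close>

definition tie_break :: "(nat \<Rightarrow> bool \<Rightarrow> real) \<Rightarrow> (nat \<Rightarrow> bool) \<Rightarrow> (nat \<Rightarrow> bool) \<Rightarrow> nat \<Rightarrow> bool" where
  "tie_break a f c = (\<lambda>i. if a i True = a i False then c i else f i)"

lemma tie_break_values:
  "a i (tie_break a f c i) = a i (f i)" "a i (\<not> tie_break a f c i) = a i (\<not> f i)"
  by (cases "f i"; cases "c i"; simp add: tie_break_def)+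

text \<open>Comparisons of numbers, indices and coins reproduce the comparisons of ranks for the
  faces \<open>g\<close>, so records and face-up counts are those of the analysis without
  ties.\<close>

lemma det_rule_eq:
  fixes a n f c
  defines "g \<equiv> tie_break a f c" and "\<kappa> \<equiv> side_rank n a"
  assumes \<sigma>: "\<sigma> permutes {..<n}" and k: "k < n"
  shows "det_rule \<theta> c (map (\<lambda>i. a i (f i)) [0..<n]) (map (\<lambda>k. (\<sigma> k, a (\<sigma> k) (\<not> f (\<sigma> k)))) [0..<Suc k])
    = of_bool ((\<forall>j<k. \<kappa> (\<sigma> j) (\<not> g (\<sigma> j)) < \<kappa> (\<sigma> k) (\<not> g (\<sigma> k))) \<and> tau (ups_above n \<kappa> g (\<sigma> k)) \<le> \<theta> k)"
proof -
  let ?h = "map (\<lambda>k. (\<sigma> k, a (\<sigma> k) (\<not> f (\<sigma> k)))) [0..<Suc k]"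
  let ?ys = "map (\<lambda>i. a i (f i)) [0..<n]"
  have val: "a i (g i) = a i (f i)" "a i (\<not> g i) = a i (\<not> f i)" for i
    unfolding g_def by (rule tie_break_values)+
  have \<sigma>n: "\<sigma> j < n" if "j < n" for j using perms_less[OF \<sigma>] that by simp
  have h: "?h ! j = (\<sigma> j, a (\<sigma> j) (\<not> f (\<sigma> j)))" if "j \<le> k" for j
    using that by (simp del: upt_Suc)
  have len: "length ?h = Suc k" by simp
  have b: "beats (?h ! k) (?h ! j) \<longleftrightarrow> \<kappa> (\<sigma> j) (\<not> g (\<sigma> j)) < \<kappa> (\<sigma> k) (\<not> g (\<sigma> k))" if "j < k" for j
  proof -
    have "\<sigma> j \<noteq> \<sigma> k" using permutes_inj[OF \<sigma>] that by (auto dest: injD)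
    moreover have "j < n" using that k by simp
    ultimately show ?thesis unfolding \<kappa>_def
      using side_rank_less_iff[OF \<sigma>n \<sigma>n[OF k], of j a] that h[of j] h[of k]
      by (auto simp: beats_def side_less_def val)
  qed
  have "count_above ?ys c (?h ! k) = ups_above n \<kappa> g (\<sigma> k)"
    unfolding count_above_def ups_above_def
  proof (intro arg_cong[where f=card] Collect_cong)
    fix l
    let ?i = "\<sigma> k"
    have tie: "g l = c l" if "l = ?i" "a l (f l) = a ?i (\<not> f ?i)"
      using that by (cases "f l") (auto simp: g_def tie_break_def)
    show "(l < length ?ys \<and> (snd (?h ! k) < ?ys ! l \<or> ?ys ! l = snd (?h ! k) \<and> (fst (?h ! k) < l \<or> l = fst (?h ! k) \<and> c l)))
      \<longleftrightarrow> (l < n \<and> \<kappa> ?i (\<not> g ?i) < \<kappa> l (g l))"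
    proof (cases "l < n")
      case True
      show ?thesis unfolding \<kappa>_def h[OF order_refl]
        using side_rank_less_iff[OF \<sigma>n[OF k] True, of a "\<not> g ?i" "g l"] True tie
        by (auto simp: side_less_def val)
    qed simp
  qed
  then show ?thesis unfolding det_rule_def len using b by (auto simp del: upt_Suc)
qed

lemma det_rule_success:
  fixes a n f c
  defines "g \<equiv> tie_break a f c" and "\<kappa> \<equiv> side_rank n a"
  assumes n: "1 \<le> n" and \<sigma>: "\<sigma> permutes {..<n}"
    and mono: "\<And>i j. i \<le> j \<Longrightarrow> j < n \<Longrightarrow> \<theta> i \<le> \<theta> j"
    and t: "\<And>k. k < n \<Longrightarrow> t (\<sigma> k) = \<theta> k"
    and wins: "wins n (\<lambda>i. \<kappa> i (\<not> g i)) (ups_above n \<kappa> g) (winner n \<kappa> g) t"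
  shows "1 \<le> sample_pick (det_rule \<theta> c) n \<sigma> (\<lambda>i. a i (\<not> f i)) (\<lambda>i. a i (f i))"
proof -
  let ?D = "\<lambda>i. \<kappa> i (\<not> g i)" and ?u = "ups_above n \<kappa> g" and ?w = "winner n \<kappa> g"
  define q where "q j = det_rule \<theta> c (map (\<lambda>i. a i (f i)) [0..<n])
    (map (\<lambda>k. (\<sigma> k, a (\<sigma> k) (\<not> f (\<sigma> k)))) [0..<Suc j])" for j
  have q: "q k = of_bool ((\<forall>j<k. ?D (\<sigma> j) < ?D (\<sigma> k)) \<and> tau (?u (\<sigma> k)) \<le> \<theta> k)" if "k < n" for k
    unfolding q_def g_def \<kappa>_def by (rule det_rule_eq[OF \<sigma> that])
  have rk: "ranking n \<kappa>" unfolding \<kappa>_def by (rule ranking_side_rank)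
  have val: "a i (\<not> g i) = a i (\<not> f i)" for i unfolding g_def by (rule tie_break_values)
  have surj: "\<exists>k<n. \<sigma> k = i" if "i < n" for i
    using permutes_image[OF \<sigma>] that by (metis imageE lessThan_iff)
  note w = winner[where n=n and \<kappa>=\<kappa> and g=g, OF n]
  obtain k0 where k0: "k0 < n" "\<sigma> k0 = ?w" using surj w(1) by blast
  have \<sigma>n: "\<sigma> j < n" if "j < n" for j using perms_less[OF \<sigma>] that by simp
  have max: "?D (\<sigma> j) < ?D ?w" if "j < n" "j \<noteq> k0" for j
  proof -
    have "\<sigma> j \<noteq> ?w" using k0 that permutes_inj[OF \<sigma>] by (metis injD)
    then have "?D (\<sigma> j) \<noteq> ?D ?w" using ranking_inj[OF rk \<sigma>n[OF that(1)] w(1)] by blast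
    then show ?thesis using w(2)[OF \<sigma>n[OF that(1)]] by simp
  qed
  have q0: "q k0 = 1" unfolding q[OF k0(1)] using max k0 wins t[OF k0(1)] by (auto simp: wins_def)
  \<comment> \<open>Suppose that position \<open>j\<close> is accepted before \<open>k0\<close>. The
    best other card \<open>y\<close> with time up to that of the winner satisfies \<open>t y < tau
    (?u y) \<le> tau (?u (\<sigma> j)) \<le> \<theta> j\<close>, so it was flipped before position
    \<open>j\<close>, and \<open>\<sigma> j\<close> is not a record.\<close>
  have qj: "q j = 0" if j: "j < k0" for j
  proof (rule ccontr)
    assume "q j \<noteq> 0"
    moreover have jn: "j < n" using j k0 by simp
    ultimately have rec: "\<And>m. m < j \<Longrightarrow> ?D (\<sigma> m) < ?D (\<sigma> j)" and acc: "tau (?u (\<sigma> j)) \<le> \<theta> j"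
      using q[of j] by (auto split: if_splits)
    \<comment> \<open>Cards sharing the time of \<open>?w\<close> are included, since the times do
      not determine whether they are flipped before it.\<close>
    let ?A = "{i \<in> {..<n} - {?w}. t i \<le> t ?w}"
    have "\<sigma> j \<noteq> ?w" using k0 j permutes_inj[OF \<sigma>] by (metis injD less_irrefl)
    then have jA: "\<sigma> j \<in> ?A" using \<sigma>n[OF jn] t[OF jn] t[OF k0(1)] k0 mono[of j k0] j by simp
    have "Max (?D ` ?A) \<in> ?D ` ?A" using jA by (intro Max_in) auto
    then obtain y where y: "Max (?D ` ?A) = ?D y" "y \<in> ?A" by (rule imageE)
    have ymax: "?D i \<le> ?D y" if "i \<in> ?A" for i unfolding y(1)[symmetric] using that by (intro Max_ge) auto
    have "t y \<le> t ?w \<and> (\<forall>j\<in>{..<n} - {?w}. t j \<le> t ?w \<longrightarrow> ?D j \<le> ?D y)"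
      using y(2) ymax by simp
    then have "t y < tau (?u y)"
      using wins y(2) unfolding wins_def good_def by blast
    also have "\<dots> \<le> tau (?u (\<sigma> j))" by (intro tau_mono ups_above_anti ymax jA)
    also have "\<dots> \<le> \<theta> j" by (rule acc)
    finally have lt: "t y < \<theta> j" .
    obtain m where m: "m < n" "\<sigma> m = y" using surj y(2) by blast
    have "m < j"
    proof (rule ccontr)
      assume "\<not> m < j"
      then have "\<theta> j \<le> \<theta> m" using mono m(1) by simp
      then show False using lt t[OF m(1)] m(2) by simp
    qed
    then show False using rec[of m] m ymax[OF jA] by simp
  qed
  have "q k0 * (\<Prod>j\<in>{0..<k0}. 1 - q j) = 1" using q0 qj by simp
  moreover have "q k0 * (\<Prod>j\<in>{0..<k0}. 1 - q j) \<le> pick_max_prob 0 n (\<lambda>k. a (\<sigma> k) (\<not> f (\<sigma> k))) q"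
    unfolding pick_max_prob_def
  proof (rule member_le_sum)
    have "a (\<sigma> j) (\<not> f (\<sigma> j)) \<le> a ?w (\<not> f ?w)" if "j < n" for j
    proof (cases "j = k0")
      case False
      have "side_less a (\<sigma> j, \<not> g (\<sigma> j)) (?w, \<not> g ?w)"
        using max[OF that False] side_rank_less_iff[OF \<sigma>n[OF that] w(1)] unfolding \<kappa>_def by blast
      then show ?thesis using val[of "\<sigma> j"] val[of ?w] by (auto simp: side_less_def)
    qed (use k0 in simp)
    then show "k0 \<in> {k. k \<in> {0..<n} \<and> (\<forall>j\<in>{0..<n}. a (\<sigma> j) (\<not> f (\<sigma> j)) \<le> a (\<sigma> k) (\<not> f (\<sigma> k)))}"
      using k0 by simp
    show "finite {k. k \<in> {0..<n} \<and> (\<forall>j\<in>{0..<n}. a (\<sigma> j) (\<not> f (\<sigma> j)) \<le> a (\<sigma> k) (\<not> f (\<sigma> k)))}" by simp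
    show "0 \<le> q k * (\<Prod>j\<in>{0..<k}. 1 - q j)" for k
      unfolding q_def det_rule_def by (intro mult_nonneg_nonneg prod_nonneg) auto
  qed
  ultimately show ?thesis unfolding sample_pick_def q_def by simp
qed

lemma sample_pick_bounds:
  assumes "sample_algorithm B"
  shows "sample_pick B n \<sigma> x y \<in> {0..1}"
  unfolding sample_pick_def using assms by (intro pick_max_prob_bounds) (simp add: sample_algorithm_def)

lemma sample_pick_sample_rule:
  "sample_pick sample_rule n \<sigma> x y
    = avg (clock_times n) (\<lambda>t. avg (faces n) (\<lambda>c. sample_pick (det_rule (arrival_times n t) c) n \<sigma> x y))"
proof -
  let ?Q = "\<lambda>(t, c). det_rule (arrival_times n t) c (map y [0..<n])"
  have "sample_pick sample_rule n \<sigma> x y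
    = pick_max_prob 0 n (\<lambda>k. x (\<sigma> k)) (\<lambda>j. mix (clock_times n \<times> faces n) ?Q (map (\<lambda>k. (\<sigma> k, x (\<sigma> k))) [0..<Suc j]))"
    unfolding sample_pick_def sample_rule_def by simp
  also have "\<dots> = avg (clock_times n \<times> faces n) (\<lambda>\<theta>. pick_max_prob 0 n (\<lambda>k. x (\<sigma> k)) (\<lambda>j. ?Q \<theta> (map (\<lambda>k. (\<sigma> k, x (\<sigma> k))) [0..<Suc j])))"
    by (rule pick_max_prob_mix) (auto simp: det_rule_def)
  also have "\<dots> = avg (clock_times n) (\<lambda>t. avg (faces n) (\<lambda>c. sample_pick (det_rule (arrival_times n t) c) n \<sigma> x y))"
    by (simp add: avg_Times sample_pick_def)
  finally show ?thesis .
qed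

text \<open>Card \<open>\<sigma> k\<close> receives the time \<open>t (\<rho> t k)\<close>, so the
  cards have the times \<open>t \<circ> (\<rho> t \<circ> inv \<sigma>)\<close>. Although
  \<open>\<rho> t\<close> depends on \<open>t\<close>, for each fixed \<open>t\<close> the
  permutation \<open>\<rho> t \<circ> inv \<sigma>\<close> is uniform because
  \<open>\<sigma>\<close> is. A permutation independent of the times is then absorbed by
  \<open>avg_funs_comp\<close>.\<close>

lemma sample_rule_success:
  assumes n: "1 \<le> n"
  shows "0.5009 \<le> avg (perms n) (\<lambda>\<sigma>. avg (faces n) (\<lambda>f.
    sample_pick sample_rule n \<sigma> (\<lambda>i. a i (\<not> f i)) (\<lambda>i. a i (f i))))"
proof -
  define \<kappa> where "\<kappa> = side_rank n a"
  define W where "W g t = (of_bool (wins n (\<lambda>i. \<kappa> i (\<not> g i)) (ups_above n \<kappa> g) (winner n \<kappa> g) t) :: real)" for g t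
  obtain \<rho> where \<rho>: "\<And>t. \<rho> t permutes {..<n}" "\<And>t k. k < n \<Longrightarrow> arrival_times n t k = t (\<rho> t k)"
    using arrival_times_perm[of n] by metis
  have bij: "bij_betw (\<lambda>\<sigma>. \<rho> t \<circ> inv \<sigma>) (perms n) (perms n)" for t
    using bij_betw_trans[OF bij_perms_inv bij_perms_comp_left[OF \<rho>(1)[of t]]] by (simp add: comp_def)
  have "0.5009 \<le> avg (faces n) (\<lambda>g. avg (clock_times n) (W g))"
    unfolding W_def by (rule avg_faces_wins[OF _ n]) (simp add: \<kappa>_def ranking_side_rank)
  also have "\<dots> = avg (perms n) (\<lambda>\<pi>. avg (clock_times n) (\<lambda>t. avg (faces n) (\<lambda>g. W g t)))"
    using avg_const[OF finite_perms perms_nonempty] by (subst avg_swap) simp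
  also have "\<dots> = avg (perms n) (\<lambda>\<pi>. avg (clock_times n) (\<lambda>t. avg (faces n) (\<lambda>g. W g (t \<circ> \<pi>))))"
    by (rule avg_cong) (use avg_funs_comp[where F="\<lambda>t. avg (faces n) (\<lambda>g. W g t)"] in simp)
  also have "\<dots> = avg (clock_times n) (\<lambda>t. avg (perms n) (\<lambda>\<pi>. avg (faces n) (\<lambda>g. W g (t \<circ> \<pi>))))"
    by (rule avg_swap)
  also have "\<dots> = avg (clock_times n) (\<lambda>t. avg (perms n) (\<lambda>\<sigma>. avg (faces n) (\<lambda>g. W g (t \<circ> (\<rho> t \<circ> inv \<sigma>)))))"
    by (rule avg_cong) (use avg_bij[OF bij, where F="\<lambda>\<pi>. avg (faces n) (\<lambda>g. W g (t \<circ> \<pi>))" for t] in simp)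
  also have "\<dots> = avg (perms n) (\<lambda>\<sigma>. avg (clock_times n) (\<lambda>t. avg (faces n) (\<lambda>g. W g (t \<circ> (\<rho> t \<circ> inv \<sigma>)))))"
    by (rule avg_swap)
  also have "\<dots> = avg (perms n) (\<lambda>\<sigma>. avg (clock_times n) (\<lambda>t. avg (faces n) (\<lambda>f. avg (faces n) (\<lambda>c.
      W (tie_break a f c) (t \<circ> (\<rho> t \<circ> inv \<sigma>))))))"
    unfolding tie_break_def
    by (intro avg_cong avg_funs_mix[where F="\<lambda>g. W g (t \<circ> (\<rho> t \<circ> inv \<sigma>))" for t \<sigma>, symmetric]) auto
  also have "\<dots> = avg (perms n) (\<lambda>\<sigma>. avg (faces n) (\<lambda>f. avg (clock_times n) (\<lambda>t. avg (faces n) (\<lambda>c.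
      W (tie_break a f c) (t \<circ> (\<rho> t \<circ> inv \<sigma>))))))"
    by (intro avg_cong avg_swap)
  also have "\<dots> \<le> avg (perms n) (\<lambda>\<sigma>. avg (faces n) (\<lambda>f. sample_pick sample_rule n \<sigma> (\<lambda>i. a i (\<not> f i)) (\<lambda>i. a i (f i))))"
    unfolding sample_pick_sample_rule
  proof (intro avg_mono)
    fix \<sigma> f t c assume "\<sigma> \<in> perms n"
    then have \<sigma>: "\<sigma> permutes {..<n}" by simp
    let ?x = "\<lambda>i. a i (\<not> f i)" and ?y = "\<lambda>i. a i (f i)"
    have nonneg: "0 \<le> sample_pick (det_rule (arrival_times n t) c) n \<sigma> ?x ?y"
      using sample_pick_bounds[of "det_rule (arrival_times n t) c"] det_rule_bounds
      by (simp add: sample_algorithm_def)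
    have t: "(t \<circ> (\<rho> t \<circ> inv \<sigma>)) (\<sigma> k) = arrival_times n t k" if "k < n" for k
      using \<rho>(2)[OF that] permutes_inverses(2)[OF \<sigma>] by simp
    show "W (tie_break a f c) (t \<circ> (\<rho> t \<circ> inv \<sigma>)) \<le> sample_pick (det_rule (arrival_times n t) c) n \<sigma> ?x ?y"
      using det_rule_success[where n=n and \<theta>="arrival_times n t" and t="t \<circ> (\<rho> t \<circ> inv \<sigma>)" and a=a and f=f and c=c,
          OF n \<sigma> arrival_times_mono t] nonneg
      unfolding W_def \<kappa>_def by (simp split: if_splits)
  qed
  finally show ?thesis .
qed

subsection \<open>The two-sided game\<close>

definition googol_pick :: "googol_algorithm \<Rightarrow> nat \<Rightarrow> (nat \<Rightarrow> bool \<Rightarrow> real) \<Rightarrow> (nat \<Rightarrow> nat) \<Rightarrow> (nat \<Rightarrow> bool) \<Rightarrow> real" where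
  "googol_pick A n a \<sigma> f = pick_max_prob 0 n (\<lambda>k. a (\<sigma> k) (\<not> f (\<sigma> k)))
     (\<lambda>j. A (map (\<lambda>k. a (\<sigma> k) (f (\<sigma> k))) [0..<n]) (map (\<lambda>k. a (\<sigma> k) (\<not> f (\<sigma> k))) [0..<Suc j]))"

lemma googol_success_eq_avg:
  "googol_success A n a = avg (perms n) (\<lambda>\<sigma>. avg (faces n) (googol_pick A n a \<sigma>))"
  unfolding googol_success_def random_order_def Pi_pmf_faces
  by (subst expectation_pair_pmf_of_set[OF finite_perms perms_nonempty _ faces_nonempty])
     (simp_all add: Let_def googol_pick_def[abs_def])

text \<open>The cards are relabelled at random, so that the table order carries no information on the labels.\<close>

definition relabelled :: "(nat \<Rightarrow> nat) \<Rightarrow> real list \<Rightarrow> real list \<Rightarrow> real" where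
  "relabelled \<pi> us ds = sample_rule (map (\<lambda>i. us ! inv \<pi> i) [0..<length us]) (map (\<lambda>k. (\<pi> k, ds ! k)) [0..<length ds])"

definition googol_rule :: googol_algorithm where
  "googol_rule us = mix (perms (length us)) (\<lambda>\<pi>. relabelled \<pi> us)"

lemma same_comparisons_reindex:
  assumes "same_comparisons v w" "\<And>i. i < m \<Longrightarrow> \<phi> i < length v"
  shows "same_comparisons (map (\<lambda>i. v ! \<phi> i) [0..<m]) (map (\<lambda>i. w ! \<phi> i) [0..<m])"
  using assms by (auto simp: same_comparisons_def)

lemma relabelled_cong:
  assumes \<pi>: "\<pi> permutes {..<length us}" and len: "length us = length us'"
    and cmp: "same_comparisons (us @ ds) (us' @ ds')"
  shows "relabelled \<pi> us ds = relabelled \<pi> us' ds'"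
proof -
  let ?n = "length us" and ?\<phi> = "\<lambda>i. if i < length us then inv \<pi> i else i"
  have ds: "length ds = length ds'" by (rule same_comparisons_append(1)[OF cmp len])
  have inv: "inv \<pi> i < ?n" if "i < ?n" for i using perms_less[OF permutes_inv[OF \<pi>]] that by simp
  have eq: "map (\<lambda>i. vs ! inv \<pi> i) [0..<?n] @ map snd (map (\<lambda>k. (\<pi> k, es ! k)) [0..<m])
     = map (\<lambda>i. (vs @ es) ! ?\<phi> i) [0..<?n + m]" if "length vs = ?n" "length es = m" for m and vs es :: "real list"
    by (rule nth_equalityI) (use that inv in \<open>auto simp: nth_append\<close>)
  show ?thesis
    unfolding relabelled_def len[symmetric]
  proof (rule sample_rule_comparison_based[unfolded sample_comparison_based_def, rule_format])
    show "map fst (map (\<lambda>k. (\<pi> k, ds ! k)) [0..<length ds]) = map fst (map (\<lambda>k. (\<pi> k, ds' ! k)) [0..<length ds'])"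
      using ds by simp
    show "same_comparisons (map (\<lambda>i. us ! inv \<pi> i) [0..<?n] @ map snd (map (\<lambda>k. (\<pi> k, ds ! k)) [0..<length ds]))
      (map (\<lambda>i. us' ! inv \<pi> i) [0..<?n] @ map snd (map (\<lambda>k. (\<pi> k, ds' ! k)) [0..<length ds']))"
      unfolding eq[OF refl refl] eq[OF len[symmetric] refl] unfolding ds[symmetric]
      by (rule same_comparisons_reindex[OF cmp]) (use inv in \<open>auto intro: trans_less_add1\<close>)
  qed simp
qed

lemma googol_rule_algorithm: "googol_algorithm googol_rule"
  unfolding googol_algorithm_def googol_rule_def
  using sample_rule_algorithm
  by (intro allI mix_bounds) (simp add: relabelled_def sample_algorithm_def)

lemma googol_rule_comparison_based: "googol_comparison_based googol_rule"
  unfolding googol_comparison_based_def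
proof (intro allI impI)
  fix us ds us' ds' :: "real list"
  assume len: "length us = length us'" and cmp: "same_comparisons (us @ ds) (us' @ ds')"
  show "googol_rule us ds = googol_rule us' ds'"
    unfolding googol_rule_def len[symmetric]
  proof (rule mix_cong)
    show "length ds = length ds'" by (rule same_comparisons_append(1)[OF cmp len])
    fix \<pi> k assume "\<pi> \<in> perms (length us)"
    then show "relabelled \<pi> us (take k ds) = relabelled \<pi> us' (take k ds')"
      using same_comparisons_take[OF cmp, of "length us + k"] len
      by (intro relabelled_cong) auto
  qed
qed

text \<open>In table order \<open>\<sigma>\<close> with labels \<open>\<pi>\<close>, label
  \<open>i\<close> stands for card \<open>(\<sigma> \<circ> inv \<pi>) i\<close>, and the labels are
  flipped in the order \<open>\<pi>\<close>. For independent uniform \<open>\<sigma>\<close> and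
  \<open>\<pi>\<close>, the renumbering and the order are again independent and uniform, so
  \<open>sample_rule_success\<close> applies to each renumbered instance.\<close>

lemma googol_rule_success:
  assumes "1 \<le> n"
  shows "0.5009 \<le> googol_success googol_rule n a"
proof -
  define G where "G \<pi> \<rho> f = sample_pick sample_rule n \<pi> (\<lambda>i. a (\<rho> i) (\<not> f i)) (\<lambda>i. a (\<rho> i) (f i))" for \<pi> \<rho> f
  have pick: "googol_pick googol_rule n a \<sigma> f = avg (perms n) (\<lambda>\<pi>. G \<pi> (\<sigma> \<circ> inv \<pi>) (f \<circ> (\<sigma> \<circ> inv \<pi>)))" for \<sigma> f
  proof -
    let ?up = "map (\<lambda>k. a (\<sigma> k) (f (\<sigma> k))) [0..<n]" and ?d = "\<lambda>k. a (\<sigma> k) (\<not> f (\<sigma> k))"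
    have "googol_pick googol_rule n a \<sigma> f = pick_max_prob 0 n ?d (\<lambda>j. mix (perms n) (\<lambda>\<pi>. relabelled \<pi> ?up) (map ?d [0..<Suc j]))"
      unfolding googol_pick_def googol_rule_def by simp
    also have "\<dots> = avg (perms n) (\<lambda>\<pi>. pick_max_prob 0 n ?d (\<lambda>j. relabelled \<pi> ?up (map ?d [0..<Suc j])))"
      by (rule pick_max_prob_mix[OF _ finite_perms perms_nonempty])
         (use sample_rule_algorithm in \<open>simp add: relabelled_def sample_algorithm_def\<close>)
    also have "\<dots> = avg (perms n) (\<lambda>\<pi>. G \<pi> (\<sigma> \<circ> inv \<pi>) (f \<circ> (\<sigma> \<circ> inv \<pi>)))"
    proof (rule avg_cong)
      fix \<pi> assume "\<pi> \<in> perms n"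
      then have \<pi>: "\<pi> permutes {..<n}" by simp
      have inv: "inv \<pi> (\<pi> k) = k" for k by (rule permutes_inverses(2)[OF \<pi>])
      have 1: "map (\<lambda>i. ?up ! inv \<pi> i) [0..<length ?up] = map (\<lambda>i. a ((\<sigma> \<circ> inv \<pi>) i) ((f \<circ> (\<sigma> \<circ> inv \<pi>)) i)) [0..<n]"
        using perms_less[OF permutes_inv[OF \<pi>]] by auto
      have 2: "map (\<lambda>k. (\<pi> k, map ?d [0..<Suc j] ! k)) [0..<length (map ?d [0..<Suc j])]
        = map (\<lambda>k. (\<pi> k, a ((\<sigma> \<circ> inv \<pi>) (\<pi> k)) (\<not> (f \<circ> (\<sigma> \<circ> inv \<pi>)) (\<pi> k)))) [0..<Suc j]" for j
        by (rule nth_equalityI) (simp_all add: inv del: upt_Suc)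
      show "pick_max_prob 0 n ?d (\<lambda>j. relabelled \<pi> ?up (map ?d [0..<Suc j])) = G \<pi> (\<sigma> \<circ> inv \<pi>) (f \<circ> (\<sigma> \<circ> inv \<pi>))"
        unfolding G_def sample_pick_def relabelled_def 1 2 by (simp add: inv del: upt_Suc)
    qed
    finally show ?thesis .
  qed
  have "googol_success googol_rule n a
    = avg (perms n) (\<lambda>\<sigma>. avg (perms n) (\<lambda>\<pi>. avg (faces n) (\<lambda>f. G \<pi> (\<sigma> \<circ> inv \<pi>) (f \<circ> (\<sigma> \<circ> inv \<pi>)))))"
    unfolding googol_success_eq_avg pick by (intro avg_cong avg_swap)
  also have "\<dots> = avg (perms n) (\<lambda>\<sigma>. avg (perms n) (\<lambda>\<pi>. avg (faces n) (\<lambda>f. G \<pi> (\<sigma> \<circ> inv \<pi>) f)))"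
    by (rule avg_cong, rule avg_cong, rule avg_funs_comp[where F="G \<pi> \<rho>" for \<pi> \<rho>])
       (auto intro: permutes_compose permutes_inv)
  also have "\<dots> = avg (perms n) (\<lambda>\<pi>. avg (perms n) (\<lambda>\<sigma>. avg (faces n) (\<lambda>f. G \<pi> (\<sigma> \<circ> inv \<pi>) f)))"
    by (rule avg_swap)
  also have "\<dots> = avg (perms n) (\<lambda>\<pi>. avg (perms n) (\<lambda>\<rho>. avg (faces n) (\<lambda>f. G \<pi> \<rho> f)))"
    by (intro avg_cong avg_bij[OF bij_perms_comp_right, where F="\<lambda>\<rho>. avg (faces n) (\<lambda>f. G \<pi> \<rho> f)" for \<pi>])
       (auto intro: permutes_inv)
  also have "\<dots> = avg (perms n) (\<lambda>\<rho>. avg (perms n) (\<lambda>\<pi>. avg (faces n) (\<lambda>f. G \<pi> \<rho> f)))"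
    by (rule avg_swap)
  also have "\<dots> \<ge> 0.5009"
    unfolding G_def by (rule avg_ge[OF finite_perms perms_nonempty]) (rule sample_rule_success[OF assms])
  finally show ?thesis .
qed

subsection \<open>Independent values\<close>

text \<open>There are finitely many comparison patterns and each of them is a measurable event. This
  is the source of measurability for quantities built from arbitrary comparison-based
  algorithms.\<close>

lemma borel_measurable_comparisons:
  fixes X :: "'k \<Rightarrow> 'a \<Rightarrow> real" and G :: "'a \<Rightarrow> real"
  assumes "finite K" and X: "\<And>k. k \<in> K \<Longrightarrow> X k \<in> borel_measurable M"
    and G: "\<And>\<omega> \<omega>'. \<omega> \<in> space M \<Longrightarrow> \<omega>' \<in> space M \<Longrightarrow>
      (\<And>k l. k \<in> K \<Longrightarrow> l \<in> K \<Longrightarrow> X k \<omega> < X l \<omega> \<longleftrightarrow> X k \<omega>' < X l \<omega>') \<Longrightarrow> G \<omega> = G \<omega>'"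
  shows "G \<in> borel_measurable M"
proof -
  define pat where "pat \<omega> = {p \<in> K \<times> K. X (fst p) \<omega> < X (snd p) \<omega>}" for \<omega>
  define g where "g R = G (SOME \<omega>. \<omega> \<in> space M \<and> pat \<omega> = R)" for R
  have "pat \<in> measurable M (count_space (Pow (K \<times> K)))"
  proof -
    have fin: "finite (Pow (K \<times> K))" using assms(1) by simp
    have "pat -` {R} \<inter> space M \<in> sets M" if "R \<subseteq> K \<times> K" for R
    proof -
      have "pat \<omega> = R \<longleftrightarrow> (\<forall>p\<in>K \<times> K. p \<in> R \<longleftrightarrow> X (fst p) \<omega> < X (snd p) \<omega>)" for \<omega>
        unfolding pat_def using that by blast
      then have "pat -` {R} \<inter> space M = {\<omega> \<in> space M. \<forall>p\<in>K \<times> K. p \<in> R \<longleftrightarrow> X (fst p) \<omega> < X (snd p) \<omega>}"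
        by blast
      also have "\<dots> \<in> sets M"
      proof (rule sets.sets_Collect_finite_All)
        show "finite (K \<times> K)" using assms(1) by simp
        fix p assume "p \<in> K \<times> K"
        then have m: "X (fst p) \<in> borel_measurable M" "X (snd p) \<in> borel_measurable M" using X by auto
        have "{\<omega> \<in> space M. X (fst p) \<omega> < X (snd p) \<omega>} \<in> sets M" using m by measurable
        then show "{\<omega> \<in> space M. p \<in> R \<longleftrightarrow> X (fst p) \<omega> < X (snd p) \<omega>} \<in> sets M"
          by (cases "p \<in> R") (auto dest: sets.sets_Collect_neg)
      qed
      finally show ?thesis .
    qed
    then show ?thesis unfolding measurable_count_space_eq2[OF fin] by (auto simp: pat_def)
  qed
  then have "(\<lambda>\<omega>. g (pat \<omega>)) \<in> borel_measurable M"
    by (rule measurable_compose) simp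
  moreover have "g (pat \<omega>) = G \<omega>" if "\<omega> \<in> space M" for \<omega>
  proof -
    let ?\<omega> = "SOME \<omega>'. \<omega>' \<in> space M \<and> pat \<omega>' = pat \<omega>"
    have *: "?\<omega> \<in> space M \<and> pat ?\<omega> = pat \<omega>" by (rule someI[of _ \<omega>]) (use that in simp)
    show ?thesis unfolding g_def
    proof (rule G)
      fix k l assume "k \<in> K" "l \<in> K"
      then have "X k \<xi> < X l \<xi> \<longleftrightarrow> (k, l) \<in> pat \<xi>" for \<xi> by (simp add: pat_def)
      then show "X k ?\<omega> < X l ?\<omega> \<longleftrightarrow> X k \<omega> < X l \<omega>" using * by simp
    qed (use * that in auto)
  qed
  ultimately show ?thesis by (subst measurable_cong[of _ _ "\<lambda>\<omega>. g (pat \<omega>)"]) auto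
qed

lemma pick_max_prob_cong:
  assumes "\<And>j k. j \<in> {s..<n} \<Longrightarrow> k \<in> {s..<n} \<Longrightarrow> v j < v k \<longleftrightarrow> v' j < v' k"
    and "\<And>j. j \<in> {s..<n} \<Longrightarrow> q j = q' j"
  shows "pick_max_prob s n v q = pick_max_prob s n v' q'"
  unfolding pick_max_prob_def
proof (rule sum.cong)
  show "{k. k \<in> {s..<n} \<and> (\<forall>j\<in>{s..<n}. v j \<le> v k)} = {k. k \<in> {s..<n} \<and> (\<forall>j\<in>{s..<n}. v' j \<le> v' k)}"
    using assms(1) by (auto simp: not_less[symmetric])
  fix k assume "k \<in> {k. k \<in> {s..<n} \<and> (\<forall>j\<in>{s..<n}. v' j \<le> v' k)}"
  then have k: "k \<in> {s..<n}" by simp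
  have "(\<Prod>j\<in>{s..<k}. 1 - q j) = (\<Prod>j\<in>{s..<k}. 1 - q' j)"
    using assms(2) k by (intro prod.cong) auto
  then show "q k * (\<Prod>j\<in>{s..<k}. 1 - q j) = q' k * (\<Prod>j\<in>{s..<k}. 1 - q' j)" using assms(2)[OF k] by simp
qed

lemma sample_pick_cong:
  assumes B: "sample_comparison_based B" and \<sigma>: "\<sigma> permutes {..<n}"
    and xx: "\<And>i j. i < n \<Longrightarrow> j < n \<Longrightarrow> x i < x j \<longleftrightarrow> x' i < x' j"
    and xy: "\<And>i j. i < n \<Longrightarrow> j < n \<Longrightarrow> x i < y j \<longleftrightarrow> x' i < y' j"
    and yx: "\<And>i j. i < n \<Longrightarrow> j < n \<Longrightarrow> y i < x j \<longleftrightarrow> y' i < x' j"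
    and yy: "\<And>i j. i < n \<Longrightarrow> j < n \<Longrightarrow> y i < y j \<longleftrightarrow> y' i < y' j"
  shows "sample_pick B n \<sigma> x y = sample_pick B n \<sigma> x' y'"
  unfolding sample_pick_def
proof (rule pick_max_prob_cong)
  have \<sigma>n: "\<sigma> k < n" if "k < n" for k using perms_less[OF \<sigma>] that by simp
  show "x (\<sigma> j) < x (\<sigma> k) \<longleftrightarrow> x' (\<sigma> j) < x' (\<sigma> k)" if "j \<in> {0..<n}" "k \<in> {0..<n}" for j k
    using that by (intro xx \<sigma>n) auto
  fix j assume j: "j \<in> {0..<n}"
  show "B (map y [0..<n]) (map (\<lambda>k. (\<sigma> k, x (\<sigma> k))) [0..<Suc j])
    = B (map y' [0..<n]) (map (\<lambda>k. (\<sigma> k, x' (\<sigma> k))) [0..<Suc j])"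
  proof (rule B[unfolded sample_comparison_based_def, rule_format])
    show "same_comparisons (map y [0..<n] @ map snd (map (\<lambda>k. (\<sigma> k, x (\<sigma> k))) [0..<Suc j]))
      (map y' [0..<n] @ map snd (map (\<lambda>k. (\<sigma> k, x' (\<sigma> k))) [0..<Suc j]))"
      unfolding same_comparisons_def
    proof (intro conjI allI impI)
      fix i l assume "i < length (map y [0..<n] @ map snd (map (\<lambda>k. (\<sigma> k, x (\<sigma> k))) [0..<Suc j]))"
        "l < length (map y [0..<n] @ map snd (map (\<lambda>k. (\<sigma> k, x (\<sigma> k))) [0..<Suc j]))"
      then have i: "i < n + Suc j" and l: "l < n + Suc j" by simp_all
      have "\<sigma> (i - n) < n" if "\<not> i < n" using that i j by (intro \<sigma>n) auto
      moreover have "\<sigma> (l - n) < n" if "\<not> l < n" using that l j by (intro \<sigma>n) auto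
      ultimately show "(map y [0..<n] @ map snd (map (\<lambda>k. (\<sigma> k, x (\<sigma> k))) [0..<Suc j])) ! i
          < (map y [0..<n] @ map snd (map (\<lambda>k. (\<sigma> k, x (\<sigma> k))) [0..<Suc j])) ! l \<longleftrightarrow>
        (map y' [0..<n] @ map snd (map (\<lambda>k. (\<sigma> k, x' (\<sigma> k))) [0..<Suc j])) ! i
          < (map y' [0..<n] @ map snd (map (\<lambda>k. (\<sigma> k, x' (\<sigma> k))) [0..<Suc j])) ! l"
        using i l xx xy yx yy by (simp add: nth_append del: upt_Suc)
    qed simp
  qed simp_all
qed

section \<open>The joint distribution of samples and values\<close>

abbreviation sides :: "nat \<Rightarrow> (nat \<times> bool) set" where
  "sides n \<equiv> {..<n} \<times> UNIV"

abbreviation sides_measure :: "nat \<Rightarrow> (nat \<Rightarrow> real measure) \<Rightarrow> (nat \<times> bool \<Rightarrow> real) measure" where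
  "sides_measure n D \<equiv> (\<Pi>\<^sub>M k\<in>sides n. D (fst k))"

definition side_pick :: "sample_algorithm \<Rightarrow> nat \<Rightarrow> (nat \<Rightarrow> nat) \<Rightarrow> (nat \<times> bool \<Rightarrow> real) \<Rightarrow> real" where
  "side_pick B n \<sigma> \<omega> = sample_pick B n \<sigma> (\<lambda>i. \<omega> (i, True)) (\<lambda>i. \<omega> (i, False))"

text \<open>Samples and values are merged into a single product indexed by sides, so that exchanging
  them becomes a reindexing of coordinates.\<close>

lemma pair_PiM_eq_distr_sides:
  assumes "\<And>i. prob_space (D i)"
  shows "(\<Pi>\<^sub>M i\<in>{..<n}. D i) \<Otimes>\<^sub>M (\<Pi>\<^sub>M i\<in>{..<n}. D i)
    = distr (sides_measure n D) ((\<Pi>\<^sub>M i\<in>{..<n}. D i) \<Otimes>\<^sub>M (\<Pi>\<^sub>M i\<in>{..<n}. D i))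
        (\<lambda>\<omega>. (\<lambda>i\<in>{..<n}. \<omega> (i, True), \<lambda>i\<in>{..<n}. \<omega> (i, False)))"
proof -
  let ?M = "\<lambda>k::nat \<times> bool. D (fst k)" and ?I = "\<lambda>b. {..<n} \<times> {b}" and ?P = "\<Pi>\<^sub>M i\<in>{..<n}. D i"
  let ?f = "\<lambda>b \<omega>. \<lambda>i\<in>{..<n}. \<omega> (i, b)"
  interpret product_sigma_finite ?M
    unfolding product_sigma_finite_def using assms prob_space_imp_sigma_finite by blast
  have P: "prob_space ?P" by (rule prob_space_PiM) (rule assms)
  have re: "distr (\<Pi>\<^sub>M k\<in>?I b. ?M k) ?P (?f b) = ?P" for b
    using distr_PiM_reindex[of "?I b" ?M "\<lambda>i. (i, b)" "{..<n}"] assms by (auto simp: inj_on_def)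
  have f: "?f b \<in> measurable (\<Pi>\<^sub>M k\<in>?I b. ?M k) ?P" for b
  proof (rule measurable_restrict)
    fix i assume "i \<in> {..<n}"
    then show "(\<lambda>\<omega>. \<omega> (i, b)) \<in> measurable (\<Pi>\<^sub>M k\<in>?I b. ?M k) (D i)"
      using measurable_component_singleton[of "(i, b)" "?I b" ?M] by simp
  qed
  have f': "?f b \<in> measurable (sides_measure n D) ?P" for b
  proof (rule measurable_restrict)
    fix i assume "i \<in> {..<n}"
    then show "(\<lambda>\<omega>. \<omega> (i, b)) \<in> measurable (sides_measure n D) (D i)"
      using measurable_component_singleton[of "(i, b)" "sides n" ?M] by simp
  qed
  have e: "?I True \<union> ?I False = sides n" by auto
  have mrg: "distr ((\<Pi>\<^sub>M k\<in>?I True. ?M k) \<Otimes>\<^sub>M (\<Pi>\<^sub>M k\<in>?I False. ?M k)) (sides_measure n D) (merge (?I True) (?I False))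
    = sides_measure n D"
    using distr_merge[of "?I True" "?I False"] unfolding e by auto
  have "?P \<Otimes>\<^sub>M ?P = distr (\<Pi>\<^sub>M k\<in>?I True. ?M k) ?P (?f True) \<Otimes>\<^sub>M distr (\<Pi>\<^sub>M k\<in>?I False. ?M k) ?P (?f False)"
    unfolding re ..
  also have "\<dots> = distr ((\<Pi>\<^sub>M k\<in>?I True. ?M k) \<Otimes>\<^sub>M (\<Pi>\<^sub>M k\<in>?I False. ?M k)) (?P \<Otimes>\<^sub>M ?P) (\<lambda>(x, y). (?f True x, ?f False y))"
    using P prob_space_imp_sigma_finite by (intro pair_measure_distr f) (auto simp: re)
  also have "\<dots> = distr ((\<Pi>\<^sub>M k\<in>?I True. ?M k) \<Otimes>\<^sub>M (\<Pi>\<^sub>M k\<in>?I False. ?M k)) (?P \<Otimes>\<^sub>M ?P)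
      ((\<lambda>\<omega>. (?f True \<omega>, ?f False \<omega>)) \<circ> merge (?I True) (?I False))"
    by (intro distr_cong refl) (auto simp: merge_def fun_eq_iff split: prod.split)
  also have "\<dots> = distr (distr ((\<Pi>\<^sub>M k\<in>?I True. ?M k) \<Otimes>\<^sub>M (\<Pi>\<^sub>M k\<in>?I False. ?M k)) (sides_measure n D) (merge (?I True) (?I False)))
      (?P \<Otimes>\<^sub>M ?P) (\<lambda>\<omega>. (?f True \<omega>, ?f False \<omega>))"
  proof (rule distr_distr[symmetric])
    show "(\<lambda>\<omega>. (?f True \<omega>, ?f False \<omega>)) \<in> sides_measure n D \<rightarrow>\<^sub>M ?P \<Otimes>\<^sub>M ?P" using f' by measurable
    show "merge (?I True) (?I False) \<in> (\<Pi>\<^sub>M k\<in>?I True. ?M k) \<Otimes>\<^sub>M (\<Pi>\<^sub>M k\<in>?I False. ?M k) \<rightarrow>\<^sub>M sides_measure n D"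
      using measurable_merge[of "?I True" "?I False" ?M] unfolding e .
  qed
  finally show ?thesis unfolding mrg .
qed

lemma integral_avg:
  fixes F :: "'b \<Rightarrow> 'a \<Rightarrow> real"
  assumes "\<And>x. x \<in> S \<Longrightarrow> integrable M (F x)"
  shows "(LINT \<omega>|M. avg S (\<lambda>x. F x \<omega>)) = avg S (\<lambda>x. LINT \<omega>|M. F x \<omega>)"
    and "integrable M (\<lambda>\<omega>. avg S (\<lambda>x. F x \<omega>))"
  using assms by (simp_all add: avg_def Bochner_Integration.integral_sum)

lemma real_distribution_measurable_component:
  assumes "\<And>i. real_distribution (D i)" "k \<in> sides n"
  shows "(\<lambda>\<omega>. \<omega> k) \<in> borel_measurable (sides_measure n D)"
proof -
  have "(\<lambda>\<omega>. \<omega> k) \<in> measurable (sides_measure n D) (D (fst k))"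
    using measurable_component_singleton[of k "sides n" "\<lambda>k. D (fst k)"] assms(2) by blast
  moreover have "measurable (sides_measure n D) (D (fst k)) = borel_measurable (sides_measure n D)"
    by (rule measurable_cong_sets[OF refl]) (rule real_distribution.events_eq_borel[OF assms(1)])
  ultimately show ?thesis by blast
qed

locale iid_sides =
  fixes B :: sample_algorithm and n :: nat and D :: "nat \<Rightarrow> real measure"
  assumes B: "sample_algorithm B" "sample_comparison_based B"
    and D: "\<And>i. real_distribution (D i)"
begin

lemma prob_D: "prob_space (D i)"
  using D by (simp add: real_distribution_def)

sublocale N: prob_space "sides_measure n D"
  by (rule prob_space_PiM) (rule prob_D)

lemma side_pick_measurable:
  assumes "\<sigma> permutes {..<n}"
  shows "side_pick B n \<sigma> \<in> borel_measurable (sides_measure n D)"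
proof (rule borel_measurable_comparisons[where K="sides n" and X="\<lambda>k \<omega>. \<omega> k"])
  fix \<omega> \<omega>' :: "nat \<times> bool \<Rightarrow> real"
  assume *: "\<And>k l. k \<in> sides n \<Longrightarrow> l \<in> sides n \<Longrightarrow> \<omega> k < \<omega> l \<longleftrightarrow> \<omega>' k < \<omega>' l"
  show "side_pick B n \<sigma> \<omega> = side_pick B n \<sigma> \<omega>'"
    unfolding side_pick_def by (rule sample_pick_cong[OF B(2) assms]; rule *) auto
next
  fix k assume "k \<in> sides n"
  then show "(\<lambda>\<omega>. \<omega> k) \<in> borel_measurable (sides_measure n D)"
    by (rule real_distribution_measurable_component[OF D])
qed simp

lemma integrable_side_pick:
  assumes "\<sigma> permutes {..<n}"
  shows "integrable (sides_measure n D) (side_pick B n \<sigma>)"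
proof (rule N.integrable_const_bound[where B=1])
  have "norm (side_pick B n \<sigma> \<omega>) \<le> 1" for \<omega>
    using sample_pick_bounds[OF B(1)] unfolding side_pick_def by simp
  then show "AE \<omega> in sides_measure n D. norm (side_pick B n \<sigma> \<omega>) \<le> 1" by (intro AE_I2)
qed (rule side_pick_measurable[OF assms])

lemma sample_success_eq:
  "sample_success B n D = avg (perms n) (\<lambda>\<sigma>. LINT \<omega>|sides_measure n D. side_pick B n \<sigma> \<omega>)"
  unfolding sample_success_def expectation_random_order
proof (rule avg_cong)
  fix \<sigma> assume "\<sigma> \<in> perms n"
  then have \<sigma>: "\<sigma> permutes {..<n}" by simp
  let ?P = "\<Pi>\<^sub>M i\<in>{..<n}. D i"
  let ?F = "\<lambda>z. sample_pick B n \<sigma> (fst z) (snd z)"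
  let ?h = "\<lambda>\<omega>. (\<lambda>i\<in>{..<n}. \<omega> (i, True), \<lambda>i\<in>{..<n}. \<omega> (i, False))"
  have h: "?h \<in> measurable (sides_measure n D) (?P \<Otimes>\<^sub>M ?P)"
  proof -
    have "(\<lambda>\<omega>. \<lambda>i\<in>{..<n}. \<omega> (i, b)) \<in> measurable (sides_measure n D) ?P" for b
    proof (rule measurable_restrict)
      fix i assume "i \<in> {..<n}"
      then show "(\<lambda>\<omega>. \<omega> (i, b)) \<in> measurable (sides_measure n D) (D i)"
        using measurable_component_singleton[of "(i, b)" "sides n" "\<lambda>k. D (fst k)"] by simp
    qed
    then show ?thesis by measurable
  qed
  have F: "?F \<in> borel_measurable (?P \<Otimes>\<^sub>M ?P)"
  proof (rule borel_measurable_comparisons[where K="sides n" and X="\<lambda>k z. (if snd k then fst z else snd z) (fst k)"])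
    fix k assume k: "k \<in> sides n"
    have "(\<lambda>x. x (fst k)) \<in> measurable ?P (D (fst k))" 
      by (rule measurable_component_singleton) (use k in \<open>auto simp: mem_Times_iff\<close>)
    moreover have "measurable ?P (D (fst k)) = borel_measurable ?P"
      by (rule measurable_cong_sets[OF refl]) (rule real_distribution.events_eq_borel[OF D])
    ultimately have m: "(\<lambda>x. x (fst k)) \<in> borel_measurable ?P" by blast
    show "(\<lambda>z. (if snd k then fst z else snd z) (fst k)) \<in> borel_measurable (?P \<Otimes>\<^sub>M ?P)"
      using measurable_compose[OF measurable_fst m] measurable_compose[OF measurable_snd m] by (cases "snd k") simp_all
  next
    fix z z' :: "(nat \<Rightarrow> real) \<times> (nat \<Rightarrow> real)"
    assume *: "\<And>k l. k \<in> sides n \<Longrightarrow> l \<in> sides n \<Longrightarrow>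
      (if snd k then fst z else snd z) (fst k) < (if snd l then fst z else snd z) (fst l) \<longleftrightarrow>
      (if snd k then fst z' else snd z') (fst k) < (if snd l then fst z' else snd z') (fst l)"
    have **: "(if b then fst z else snd z) i < (if c then fst z else snd z) j \<longleftrightarrow>
      (if b then fst z' else snd z') i < (if c then fst z' else snd z') j" if "i < n" "j < n" for i j b c
      using *[of "(i, b)" "(j, c)"] that by simp
    show "?F z = ?F z'"
      by (rule sample_pick_cong[OF B(2) \<sigma>])
         (use **[of _ _ True True] **[of _ _ True False] **[of _ _ False True] **[of _ _ False False] in simp_all)
  qed simp
  have "(LINT (x, y)|(?P \<Otimes>\<^sub>M ?P). pick_max_prob 0 n (\<lambda>k. x (\<sigma> k))
      (\<lambda>j. B (map y [0..<n]) (map (\<lambda>k. (\<sigma> k, x (\<sigma> k))) [0..<Suc j]))) = (LINT z|(?P \<Otimes>\<^sub>M ?P). ?F z)"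
    by (rule Bochner_Integration.integral_cong) (auto simp: sample_pick_def split: prod.split)
  also have "\<dots> = (LINT z|distr (sides_measure n D) (?P \<Otimes>\<^sub>M ?P) ?h. ?F z)"
    by (rule arg_cong[where f="\<lambda>M. integral\<^sup>L M ?F", OF pair_PiM_eq_distr_sides[OF prob_D]])
  also have "\<dots> = (LINT \<omega>|sides_measure n D. ?F (?h \<omega>))" by (rule integral_distr[OF h F])
  also have "\<dots> = (LINT \<omega>|sides_measure n D. side_pick B n \<sigma> \<omega>)"
    unfolding side_pick_def
    by (intro Bochner_Integration.integral_cong refl sample_pick_cong[OF B(2) \<sigma>]) auto
  finally show "(LINT (x, y)|(?P \<Otimes>\<^sub>M ?P). pick_max_prob 0 n (\<lambda>k. x (\<sigma> k))
      (\<lambda>j. B (map y [0..<n]) (map (\<lambda>k. (\<sigma> k, x (\<sigma> k))) [0..<Suc j]))) = (LINT \<omega>|sides_measure n D. side_pick B n \<sigma> \<omega>)" .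
qed

text \<open>The product measure is invariant under an injective reindexing that respects the
  distributions of the coordinates.\<close>

lemma side_pick_reindex:
  assumes \<sigma>: "\<sigma> permutes {..<n}" and h: "inj_on h (sides n)" "h \<in> sides n \<rightarrow> sides n"
    and Dh: "\<And>k. k \<in> sides n \<Longrightarrow> D (fst (h k)) = D (fst k)"
  shows "(LINT \<omega>|sides_measure n D. side_pick B n \<sigma> (\<lambda>k. \<omega> (h k))) = (LINT \<omega>|sides_measure n D. side_pick B n \<sigma> \<omega>)"
    and "integrable (sides_measure n D) (\<lambda>\<omega>. side_pick B n \<sigma> (\<lambda>k. \<omega> (h k)))"
proof -
  let ?N = "sides_measure n D" and ?r = "\<lambda>\<omega>. \<lambda>k\<in>sides n. \<omega> (h k)"
  have eq: "(\<Pi>\<^sub>M k\<in>sides n. D (fst (h k))) = ?N" by (rule PiM_cong) (use Dh in auto)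
  have d: "distr ?N ?N ?r = ?N"
    using distr_PiM_reindex[of "sides n" "\<lambda>k. D (fst k)" h "sides n"] prob_D h unfolding eq by blast
  have r: "?r \<in> measurable ?N ?N"
  proof (rule measurable_restrict)
    fix k assume k: "k \<in> sides n"
    then have "h k \<in> sides n" using h by blast
    then show "(\<lambda>\<omega>. \<omega> (h k)) \<in> measurable ?N (D (fst k))"
      using measurable_component_singleton[of "h k" "sides n" "\<lambda>k. D (fst k)"] Dh[OF k] by simp
  qed
  have c: "side_pick B n \<sigma> (?r \<omega>) = side_pick B n \<sigma> (\<lambda>k. \<omega> (h k))" for \<omega>
    unfolding side_pick_def by (rule sample_pick_cong[OF B(2) \<sigma>]) auto
  have "(LINT \<omega>|?N. side_pick B n \<sigma> \<omega>) = (LINT \<omega>|distr ?N ?N ?r. side_pick B n \<sigma> \<omega>)" unfolding d ..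
  also have "\<dots> = (LINT \<omega>|?N. side_pick B n \<sigma> (?r \<omega>))" by (rule integral_distr[OF r side_pick_measurable[OF \<sigma>]])
  finally show "(LINT \<omega>|?N. side_pick B n \<sigma> (\<lambda>k. \<omega> (h k))) = (LINT \<omega>|?N. side_pick B n \<sigma> \<omega>)" unfolding c ..
  have "integrable (distr ?N ?N ?r) (side_pick B n \<sigma>)" unfolding d by (rule integrable_side_pick[OF \<sigma>])
  then have "integrable ?N (\<lambda>\<omega>. side_pick B n \<sigma> (?r \<omega>))" by (rule integrable_distr[OF r])
  then show "integrable ?N (\<lambda>\<omega>. side_pick B n \<sigma> (\<lambda>k. \<omega> (h k)))" unfolding c .
qed

text \<open>For each \<open>i\<close> a fair coin decides which of the two independent draws from
  \<open>D i\<close> is the sample; this leaves the joint distribution unchanged. For given draws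
  the coins are the faces of cards with sides \<open>\<omega> (i, True)\<close> and
  \<open>\<omega> (i, False)\<close>, so the bound for fixed instances applies pointwise.\<close>

lemma sample_success_ge:
  assumes core: "\<And>a. c \<le> avg (perms n) (\<lambda>\<sigma>. avg (faces n) (\<lambda>f. sample_pick B n \<sigma> (\<lambda>i. a i (\<not> f i)) (\<lambda>i. a i (f i))))"
  shows "c \<le> sample_success B n D"
proof -
  let ?N = "sides_measure n D"
  let ?h = "\<lambda>f k. (fst k, snd k \<noteq> f (fst k))"
  let ?G = "\<lambda>\<sigma> f \<omega>. side_pick B n \<sigma> (\<lambda>k. \<omega> (?h f k))"
  have G: "?G \<sigma> f \<omega> = sample_pick B n \<sigma> (\<lambda>i. \<omega> (i, \<not> f i)) (\<lambda>i. \<omega> (i, f i))" for \<sigma> f \<omega>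
    by (simp add: side_pick_def)
  have inj: "inj_on (?h f) (sides n)" "?h f \<in> sides n \<rightarrow> sides n" for f :: "nat \<Rightarrow> bool"
    by (auto intro!: inj_onI simp: prod_eq_iff)
  have int: "integrable ?N (?G \<sigma> f)" if "\<sigma> \<in> perms n" for \<sigma> f
    using side_pick_reindex(2)[where \<sigma>=\<sigma> and h="?h f", OF _ inj] that by simp
  have "sample_success B n D = avg (perms n) (\<lambda>\<sigma>. avg (faces n) (\<lambda>f. LINT \<omega>|?N. side_pick B n \<sigma> \<omega>))"
    unfolding sample_success_eq by (simp add: avg_const)
  also have "\<dots> = avg (perms n) (\<lambda>\<sigma>. avg (faces n) (\<lambda>f. LINT \<omega>|?N. ?G \<sigma> f \<omega>))"
    by (rule avg_cong, rule avg_cong, rule side_pick_reindex(1)[where h="?h f" for f, OF _ inj, symmetric]) simp_all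
  also have "\<dots> = avg (perms n) (\<lambda>\<sigma>. LINT \<omega>|?N. avg (faces n) (\<lambda>f. ?G \<sigma> f \<omega>))"
    by (rule avg_cong, rule integral_avg(1)[symmetric], rule int)
  also have "\<dots> = (LINT \<omega>|?N. avg (perms n) (\<lambda>\<sigma>. avg (faces n) (\<lambda>f. ?G \<sigma> f \<omega>)))"
    by (rule integral_avg(1)[symmetric], rule integral_avg(2), rule int)
  also have "c \<le> \<dots>"
  proof (rule N.integral_ge_const)
    show "integrable ?N (\<lambda>\<omega>. avg (perms n) (\<lambda>\<sigma>. avg (faces n) (\<lambda>f. ?G \<sigma> f \<omega>)))"
      by (intro integral_avg(2) int)
    show "AE \<omega> in ?N. c \<le> avg (perms n) (\<lambda>\<sigma>. avg (faces n) (\<lambda>f. ?G \<sigma> f \<omega>))"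
      unfolding G by (rule AE_I2) (use core[of "\<lambda>i b. \<omega> (i, b)" for \<omega>] in simp)
  qed
  finally show ?thesis .
qed

end

lemma sample_success_cong:
  assumes "\<And>i. i < n \<Longrightarrow> D i = D' i"
  shows "sample_success B n D = sample_success B n D'"
proof -
  have "(\<Pi>\<^sub>M i\<in>{..<n}. D i) = (\<Pi>\<^sub>M i\<in>{..<n}. D' i)" by (rule PiM_cong) (use assms in auto)
  then show ?thesis unfolding sample_success_def by simp
qed

lemma sample_rule_sample_success:
  assumes "1 \<le> n" "\<And>i. i < n \<Longrightarrow> real_distribution (D i)"
  shows "0.5009 \<le> sample_success sample_rule n D"
proof -
  \<comment> \<open>The locale asks for a distribution at every index; a point mass fills the
    indices from \<open>n\<close> on.\<close>
  define D' where "D' = (\<lambda>i. if i < n then D i else return borel (0::real))"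
  have D': "real_distribution (D' i)" for i
  proof (cases "i < n")
    case False
    then show ?thesis unfolding D'_def real_distribution_def real_distribution_axioms_def
      by (simp add: prob_space_return)
  qed (use assms(2) in \<open>simp add: D'_def\<close>)
  interpret iid_sides sample_rule n D'
    by (rule iid_sides.intro[OF sample_rule_algorithm sample_rule_comparison_based D'])
  have "sample_success sample_rule n D = sample_success sample_rule n D'"
    by (rule sample_success_cong) (simp add: D'_def)
  then show ?thesis using sample_success_ge[OF sample_rule_success[OF assms(1)]] by simp
qed

subsection \<open>The best of the current crop\<close>

definition crop_pick :: "crop_algorithm \<Rightarrow> nat \<Rightarrow> (nat \<Rightarrow> real) \<Rightarrow> real" where
  "crop_pick C m v = pick_max_prob m (2 * m) v (\<lambda>j. C (map v [0..<Suc j]))"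

lemma crop_success_eq_avg: "crop_success C m w = avg (perms (2 * m)) (\<lambda>\<sigma>. crop_pick C m (\<lambda>k. w (\<sigma> k)))"
  by (simp add: crop_success_def expectation_random_order crop_pick_def)

lemma crop_pick_bounds: "crop_algorithm C \<Longrightarrow> crop_pick C m v \<in> {0..1}"
  unfolding crop_pick_def by (rule pick_max_prob_bounds) (simp add: crop_algorithm_def)

lemma same_comparisons_map_upt:
  assumes "\<And>i j. i < N \<Longrightarrow> j < N \<Longrightarrow> v i < v j \<longleftrightarrow> v' i < v' j"
  shows "same_comparisons (map v [0..<N]) (map v' [0..<N])"
  using assms by (simp add: same_comparisons_def)

lemma crop_pick_cong:
  assumes C: "crop_comparison_based C"
    and v: "\<And>i j. i < 2 * m \<Longrightarrow> j < 2 * m \<Longrightarrow> v i < v j \<longleftrightarrow> v' i < v' j"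
  shows "crop_pick C m v = crop_pick C m v'"
  unfolding crop_pick_def
proof (rule pick_max_prob_cong)
  fix j assume j: "j \<in> {m..<2 * m}"
  show "C (map v [0..<Suc j]) = C (map v' [0..<Suc j])"
    by (rule C[unfolded crop_comparison_based_def, rule_format], rule same_comparisons_map_upt) (use v j in auto)
qed (use v in auto)

lemma rank_permutation:
  fixes w :: "nat \<Rightarrow> real"
  assumes "inj_on w {..<N}"
  obtains \<rho> where "\<rho> permutes {..<N}" "\<And>i j. i < N \<Longrightarrow> j < N \<Longrightarrow> w i < w j \<longleftrightarrow> \<rho> i < \<rho> j"
proof -
  define r where "r i = card {j. j < N \<and> w j < w i}" for i
  have less: "r i < r j" if "i < N" "w i < w j" for i j
  proof -
    have "i \<in> {l. l < N \<and> w l < w j} - {l. l < N \<and> w l < w i}" using that by simp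
    then have "{l. l < N \<and> w l < w i} \<subset> {l. l < N \<and> w l < w j}" using that by fastforce
    then show ?thesis unfolding r_def by (intro psubset_card_mono) auto
  qed
  have iff: "w i < w j \<longleftrightarrow> r i < r j" if "i < N" "j < N" for i j
    using less[of i j] less[of j i] that assms by (metis inj_onD lessThan_iff linorder_neqE not_less_iff_gr_or_eq)
  have inj: "inj_on r {..<N}"
  proof (rule inj_onI)
    fix i j assume "i \<in> {..<N}" "j \<in> {..<N}" "r i = r j"
    then have "\<not> w i < w j" "\<not> w j < w i" using iff[of i j] iff[of j i] by auto
    then have "w i = w j" by simp
    then show "i = j" using assms \<open>i \<in> {..<N}\<close> \<open>j \<in> {..<N}\<close> by (metis inj_onD)
  qed
  have "r i < N" if "i < N" for i
  proof -
    have "{j. j < N \<and> w j < w i} \<subseteq> {..<N} - {i}" by auto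
    then have "r i \<le> card ({..<N} - {i})" unfolding r_def by (intro card_mono) auto
    then show ?thesis using that by simp
  qed
  then have "r ` {..<N} = {..<N}" using inj by (intro card_subset_eq) (auto simp: card_image)
  then have bij: "bij_betw r {..<N} {..<N}" using inj by (simp add: bij_betw_def)
  let ?\<rho> = "\<lambda>i. if i < N then r i else i"
  have "bij_betw ?\<rho> {..<N} {..<N}" using bij by (subst bij_betw_cong[of _ _ r]) auto
  then have "?\<rho> permutes {..<N}" by (rule bij_imp_permutes) auto
  then show ?thesis using iff that[of ?\<rho>] by simp
qed

text \<open>Passing to ranks changes no comparison, and composition with the rank permutation
  preserves the uniform order. Hence the infimum in \<open>crop_optimum\<close> is taken over a
  constant.\<close>

lemma crop_success_inj:
  assumes C: "crop_comparison_based C" and "inj_on w {..<2 * m}"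
  shows "crop_success C m w = crop_success C m real"
proof -
  obtain \<rho> where \<rho>: "\<rho> permutes {..<2 * m}" "\<And>i j. i < 2 * m \<Longrightarrow> j < 2 * m \<Longrightarrow> w i < w j \<longleftrightarrow> \<rho> i < \<rho> j"
    using rank_permutation[OF assms(2)] by blast
  have "crop_success C m w = avg (perms (2 * m)) (\<lambda>\<sigma>. crop_pick C m (\<lambda>k. real ((\<rho> \<circ> \<sigma>) k)))"
    unfolding crop_success_eq_avg
  proof (rule avg_cong, rule crop_pick_cong[OF C])
    fix \<sigma> i j assume "\<sigma> \<in> perms (2 * m)" "i < 2 * m" "j < 2 * m"
    then show "w (\<sigma> i) < w (\<sigma> j) \<longleftrightarrow> real ((\<rho> \<circ> \<sigma>) i) < real ((\<rho> \<circ> \<sigma>) j)"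
      using \<rho>(2)[of "\<sigma> i" "\<sigma> j"] perms_less[of \<sigma> "2 * m"] by simp
  qed
  also have "\<dots> = crop_success C m real"
    unfolding crop_success_eq_avg
    using avg_bij[OF bij_perms_comp_left[OF \<rho>(1)], where F="\<lambda>\<sigma>. crop_pick C m (\<lambda>k. real (\<sigma> k))"] by simp
  finally show ?thesis .
qed

lemma crop_optimum_eq:
  "crop_optimum m = (SUP C \<in> {C. crop_algorithm C \<and> crop_comparison_based C}. crop_success C m real)"
  unfolding crop_optimum_def
proof (rule SUP_cong[OF refl])
  fix C assume "C \<in> {C. crop_algorithm C \<and> crop_comparison_based C}"
  then have C: "crop_comparison_based C" by simp
  have ne: "{w::nat \<Rightarrow> real. inj_on w {..<2 * m}} \<noteq> {}" by (auto intro!: exI[of _ real] inj_onI)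
  have "(INF w \<in> {w. inj_on w {..<2 * m}}. crop_success C m w) = (INF w \<in> {w::nat \<Rightarrow> real. inj_on w {..<2 * m}}. crop_success C m real)"
    by (rule INF_cong) (auto intro: crop_success_inj[OF C])
  then show "(INF w \<in> {w. inj_on w {..<2 * m}}. crop_success C m w) = crop_success C m real"
    using cINF_const[OF ne] by simp
qed

lemma crop_success_bounds: "crop_algorithm C \<Longrightarrow> crop_success C m w \<in> {0..1}"
proof -
  assume "crop_algorithm C"
  from crop_pick_bounds[OF this, of m] have "0 \<le> crop_success C m w" "crop_success C m w \<le> 1"
    unfolding crop_success_eq_avg
    by (intro avg_ge[OF finite_perms perms_nonempty] avg_le[OF finite_perms perms_nonempty]; simp)+
  then show ?thesis by simp
qed

lemma crop_success_le_optimum: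
  assumes "crop_algorithm C" "crop_comparison_based C"
  shows "crop_success C m real \<le> crop_optimum m"
  unfolding crop_optimum_eq
proof (rule cSUP_upper)
  show "bdd_above ((\<lambda>C. crop_success C m real) ` {C. crop_algorithm C \<and> crop_comparison_based C})"
    using crop_success_bounds by (intro bdd_aboveI2[where M=1]) simp
qed (use assms in simp)

lemma crop_optimum_le:
  assumes "\<And>C. crop_algorithm C \<Longrightarrow> crop_comparison_based C \<Longrightarrow> crop_success C m real \<le> b"
  shows "crop_optimum m \<le> b"
  unfolding crop_optimum_eq
proof (rule cSUP_least)
  have "(\<lambda>_. 0) \<in> {C. crop_algorithm C \<and> crop_comparison_based C}"
    by (simp add: crop_algorithm_def crop_comparison_based_def)
  then show "{C. crop_algorithm C \<and> crop_comparison_based C} \<noteq> {}" by blast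
qed (use assms in simp)

lemma crop_optimum_bounds: "crop_optimum m \<in> {0..1}"
proof -
  have "0 \<le> crop_success (\<lambda>_. 0) m real" using crop_success_bounds[of "\<lambda>_. 0"] by (simp add: crop_algorithm_def)
  also have "\<dots> \<le> crop_optimum m"
    by (rule crop_success_le_optimum) (simp_all add: crop_algorithm_def crop_comparison_based_def)
  finally show ?thesis using crop_optimum_le[of m 1] crop_success_bounds by simp
qed

lemma pick_max_prob_shift:
  "pick_max_prob n (2 * n) v q = pick_max_prob 0 n (\<lambda>k. v (n + k)) (\<lambda>j. q (n + j))"
  unfolding pick_max_prob_def
proof (rule sum.reindex_bij_witness[where i="\<lambda>k. n + k" and j="\<lambda>k. k - n"])
  fix k assume "k \<in> {k. k \<in> {0..<n} \<and> (\<forall>j\<in>{0..<n}. v (n + j) \<le> v (n + k))}"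
  then have k: "k < n" and max: "\<And>j. j < n \<Longrightarrow> v (n + j) \<le> v (n + k)" by auto
  have "v j \<le> v (n + k)" if "j \<in> {n..<2 * n}" for j using max[of "j - n"] that by auto
  then show "n + k \<in> {k. k \<in> {n..<2 * n} \<and> (\<forall>j\<in>{n..<2 * n}. v j \<le> v k)}" using k by simp
next
  fix k assume "k \<in> {k. k \<in> {n..<2 * n} \<and> (\<forall>j\<in>{n..<2 * n}. v j \<le> v k)}"
  then have k: "n \<le> k" "k < 2 * n" by auto
  have "(\<Prod>j\<in>{n..<k}. 1 - q j) = (\<Prod>j\<in>{0..<k - n}. 1 - q (n + j))"
    by (rule prod.reindex_bij_witness[where i="\<lambda>j. n + j" and j="\<lambda>j. j - n"]) auto
  then show "q (n + (k - n)) * (\<Prod>j\<in>{0..<k - n}. 1 - q (n + j)) = q k * (\<Prod>j\<in>{n..<k}. 1 - q j)" using k by simp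
qed auto

subsection \<open>Upper bound\<close>

lemma avg_crop_pick_comp:
  assumes "bij_betw \<psi> {..<2 * n} {..<2 * n}" "crop_comparison_based C"
  shows "avg (perms (2 * n)) (\<lambda>\<pi>. crop_pick C n (\<lambda>k. w (\<pi> (\<psi> k)))) = crop_success C n w"
proof -
  let ?\<psi> = "\<lambda>k. if k < 2 * n then \<psi> k else k"
  have "bij_betw ?\<psi> {..<2 * n} {..<2 * n}" using assms(1) by (subst bij_betw_cong[of _ _ \<psi>]) auto
  then have p: "?\<psi> permutes {..<2 * n}" by (rule bij_imp_permutes) auto
  have "avg (perms (2 * n)) (\<lambda>\<pi>. crop_pick C n (\<lambda>k. w (\<pi> (\<psi> k))))
    = avg (perms (2 * n)) (\<lambda>\<pi>. crop_pick C n (\<lambda>k. w ((\<pi> \<circ> ?\<psi>) k)))"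
    by (rule avg_cong, rule crop_pick_cong[OF assms(2)]) auto
  also have "\<dots> = crop_success C n w"
    unfolding crop_success_eq_avg
    using avg_bij[OF bij_perms_comp_right[OF p], where F="\<lambda>\<sigma>. crop_pick C n (\<lambda>k. w (\<sigma> k))"] by simp
  finally show ?thesis .
qed

lemma bij_betw_half:
  fixes \<phi> :: "nat \<Rightarrow> 'a"
  assumes "\<And>k. k < n \<Longrightarrow> \<phi> k = g (k, True)" "\<And>k. k < n \<Longrightarrow> \<phi> (n + k) = g (k, False)"
    and "bij_betw g ({..<n} \<times> UNIV) S"
  shows "bij_betw \<phi> {..<2 * n} S"
proof -
  let ?h = "\<lambda>k. if k < n then (k, True) else (k - n, False)"
  have "bij_betw ?h {..<2 * n} ({..<n} \<times> UNIV)"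
    by (rule bij_betwI[where g="\<lambda>(k, b). if b then k else n + k"]) (auto split: if_splits)
  then have "bij_betw (g \<circ> ?h) {..<2 * n} S" using assms(3) by (rule bij_betw_trans)
  moreover have "(g \<circ> ?h) k = \<phi> k" if "k \<in> {..<2 * n}" for k
    using assms(1)[of k] assms(2)[of "k - n"] that by auto
  ultimately show ?thesis using bij_betw_cong[of "{..<2 * n}" "g \<circ> ?h" \<phi> S] by blast
qed

text \<open>If the \<open>2 * n\<close> sides are numbered at random, the face-up numbers followed
  by the face-down numbers form a uniformly random ranking, for every table order and all faces.
  Averaged over the numberings \<open>A\<close> therefore plays the crop game, and some numbering
  does not exceed the average.\<close>

lemma ex_googol_success_le:
  assumes A: "googol_algorithm A" "googol_comparison_based A"
  shows "\<exists>a. googol_success A n a \<le> crop_optimum n"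
proof -
  define C where "C vs = A (take n vs) (drop n vs)" for vs
  define a where "a \<pi> = (\<lambda>i b. real (\<pi> (2 * i + of_bool b)))" for \<pi> :: "nat \<Rightarrow> nat"
  have C: "crop_algorithm C" "crop_comparison_based C"
  proof -
    show "crop_algorithm C" using A(1) by (simp add: crop_algorithm_def googol_algorithm_def C_def)
    show "crop_comparison_based C" unfolding crop_comparison_based_def
    proof (intro allI impI)
      fix vs vs' assume "same_comparisons vs vs'"
      moreover from this have "length vs = length vs'" by (simp add: same_comparisons_def)
      ultimately show "C vs = C vs'" unfolding C_def
        by (intro A(2)[unfolded googol_comparison_based_def, rule_format]) simp_all
    qed
  qed
  have pick: "avg (perms (2 * n)) (\<lambda>\<pi>. googol_pick A n (a \<pi>) \<sigma> f) = crop_success C n real"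
    if \<sigma>: "\<sigma> permutes {..<n}" for \<sigma> f
  proof -
    \<comment> \<open>The side observed at time \<open>k\<close>, encoded as twice the card plus the
      side.\<close>
    let ?\<psi> = "\<lambda>k. if k < n then 2 * \<sigma> k + of_bool (f (\<sigma> k)) else 2 * \<sigma> (k - n) + of_bool (\<not> f (\<sigma> (k - n)))"
    let ?g = "\<lambda>(k, b). 2 * \<sigma> k + of_bool (b = f (\<sigma> k))"
    have lt: "Suc (2 * \<sigma> k) < 2 * n" if "k < n" for k using perms_less[OF \<sigma>, of k] that by linarith
    have "bij_betw ?g ({..<n} \<times> UNIV) {..<2 * n}"
      by (rule bij_betwI[where g="\<lambda>x. (inv \<sigma> (x div 2), odd x = f (x div 2))"])
         (use lt perms_less[OF \<sigma>] perms_less[OF permutes_inv[OF \<sigma>]] permutes_inverses[OF \<sigma>] in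
           \<open>auto split: if_splits simp: of_bool_def\<close>)
    then have bij: "bij_betw ?\<psi> {..<2 * n} {..<2 * n}" by (rule bij_betw_half[rotated 2]) auto
    have "googol_pick A n (a \<pi>) \<sigma> f = crop_pick C n (\<lambda>k. real (\<pi> (?\<psi> k)))" for \<pi>
    proof -
      have "map (\<lambda>k. real (\<pi> (?\<psi> k))) [0..<Suc (n + j)] = map (\<lambda>k. a \<pi> (\<sigma> k) (f (\<sigma> k))) [0..<n] @ map (\<lambda>k. a \<pi> (\<sigma> k) (\<not> f (\<sigma> k))) [0..<Suc j]" for j
        by (rule nth_equalityI) (auto simp: nth_append a_def simp del: upt_Suc)
      then show ?thesis unfolding googol_pick_def crop_pick_def pick_max_prob_shift C_def
        by (simp add: a_def del: upt_Suc)
    qed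
    then show ?thesis using avg_crop_pick_comp[OF bij C(2), of real] by simp
  qed
  have "avg (perms (2 * n)) (\<lambda>\<pi>. googol_success A n (a \<pi>))
    = avg (perms n) (\<lambda>\<sigma>. avg (faces n) (\<lambda>f. avg (perms (2 * n)) (\<lambda>\<pi>. googol_pick A n (a \<pi>) \<sigma> f)))"
    unfolding googol_success_eq_avg by (subst avg_swap) (intro avg_cong avg_swap)
  also have "\<dots> = avg (perms n) (\<lambda>\<sigma>. avg (faces n) (\<lambda>f. crop_success C n real))"
    by (rule avg_cong, rule avg_cong, rule pick) simp
  also have "\<dots> = crop_success C n real"
    using avg_const[OF finite_perms perms_nonempty] by (simp add: avg_const)
  also have "\<dots> \<le> crop_optimum n" by (rule crop_success_le_optimum[OF C])
  finally have le: "avg (perms (2 * n)) (\<lambda>\<pi>. googol_success A n (a \<pi>)) \<le> crop_optimum n" .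
  obtain \<pi> where "googol_success A n (a \<pi>) \<le> avg (perms (2 * n)) (\<lambda>\<pi>. googol_success A n (a \<pi>))"
    using ex_le_avg[where F="\<lambda>\<pi>. googol_success A n (a \<pi>)", OF finite_perms perms_nonempty] by blast
  then have "googol_success A n (a \<pi>) \<le> crop_optimum n" using le by (rule order_trans)
  then show ?thesis by blast
qed

text \<open>The joint distribution of two different coordinates is the product of \<open>M\<close>
  with itself, and by Fubini its diagonal is null because \<open>M\<close> has no atoms.\<close>

lemma AE_component_neq:
  fixes M :: "real measure"
  assumes M: "real_distribution M" and atom: "\<And>x. AE y in M. y \<noteq> x" and kl: "k \<in> K" "l \<in> K" "k \<noteq> l"
  shows "AE \<omega> in (\<Pi>\<^sub>M k\<in>K. M). \<omega> k \<noteq> \<omega> l"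
proof -
  interpret M: real_distribution M by (rule M)
  interpret MM: pair_sigma_finite M M ..
  let ?f = "\<lambda>b. if b then k else l" and ?N = "\<Pi>\<^sub>M k\<in>K. M" and ?U = "\<Pi>\<^sub>M b\<in>(UNIV :: bool set). M"
  have "distr ?N (\<Pi>\<^sub>M b\<in>UNIV. M) (\<lambda>\<omega>. \<lambda>b\<in>UNIV. \<omega> (?f b)) = ?U"
    by (rule distr_PiM_reindex[where f="?f"]) (use M.prob_space_axioms kl in \<open>auto simp: inj_on_def split: if_splits\<close>)
  then have 1: "distr ?N ?U (\<lambda>\<omega> b. \<omega> (?f b)) = ?U" by (simp add: restrict_UNIV)
  have comp: "(\<lambda>\<omega>. \<omega> j) \<in> measurable ?N M" if "j \<in> K" for j
    using measurable_component_singleton[of j K "\<lambda>_. M"] that by simp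
  have m1: "(\<lambda>\<omega> b. \<omega> (?f b)) \<in> measurable ?N ?U"
  proof (rule measurable_PiM_single')
    show "(\<lambda>\<omega>. \<omega> (?f b)) \<in> measurable ?N M" for b using comp kl by simp
  qed (auto simp: space_PiM PiE_iff kl)
  have m2: "(\<lambda>x. (x True, x False)) \<in> measurable ?U (M \<Otimes>\<^sub>M M)"
    by (intro measurable_Pair measurable_component_singleton) auto
  have cb: "case_bool M M = (\<lambda>_. M)" by (auto simp: fun_eq_iff split: bool.split)
  have "M \<Otimes>\<^sub>M M = distr ?U (M \<Otimes>\<^sub>M M) (\<lambda>x. (x True, x False))"
    using pair_measure_eq_distr_PiM[of M M] M.sigma_finite_measure_axioms unfolding cb by blast
  also have "\<dots> = distr (distr ?N ?U (\<lambda>\<omega> b. \<omega> (?f b))) (M \<Otimes>\<^sub>M M) (\<lambda>x. (x True, x False))" unfolding 1 ..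
  also have "\<dots> = distr ?N (M \<Otimes>\<^sub>M M) (\<lambda>\<omega>. (\<omega> k, \<omega> l))"
    by (subst distr_distr[OF m2 m1]) (simp add: comp_def)
  finally have eq: "M \<Otimes>\<^sub>M M = distr ?N (M \<Otimes>\<^sub>M M) (\<lambda>\<omega>. (\<omega> k, \<omega> l))" .
  have "AE z in M \<Otimes>\<^sub>M M. snd z \<noteq> fst z"
  proof (rule MM.AE_pair_measure)
    have "fst \<in> borel_measurable (M \<Otimes>\<^sub>M M)" "snd \<in> borel_measurable (M \<Otimes>\<^sub>M M)"
      using measurable_fst[of M M] measurable_snd[of M M]
        measurable_cong_sets[OF refl M.events_eq_borel, of "M \<Otimes>\<^sub>M M"] by blast+
    then show "{z \<in> space (M \<Otimes>\<^sub>M M). snd z \<noteq> fst z} \<in> sets (M \<Otimes>\<^sub>M M)" by measurable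
    show "AE x in M. AE y in M. snd (x, y) \<noteq> fst (x, y)" using atom by simp
  qed
  then have "AE z in distr ?N (M \<Otimes>\<^sub>M M) (\<lambda>\<omega>. (\<omega> k, \<omega> l)). snd z \<noteq> fst z" unfolding eq[symmetric] .
  then have "AE \<omega> in ?N. snd (\<omega> k, \<omega> l) \<noteq> fst (\<omega> k, \<omega> l)"
    by (rule AE_distrD[rotated]) (use comp kl in simp)
  then show ?thesis by (rule eventually_mono) auto
qed

text \<open>All \<open>2 * n\<close> observations are identically distributed and independent, so
  for fixed \<open>\<sigma>\<close> the integral equals its average over all rearrangements of the
  coordinates. Almost surely the observations are distinct, and then the average inside the integral
  is a success probability of the crop game.\<close>

lemma uniform_sample_success_le:
  assumes B: "sample_algorithm B" "sample_comparison_based B"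
  shows "\<exists>D. (\<forall>i. real_distribution (D i)) \<and> sample_success B n D \<le> crop_optimum n"
proof -
  define \<mu> where "\<mu> = uniform_measure lborel {0..1::real}"
  have \<mu>: "real_distribution \<mu>"
    unfolding real_distribution_def real_distribution_axioms_def \<mu>_def by (auto intro: prob_space_uniform_measure)
  have atom: "AE y in \<mu>. y \<noteq> x" for x
    unfolding \<mu>_def using AE_lborel_singleton[of x] by (intro AE_uniform_measureI) auto
  interpret iid_sides B n "\<lambda>_. \<mu>" by (rule iid_sides.intro[OF B \<mu>])
  let ?N = "\<Pi>\<^sub>M k\<in>sides n. \<mu>"
  have inj: "AE \<omega> in ?N. inj_on \<omega> (sides n)"
  proof -
    have "AE \<omega> in ?N. \<forall>p\<in>{p \<in> sides n \<times> sides n. fst p \<noteq> snd p}. \<omega> (fst p) \<noteq> \<omega> (snd p)"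
    proof (rule AE_finite_allI)
      fix p assume "p \<in> {p \<in> sides n \<times> sides n. fst p \<noteq> snd p}"
      then have "fst p \<in> sides n" "snd p \<in> sides n" "fst p \<noteq> snd p" by (simp_all add: mem_Times_iff)
      then show "AE \<omega> in ?N. \<omega> (fst p) \<noteq> \<omega> (snd p)" by (rule AE_component_neq[OF \<mu> atom])
    qed simp
    then show ?thesis
    proof (rule eventually_mono)
      fix \<omega> :: "nat \<times> bool \<Rightarrow> real"
      assume *: "\<forall>p\<in>{p \<in> sides n \<times> sides n. fst p \<noteq> snd p}. \<omega> (fst p) \<noteq> \<omega> (snd p)"
      show "inj_on \<omega> (sides n)"
      proof (rule inj_onI, rule ccontr)
        fix k l assume "k \<in> sides n" "l \<in> sides n" "\<omega> k = \<omega> l" "k \<noteq> l"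
        then show False using bspec[OF *, of "(k, l)"] by simp
      qed
    qed
  qed
  have "(LINT \<omega>|?N. side_pick B n \<sigma> \<omega>) \<le> crop_optimum n" if "\<sigma> \<in> perms n" for \<sigma>
  proof -
    from that have \<sigma>: "\<sigma> permutes {..<n}" by simp
    \<comment> \<open>A crop algorithm sees no indices, but with \<open>\<sigma>\<close> fixed it
      can supply those that \<open>B\<close> expects.\<close>
    define C where "C vs = B (take n vs) (map (\<lambda>k. (\<sigma> k, vs ! (n + k))) [0..<length vs - n])" for vs
    define \<phi> where "\<phi> k = (if k < n then (k, False) else (\<sigma> (k - n), True))" for k
    define \<phi>' where "\<phi>' = the_inv_into {..<2 * n} \<phi>"
    have "bij_betw (\<lambda>(k, b). if b then (k, False) else (\<sigma> k, True)) ({..<n} \<times> UNIV) (sides n)"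
      by (rule bij_betwI[where g="\<lambda>(k, b). if b then (inv \<sigma> k, False) else (k, True)"])
         (use perms_less[OF \<sigma>] perms_less[OF permutes_inv[OF \<sigma>]] permutes_inverses[OF \<sigma>] in \<open>auto split: if_splits\<close>)
    then have \<phi>: "bij_betw \<phi> {..<2 * n} (sides n)" by (rule bij_betw_half[rotated 2]) (auto simp: \<phi>_def)
    then have \<phi>': "bij_betw \<phi>' (sides n) {..<2 * n}" unfolding \<phi>'_def by (rule bij_betw_the_inv_into)
    have \<phi>'\<phi>: "\<phi>' (\<phi> k) = k" if "k < 2 * n" for k
      unfolding \<phi>'_def using \<phi> that by (intro the_inv_into_f_f) (auto simp: bij_betw_def)
    have C: "crop_algorithm C" using B(1) by (simp add: crop_algorithm_def sample_algorithm_def C_def)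
    have C': "crop_comparison_based C"
      unfolding crop_comparison_based_def
    proof (intro allI impI)
      fix vs vs' assume s: "same_comparisons vs vs'"
      then have len: "length vs = length vs'" by (simp add: same_comparisons_def)
      have eq: "take n xs @ map snd (map (\<lambda>k. (\<sigma> k, xs ! (n + k))) [0..<length xs - n]) = xs" for xs :: "real list"
        by (rule nth_equalityI) (auto simp: nth_append min_def)
      show "C vs = C vs'"
        unfolding C_def
      proof (rule B(2)[unfolded sample_comparison_based_def, rule_format])
        show "same_comparisons (take n vs @ map snd (map (\<lambda>k. (\<sigma> k, vs ! (n + k))) [0..<length vs - n]))
          (take n vs' @ map snd (map (\<lambda>k. (\<sigma> k, vs' ! (n + k))) [0..<length vs' - n]))"
          unfolding eq by (rule s)
      qed (simp_all add: len)
    qed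
    have crop: "side_pick B n \<sigma> \<omega> = crop_pick C n (\<lambda>k. \<omega> (\<phi> k))" for \<omega>
    proof -
      have 1: "take n (map (\<lambda>k. \<omega> (\<phi> k)) [0..<Suc (n + j)]) = map (\<lambda>i. \<omega> (i, False)) [0..<n]" for j
        by (rule nth_equalityI) (auto simp: \<phi>_def simp del: upt_Suc)
      have 2: "map (\<lambda>k. (\<sigma> k, map (\<lambda>k. \<omega> (\<phi> k)) [0..<Suc (n + j)] ! (n + k))) [0..<length (map (\<lambda>k. \<omega> (\<phi> k)) [0..<Suc (n + j)]) - n]
        = map (\<lambda>k. (\<sigma> k, \<omega> (\<sigma> k, True))) [0..<Suc j]" for j
        by (rule nth_equalityI) (auto simp: \<phi>_def simp del: upt_Suc)
      show ?thesis
        unfolding side_pick_def sample_pick_def crop_pick_def pick_max_prob_shift C_def 1 2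
        by (simp add: \<phi>_def del: upt_Suc)
    qed
    \<comment> \<open>The permutation \<open>\<pi>\<close> of the observation times, transported
      along \<open>\<phi>\<close> to the sides.\<close>
    let ?h = "\<lambda>\<pi> k. \<phi> (\<pi> (\<phi>' k))"
    have h: "inj_on (?h \<pi>) (sides n)" "?h \<pi> \<in> sides n \<rightarrow> sides n" if "\<pi> \<in> perms (2 * n)" for \<pi>
    proof -
      have "bij_betw \<pi> {..<2 * n} {..<2 * n}" using that by (auto intro: permutes_imp_bij)
      from bij_betw_trans[OF bij_betw_trans[OF \<phi>' this] \<phi>]
      have b: "bij_betw (?h \<pi>) (sides n) (sides n)" by (simp add: comp_def)
      show "inj_on (?h \<pi>) (sides n)" by (rule bij_betw_imp_inj_on[OF b])
      show "?h \<pi> \<in> sides n \<rightarrow> sides n" by (rule bij_betw_imp_funcset[OF b])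
    qed
    have h_pick: "(\<lambda>\<omega>. side_pick B n \<sigma> (\<lambda>k. \<omega> (?h \<pi> k))) = (\<lambda>\<omega>. crop_pick C n (\<lambda>k. \<omega> (\<phi> (\<pi> k))))" for \<pi>
    proof
      fix \<omega> :: "nat \<times> bool \<Rightarrow> real"
      show "side_pick B n \<sigma> (\<lambda>k. \<omega> (?h \<pi> k)) = crop_pick C n (\<lambda>k. \<omega> (\<phi> (\<pi> k)))"
        unfolding crop by (rule crop_pick_cong[OF C']) (simp add: \<phi>'\<phi>)
    qed
    have int: "integrable ?N (\<lambda>\<omega>. crop_pick C n (\<lambda>k. \<omega> (\<phi> (\<pi> k))))"
      and eq: "(LINT \<omega>|?N. crop_pick C n (\<lambda>k. \<omega> (\<phi> (\<pi> k)))) = (LINT \<omega>|?N. side_pick B n \<sigma> \<omega>)"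
      if "\<pi> \<in> perms (2 * n)" for \<pi>
    proof -
      note r = side_pick_reindex[where h="?h \<pi>", OF \<sigma> h[OF that] refl]
      show "integrable ?N (\<lambda>\<omega>. crop_pick C n (\<lambda>k. \<omega> (\<phi> (\<pi> k))))"
        using r(2) unfolding h_pick[of \<pi>] .
      show "(LINT \<omega>|?N. crop_pick C n (\<lambda>k. \<omega> (\<phi> (\<pi> k)))) = (LINT \<omega>|?N. side_pick B n \<sigma> \<omega>)"
        using r(1) unfolding h_pick[of \<pi>] .
    qed
    have "(LINT \<omega>|?N. side_pick B n \<sigma> \<omega>) = avg (perms (2 * n)) (\<lambda>\<pi>. LINT \<omega>|?N. side_pick B n \<sigma> \<omega>)"
      by (rule avg_const[OF finite_perms perms_nonempty, symmetric])
    also have "\<dots> = avg (perms (2 * n)) (\<lambda>\<pi>. LINT \<omega>|?N. crop_pick C n (\<lambda>k. \<omega> (\<phi> (\<pi> k))))"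
      by (rule avg_cong) (rule eq[symmetric])
    also have "\<dots> = (LINT \<omega>|?N. avg (perms (2 * n)) (\<lambda>\<pi>. crop_pick C n (\<lambda>k. \<omega> (\<phi> (\<pi> k)))))"
      by (rule integral_avg(1)[symmetric], rule int)
    also have "\<dots> \<le> crop_optimum n"
    proof (rule N.integral_le_const)
      show "integrable ?N (\<lambda>\<omega>. avg (perms (2 * n)) (\<lambda>\<pi>. crop_pick C n (\<lambda>k. \<omega> (\<phi> (\<pi> k)))))"
        by (rule integral_avg(2), rule int)
      show "AE \<omega> in ?N. avg (perms (2 * n)) (\<lambda>\<pi>. crop_pick C n (\<lambda>k. \<omega> (\<phi> (\<pi> k)))) \<le> crop_optimum n"
      proof (rule eventually_mono[OF inj])
        fix \<omega> :: "nat \<times> bool \<Rightarrow> real" assume \<omega>: "inj_on \<omega> (sides n)"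
        have "inj_on \<omega> (\<phi> ` {..<2 * n})" unfolding bij_betw_imp_surj_on[OF \<phi>] by (rule \<omega>)
        from comp_inj_on[OF bij_betw_imp_inj_on[OF \<phi>] this]
        have "inj_on (\<lambda>k. \<omega> (\<phi> k)) {..<2 * n}" unfolding comp_def .
        then have "crop_success C n (\<lambda>k. \<omega> (\<phi> k)) = crop_success C n real" by (rule crop_success_inj[OF C'])
        also have "\<dots> \<le> crop_optimum n" by (rule crop_success_le_optimum[OF C C'])
        finally show "avg (perms (2 * n)) (\<lambda>\<pi>. crop_pick C n (\<lambda>k. \<omega> (\<phi> (\<pi> k)))) \<le> crop_optimum n"
          unfolding crop_success_eq_avg .
      qed
    qed
    finally show ?thesis .
  qed
  then have "avg (perms n) (\<lambda>\<sigma>. LINT \<omega>|?N. side_pick B n \<sigma> \<omega>) \<le> crop_optimum n"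
    by (rule avg_le[OF finite_perms perms_nonempty])
  then have "sample_success B n (\<lambda>_. \<mu>) \<le> crop_optimum n" using sample_success_eq by simp
  then show ?thesis by (intro exI[of _ "\<lambda>_. \<mu>"] conjI allI \<mu>)
qed

subsection \<open>Convergence of the optimum\<close>

text \<open>By symmetry under transpositions all positions in \<open>S\<close> are equally likely to
  hold the maximum, and exactly one of them does.\<close>

lemma avg_argmax:
  assumes "S \<subseteq> {..<N}" "j \<in> S"
  shows "avg (perms N) (\<lambda>\<pi>. of_bool (\<forall>i\<in>S. \<pi> i \<le> \<pi> j)) = 1 / real (card S)"
proof -
  let ?g = "\<lambda>j. avg (perms N) (\<lambda>\<pi>. of_bool (\<forall>i\<in>S. \<pi> i \<le> \<pi> j))"
  have fin: "finite S" using assms(1) finite_subset by blast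
  have same: "?g i = ?g j" if "i \<in> S" for i
  proof -
    let ?t = "Transposition.transpose i j"
    have t: "?t permutes {..<N}" using assms that by (intro permutes_swap_id) auto
    have im: "?t ` S = S" by (rule transpose_image_eq) (use assms(2) that in simp)
    have "(\<forall>l\<in>S. (\<pi> \<circ> ?t) l \<le> (\<pi> \<circ> ?t) j) \<longleftrightarrow> (\<forall>l\<in>?t ` S. \<pi> l \<le> \<pi> i)" for \<pi> :: "nat \<Rightarrow> nat"
      by simp
    then have eq: "(\<forall>l\<in>S. (\<pi> \<circ> ?t) l \<le> (\<pi> \<circ> ?t) j) \<longleftrightarrow> (\<forall>l\<in>S. \<pi> l \<le> \<pi> i)" for \<pi> :: "nat \<Rightarrow> nat"
      unfolding im .
    have "?g i = avg (perms N) (\<lambda>\<pi>. of_bool (\<forall>l\<in>S. (\<pi> \<circ> ?t) l \<le> (\<pi> \<circ> ?t) j))" unfolding eq ..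
    also have "\<dots> = ?g j" by (rule avg_bij[OF bij_perms_comp_right[OF t], where F="\<lambda>\<pi>. of_bool (\<forall>i\<in>S. \<pi> i \<le> \<pi> j)"])
    finally show ?thesis .
  qed
  have one: "(\<Sum>i\<in>S. of_bool (\<forall>l\<in>S. \<pi> l \<le> \<pi> i)) = (1::real)" if "\<pi> \<in> perms N" for \<pi>
  proof -
    have inj: "inj \<pi>" using that permutes_inj by blast
    have "Max (\<pi> ` S) \<in> \<pi> ` S" using fin assms(2) by (intro Max_in) auto
    then obtain k where k: "Max (\<pi> ` S) = \<pi> k" "k \<in> S" by (rule imageE)
    have max: "\<pi> l \<le> \<pi> k" if "l \<in> S" for l unfolding k(1)[symmetric] using that fin by (intro Max_ge) auto
    have uniq: "i = k" if "i \<in> S" "\<forall>l\<in>S. \<pi> l \<le> \<pi> i" for i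
      using max[OF that(1)] bspec[OF that(2) k(2)] injD[OF inj, of i k] by (metis le_antisym)
    have iff: "(\<forall>l\<in>S. \<pi> l \<le> \<pi> i) \<longleftrightarrow> i = k" if "i \<in> S" for i
    proof
      show "\<forall>l\<in>S. \<pi> l \<le> \<pi> i" if "i = k" unfolding that by (rule ballI) (rule max)
    qed (rule uniq[OF that])
    have "of_bool (\<forall>l\<in>S. \<pi> l \<le> \<pi> i) = (if i = k then 1 else 0 :: real)" if "i \<in> S" for i
      unfolding iff[OF that] by (rule of_bool_def)
    then have "(\<Sum>i\<in>S. of_bool (\<forall>l\<in>S. \<pi> l \<le> \<pi> i)) = (\<Sum>i\<in>S. if i = k then 1 else 0 :: real)"
      by (rule sum.cong[OF refl])
    also have "\<dots> = 1" unfolding sum.delta[OF fin] using k(2) by simp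
    finally show ?thesis .
  qed
  have "(\<Sum>i\<in>S. ?g i) = (\<Sum>i\<in>S. ?g j)" by (rule sum.cong[OF refl same])
  then have "?g j * real (card S) = (\<Sum>i\<in>S. ?g i)" by (simp only: sum_constant mult.commute)
  also have "\<dots> = avg (perms N) (\<lambda>\<pi>. \<Sum>i\<in>S. of_bool (\<forall>l\<in>S. \<pi> l \<le> \<pi> i))" by (rule avg_sum[symmetric])
  also have "\<dots> = avg (perms N) (\<lambda>\<pi>. 1)" by (rule avg_cong) (rule one)
  also have "\<dots> = 1" by (rule avg_const[OF finite_perms perms_nonempty])
  finally have "?g j * real (card S) = 1" .
  moreover have ne: "real (card S) \<noteq> 0" using fin assms(2) by auto
  ultimately show ?thesis unfolding nonzero_eq_divide_eq[OF ne] by blast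
qed

lemma avg_early_argmax:
  assumes "a \<le> b" "b \<le> N" "a < N"
  shows "avg (perms N) (\<lambda>\<pi>. of_bool (\<exists>j\<in>{a..<b}. \<forall>i\<in>{a..<N}. \<pi> i \<le> \<pi> j)) \<le> real (b - a) / real (N - a)"
proof -
  have "avg (perms N) (\<lambda>\<pi>. of_bool (\<exists>j\<in>{a..<b}. \<forall>i\<in>{a..<N}. \<pi> i \<le> \<pi> j))
    \<le> avg (perms N) (\<lambda>\<pi>. \<Sum>j\<in>{a..<b}. of_bool (\<forall>i\<in>{a..<N}. \<pi> i \<le> \<pi> j))"
  proof (rule avg_mono)
    fix \<pi> :: "nat \<Rightarrow> nat"
    show "of_bool (\<exists>j\<in>{a..<b}. \<forall>i\<in>{a..<N}. \<pi> i \<le> \<pi> j) \<le> (\<Sum>j\<in>{a..<b}. of_bool (\<forall>i\<in>{a..<N}. \<pi> i \<le> \<pi> j) :: real)"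
    proof (cases "\<exists>j\<in>{a..<b}. \<forall>i\<in>{a..<N}. \<pi> i \<le> \<pi> j")
      case True
      then obtain j where j: "j \<in> {a..<b}" "\<forall>i\<in>{a..<N}. \<pi> i \<le> \<pi> j" by blast
      have "of_bool (\<forall>i\<in>{a..<N}. \<pi> i \<le> \<pi> j) \<le> (\<Sum>j\<in>{a..<b}. of_bool (\<forall>i\<in>{a..<N}. \<pi> i \<le> \<pi> j) :: real)"
        by (rule member_le_sum) (use j in auto)
      then show ?thesis using j True by simp
    next
      case False
      then have 0: "of_bool (\<exists>j\<in>{a..<b}. \<forall>i\<in>{a..<N}. \<pi> i \<le> \<pi> j) = (0::real)" by (simp only: of_bool_eq)
      show ?thesis unfolding 0 by (rule sum_nonneg) simp
    qed
  qed
  also have "\<dots> = (\<Sum>j\<in>{a..<b}. 1 / real (card {a..<N}))"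
    unfolding avg_sum using assms by (intro sum.cong refl avg_argmax) auto
  also have "\<dots> = real (b - a) / real (N - a)" by simp
  finally show ?thesis .
qed

section \<open>The largest values of a random order\<close>

definition tops :: "nat \<Rightarrow> nat \<Rightarrow> (nat \<Rightarrow> nat) \<Rightarrow> nat set" where
  "tops r N \<sigma> = {k. k < N \<and> N - r \<le> \<sigma> k}"

lemma image_tops:
  assumes "\<sigma> permutes {..<N}"
  shows "\<sigma> ` tops r N \<sigma> = {N - r..<N}"
proof (intro equalityI subsetI)
  fix x assume "x \<in> \<sigma> ` tops r N \<sigma>"
  then show "x \<in> {N - r..<N}" using perms_less[OF assms] by (auto simp: tops_def)
next
  fix x assume x: "x \<in> {N - r..<N}"
  then have "inv \<sigma> x < N" using perms_less[OF permutes_inv[OF assms]] by simp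
  then show "x \<in> \<sigma> ` tops r N \<sigma>"
    using x permutes_inverses(1)[OF assms] by (intro image_eqI[of _ _ "inv \<sigma> x"]) (auto simp: tops_def)
qed

lemma card_tops:
  assumes "\<sigma> permutes {..<N}" "r \<le> N"
  shows "card (tops r N \<sigma>) = r"
proof -
  have "inj_on \<sigma> (tops r N \<sigma>)" using permutes_inj[OF assms(1)] by (rule inj_on_subset) simp
  then show ?thesis using card_image[of \<sigma> "tops r N \<sigma>"] image_tops[OF assms(1)] assms(2) by simp
qed

text \<open>A hypergeometric variance. Since there are \<open>2 * m\<close> top values in total,
  twice the deviation is the sum of the signs \<open>e k\<close> over their positions. By
  exchangeability all mixed second moments equal \<open>p2\<close>, and they cancel up to the
  diagonal because the signs sum to 0. What remains is \<open>2 * M * (p1 - p2) / 4\<close>, where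
  \<open>2 * M * p1 = 2 * m\<close>.\<close>

lemma avg_tops_deviation:
  assumes "m \<le> M" "1 \<le> M"
  shows "avg (perms (2 * M)) (\<lambda>\<sigma>. (real (card {k \<in> tops (2 * m) (2 * M) \<sigma>. k < M}) - real m) ^ 2) \<le> real m / 2"
proof -
  let ?N = "2 * M" and ?T = "tops (2 * m) (2 * M)"
  let ?x = "\<lambda>k \<sigma>. of_bool (k \<in> ?T \<sigma>) :: real"
  define e :: "nat \<Rightarrow> real" where "e k = (if k < M then 1 else - 1)" for k
  define p1 where "p1 = avg (perms ?N) (\<lambda>\<sigma>. ?x 0 \<sigma>)"
  define p2 where "p2 = avg (perms ?N) (\<lambda>\<sigma>. ?x 0 \<sigma> * ?x 1 \<sigma>)"
  have card: "card (?T \<sigma>) = 2 * m" if "\<sigma> \<in> perms ?N" for \<sigma> using card_tops[of \<sigma> ?N "2 * m"] that assms by simp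
  have comp: "?x k (\<sigma> \<circ> \<tau>) = ?x (\<tau> k) \<sigma>" if "\<tau> permutes {..<?N}" for k \<sigma> \<tau>
    using perms_less[OF that, of k] by (simp add: tops_def)
  have move: "avg (perms ?N) (\<lambda>\<sigma>. ?x (\<tau> k) \<sigma> * ?x (\<tau> l) \<sigma>) = avg (perms ?N) (\<lambda>\<sigma>. ?x k \<sigma> * ?x l \<sigma>)"
    if "\<tau> permutes {..<?N}" for \<tau> k l
    using avg_bij[OF bij_perms_comp_right[OF that], where F="\<lambda>\<sigma>. ?x k \<sigma> * ?x l \<sigma>"] unfolding comp[OF that] .
  have pair: "avg (perms ?N) (\<lambda>\<sigma>. ?x k \<sigma> * ?x l \<sigma>) = p2 + (p1 - p2) * of_bool (k = l)" if "k < ?N" "l < ?N" for k l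
  proof -
    \<comment> \<open>\<open>t1\<close> moves 0 to \<open>k\<close>; followed by the transposition
      \<open>t2\<close> it also moves 1 to \<open>l\<close>. This reduces every mixed moment to the
      positions 0 and 1.\<close>
    define t1 where "t1 = Transposition.transpose 0 k"
    have t1: "t1 permutes {..<?N}" "t1 0 = k" unfolding t1_def using that assms by (auto intro: permutes_swap_id)
    show ?thesis
    proof (cases "k = l")
      case True
      have "p1 = avg (perms ?N) (\<lambda>\<sigma>. ?x 0 \<sigma> * ?x 0 \<sigma>)" unfolding p1_def by (rule avg_cong) simp
      also have "\<dots> = avg (perms ?N) (\<lambda>\<sigma>. ?x k \<sigma> * ?x k \<sigma>)" using move[OF t1(1), of 0 0] t1(2) by simp
      finally show ?thesis using True by simp
    next
      case False
      define t2 where "t2 = Transposition.transpose (t1 1) l"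
      have N: "1 < ?N" using assms by simp
      have l1: "t1 1 < ?N" using perms_less[OF t1(1), of 1] N by simp
      have ne: "t1 1 \<noteq> k" using t1 injD[OF permutes_inj[OF t1(1)], of 0 1] by auto
      have t2: "t2 permutes {..<?N}" unfolding t2_def using that l1 by (intro permutes_swap_id) auto
      have "(t2 \<circ> t1) 0 = k" "(t2 \<circ> t1) 1 = l" using t1(2) ne False by (simp_all add: t2_def Transposition.transpose_def)
      then show ?thesis using move[OF permutes_compose[OF t1(1) t2], of 0 1] False by (simp add: p2_def)
    qed
  qed
  have se: "(\<Sum>k<?N. e k) = 0"
  proof -
    have "(\<Sum>k<?N. e k) = (\<Sum>k<M. e k) + (\<Sum>k\<in>{M..<?N}. e k)"
      by (subst sum.union_disjoint[symmetric]) (auto intro!: sum.cong)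
    then show ?thesis by (simp add: e_def)
  qed
  have p1: "real ?N * p1 = 2 * real m"
  proof -
    have "avg (perms ?N) (\<lambda>\<sigma>. ?x k \<sigma>) = p1" if "k < ?N" for k
    proof -
      have "avg (perms ?N) (\<lambda>\<sigma>. ?x k \<sigma>) = avg (perms ?N) (\<lambda>\<sigma>. ?x k \<sigma> * ?x k \<sigma>)" by (rule avg_cong) simp
      then show ?thesis unfolding pair[OF that that] by simp
    qed
    then have "real ?N * p1 = (\<Sum>k<?N. avg (perms ?N) (\<lambda>\<sigma>. ?x k \<sigma>))" by simp
    also have "\<dots> = avg (perms ?N) (\<lambda>\<sigma>. \<Sum>k<?N. ?x k \<sigma>)" by (rule avg_sum[symmetric])
    also have "\<dots> = avg (perms ?N) (\<lambda>\<sigma>. 2 * real m)"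
    proof (rule avg_cong)
      fix \<sigma> assume "\<sigma> \<in> perms ?N"
      moreover have "{..<?N} \<inter> ?T \<sigma> = ?T \<sigma>" by (auto simp: tops_def)
      ultimately show "(\<Sum>k<?N. ?x k \<sigma>) = 2 * real m" using card by (subst sum_of_bool_eq) auto
    qed
    also have "\<dots> = 2 * real m" by (rule avg_const[OF finite_perms perms_nonempty])
    finally show ?thesis .
  qed
  have p2: "0 \<le> p2" unfolding p2_def by (rule avg_ge[OF finite_perms perms_nonempty]) simp
  have dev: "(real (card {k \<in> ?T \<sigma>. k < M}) - real m) ^ 2 = (1 / 4) * (\<Sum>k<?N. \<Sum>l<?N. e k * e l * (?x k \<sigma> * ?x l \<sigma>))"
    if "\<sigma> \<in> perms ?N" for \<sigma>
  proof -
    let ?H = "{k \<in> ?T \<sigma>. k < M}" and ?H' = "{k \<in> ?T \<sigma>. M \<le> k}"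
    have fin: "finite (?T \<sigma>)" by (simp add: tops_def)
    have "card ?H + card ?H' = card (?H \<union> ?H')" using fin by (intro card_Un_disjoint[symmetric]) auto
    also have "?H \<union> ?H' = ?T \<sigma>" by auto
    finally have hh: "real (card ?H) + real (card ?H') = 2 * real m" using card[OF that] by linarith
    have "(\<Sum>k<?N. e k * ?x k \<sigma>) = (\<Sum>k<?N. of_bool (k \<in> ?H) - of_bool (k \<in> ?H'))"
      by (intro sum.cong refl) (auto simp: e_def)
    also have "\<dots> = (\<Sum>k<?N. of_bool (k \<in> ?H)) - (\<Sum>k<?N. of_bool (k \<in> ?H'))" by (rule sum_subtractf)
    also have "(\<Sum>k<?N. of_bool (k \<in> ?H)) = real (card ?H)"
      by (subst sum_of_bool_eq) (auto simp: tops_def intro!: arg_cong[where f=card])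
    also have "(\<Sum>k<?N. of_bool (k \<in> ?H')) = real (card ?H')"
      by (subst sum_of_bool_eq) (auto simp: tops_def intro!: arg_cong[where f=card])
    finally have S0: "(\<Sum>k<?N. e k * ?x k \<sigma>) = real (card ?H) - real (card ?H')" .
    have "a - b = 2 * (a - c)" if "a + b = 2 * c" for a b c :: real using that by simp
    from this[OF hh] have S: "(\<Sum>k<?N. e k * ?x k \<sigma>) = 2 * (real (card ?H) - real m)" unfolding S0 .
    have "(\<Sum>k<?N. \<Sum>l<?N. e k * e l * (?x k \<sigma> * ?x l \<sigma>)) = (\<Sum>k<?N. e k * ?x k \<sigma>) * (\<Sum>k<?N. e k * ?x k \<sigma>)"
      unfolding sum_product by (intro sum.cong refl) (simp only: mult_ac)
    then show ?thesis unfolding S by (simp add: power2_eq_square algebra_simps)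
  qed
  have "avg (perms ?N) (\<lambda>\<sigma>. (real (card {k \<in> ?T \<sigma>. k < M}) - real m) ^ 2)
    = avg (perms ?N) (\<lambda>\<sigma>. (1 / 4) * (\<Sum>k<?N. \<Sum>l<?N. e k * e l * (?x k \<sigma> * ?x l \<sigma>)))"
    by (rule avg_cong) (rule dev)
  also have "\<dots> = (1 / 4) * (\<Sum>k<?N. \<Sum>l<?N. e k * e l * avg (perms ?N) (\<lambda>\<sigma>. ?x k \<sigma> * ?x l \<sigma>))"
    unfolding avg_cmult avg_sum ..
  also have "(\<Sum>k<?N. \<Sum>l<?N. e k * e l * avg (perms ?N) (\<lambda>\<sigma>. ?x k \<sigma> * ?x l \<sigma>))
    = (\<Sum>k<?N. \<Sum>l<?N. p2 * (e k * e l) + (p1 - p2) * (e k * e l * of_bool (k = l)))"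
  proof (intro sum.cong refl)
    fix k l assume "k \<in> {..<?N}" "l \<in> {..<?N}"
    then have "avg (perms ?N) (\<lambda>\<sigma>. ?x k \<sigma> * ?x l \<sigma>) = p2 + (p1 - p2) * of_bool (k = l)" by (intro pair) simp_all
    then show "e k * e l * avg (perms ?N) (\<lambda>\<sigma>. ?x k \<sigma> * ?x l \<sigma>) = p2 * (e k * e l) + (p1 - p2) * (e k * e l * of_bool (k = l))"
      by (simp only: distrib_left mult_ac)
  qed
  also have "\<dots> = p2 * ((\<Sum>k<?N. e k) * (\<Sum>k<?N. e k)) + (p1 - p2) * (\<Sum>k<?N. \<Sum>l<?N. e k * e l * of_bool (k = l))"
    unfolding sum.distrib sum_distrib_left[symmetric] sum_product ..
  also have "(\<Sum>k<?N. \<Sum>l<?N. e k * e l * of_bool (k = l)) = (\<Sum>k<?N. 1)"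
  proof (intro sum.cong refl)
    fix k assume k: "k \<in> {..<?N}"
    have "(\<Sum>l<?N. e k * e l * of_bool (k = l)) = (\<Sum>l<?N. if k = l then e k * e l else 0)" by (intro sum.cong) auto
    also have "\<dots> = e k * e k" using k by simp
    finally show "(\<Sum>l<?N. e k * e l * of_bool (k = l)) = 1" by (simp add: e_def)
  qed
  also have "(1 / 4) * (p2 * ((\<Sum>k<?N. e k) * (\<Sum>k<?N. e k)) + (p1 - p2) * (\<Sum>k<?N. 1)) = (real ?N * p1 - real ?N * p2) / 4"
    unfolding se by (simp add: algebra_simps)
  also have "\<dots> \<le> real m / 2" unfolding p1 using p2 by simp
  finally show ?thesis .
qed

lemma enumerate_finite:
  fixes P :: "nat set"
  assumes "finite P"
  obtains p where "bij_betw p {..<card P} P" "\<And>i j. i < j \<Longrightarrow> j < card P \<Longrightarrow> p i < p j"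
proof
  let ?p = "\<lambda>j. sorted_list_of_set P ! j"
  show "bij_betw ?p {..<card P} P"
    using bij_betw_nth[of "sorted_list_of_set P" "{..<card P}" P] assms by simp
  show "?p i < ?p j" if "i < j" "j < card P" for i j
    using strict_sorted_list_of_set[of P] that sorted_wrt_nth_less[of "(<)" "sorted_list_of_set P" i j] assms by simp
qed

text \<open>The positions of the \<open>r\<close> largest values and all smaller values are kept
  from \<open>\<sigma>\<close>; \<open>w\<close> prescribes the order of the largest ones along the
  enumeration \<open>p\<close>.\<close>

definition reorder_tops :: "nat \<Rightarrow> nat \<Rightarrow> (nat \<Rightarrow> nat) \<Rightarrow> (nat \<Rightarrow> nat) \<Rightarrow> (nat \<Rightarrow> nat) \<Rightarrow> nat \<Rightarrow> nat" where
  "reorder_tops r N p \<sigma> w k = (if k \<in> tops r N \<sigma> then N - r + w (the_inv_into {..<r} p k) else \<sigma> k)"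

text \<open>Permuting the \<open>r\<close> largest values by an independent uniform
  \<open>\<pi>\<close> keeps \<open>\<sigma>\<close> uniform. For fixed \<open>\<sigma>\<close>,
  reading the result along \<open>p\<close> gives the order \<open>\<pi> \<circ> ?\<beta>\<close>,
  which is uniform again.\<close>

lemma avg_reorder_tops:
  assumes "r \<le> N" and p: "\<And>\<sigma>. \<sigma> \<in> perms N \<Longrightarrow> bij_betw (p \<sigma>) {..<r} (tops r N \<sigma>)"
  shows "avg (perms N) F = avg (perms N) (\<lambda>\<sigma>. avg (perms r) (\<lambda>w. F (reorder_tops r N (p \<sigma>) \<sigma> w)))"
proof -
  let ?L = "N - r"
  define \<rho> where "\<rho> \<pi> x = (if ?L \<le> x \<and> x < N then ?L + \<pi> (x - ?L) else x)" for \<pi> :: "nat \<Rightarrow> nat" and x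
  have \<rho>: "\<rho> \<pi> permutes {..<N}" if "\<pi> \<in> perms r" for \<pi>
  proof (rule bij_imp_permutes)
    from that have \<pi>: "\<pi> permutes {..<r}" by simp
    show "bij_betw (\<rho> \<pi>) {..<N} {..<N}"
    proof (rule bij_betwI[where g="\<rho> (inv \<pi>)"])
      have lt: "\<rho> \<pi>' \<in> {..<N} \<rightarrow> {..<N}" if "\<pi>' permutes {..<r}" for \<pi>'
      proof
        fix x assume x: "x \<in> {..<N}"
        show "\<rho> \<pi>' x \<in> {..<N}"
        proof (cases "?L \<le> x")
          case True
          then have "x - ?L < r" using x assms(1) by simp
          then have "\<pi>' (x - ?L) < r" using perms_less[OF that] by simp
          then show ?thesis using x True assms(1) by (simp add: \<rho>_def)
        next
          case False
          then show ?thesis using x by (simp add: \<rho>_def)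
        qed
      qed
      show "\<rho> \<pi> \<in> {..<N} \<rightarrow> {..<N}" by (rule lt[OF \<pi>])
      show "\<rho> (inv \<pi>) \<in> {..<N} \<rightarrow> {..<N}" by (rule lt[OF permutes_inv[OF \<pi>]])
      have *: "\<rho> (inv \<pi>') (\<rho> \<pi>' x) = x" if "\<pi>' permutes {..<r}" for \<pi>' x
      proof (cases "?L \<le> x \<and> x < N")
        case True
        then have "x - ?L < r" using assms(1) by linarith
        then have "\<pi>' (x - ?L) < r" using perms_less[OF that] by simp
        then show ?thesis using True assms(1) permutes_inverses(2)[OF that] by (auto simp: \<rho>_def)
      next
        case False
        then show ?thesis by (auto simp: \<rho>_def)
      qed
      show "\<rho> (inv \<pi>) (\<rho> \<pi> x) = x" for x by (rule *[OF \<pi>])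
      show "\<rho> \<pi> (\<rho> (inv \<pi>) y) = y" for y
        using *[OF permutes_inv[OF \<pi>], of y] permutes_inv_inv[OF \<pi>] by simp
    qed
  qed (auto simp: \<rho>_def)
  have "avg (perms N) F = avg (perms r) (\<lambda>\<pi>. avg (perms N) F)"
    by (rule avg_const[OF finite_perms perms_nonempty, symmetric])
  also have "\<dots> = avg (perms r) (\<lambda>\<pi>. avg (perms N) (\<lambda>\<sigma>. F (\<rho> \<pi> \<circ> \<sigma>)))"
  proof (rule avg_cong)
    fix \<pi> assume "\<pi> \<in> perms r"
    show "avg (perms N) F = avg (perms N) (\<lambda>\<sigma>. F (\<rho> \<pi> \<circ> \<sigma>))"
      by (rule avg_bij[OF bij_perms_comp_left[OF \<rho>[OF \<open>\<pi> \<in> perms r\<close>]], where F=F, symmetric])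
  qed
  also have "\<dots> = avg (perms N) (\<lambda>\<sigma>. avg (perms r) (\<lambda>\<pi>. F (\<rho> \<pi> \<circ> \<sigma>)))" by (rule avg_swap)
  also have "\<dots> = avg (perms N) (\<lambda>\<sigma>. avg (perms r) (\<lambda>w. F (reorder_tops r N (p \<sigma>) \<sigma> w)))"
  proof (rule avg_cong)
    fix \<sigma> assume s: "\<sigma> \<in> perms N"
    then have \<sigma>: "\<sigma> permutes {..<N}" by simp
    let ?\<beta> = "\<lambda>j. if j < r then \<sigma> (p \<sigma> j) - ?L else j"
    have b1: "bij_betw \<sigma> (tops r N \<sigma>) {?L..<N}"
      unfolding bij_betw_def by (intro conjI image_tops[OF \<sigma>]) (rule inj_on_subset[OF permutes_inj[OF \<sigma>] subset_UNIV])
    have b2: "bij_betw (\<lambda>x. x - ?L) {?L..<N} {..<r}"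
    proof (rule bij_betwI[where g="\<lambda>x. x + ?L"])
      show "(\<lambda>x. x - ?L) \<in> {?L..<N} \<rightarrow> {..<r}"
      proof
        fix x assume "x \<in> {?L..<N}"
        then have "?L \<le> x" "x < N" by simp_all
        then have "x - ?L < r" using assms(1) by linarith
        then show "x - ?L \<in> {..<r}" by simp
      qed
      show "(\<lambda>x. x + ?L) \<in> {..<r} \<rightarrow> {?L..<N}"
      proof
        fix x assume "x \<in> {..<r}"
        then have "x + ?L < N" using assms(1) by simp
        then show "x + ?L \<in> {?L..<N}" by simp
      qed
    qed simp_all
    have "bij_betw ?\<beta> {..<r} {..<r}"
    proof (rule bij_betw_cong[THEN iffD1, OF _ bij_betw_trans[OF bij_betw_trans[OF p[OF s] b1] b2]])
      show "((\<lambda>x. x - ?L) \<circ> (\<sigma> \<circ> p \<sigma>)) j = ?\<beta> j" if "j \<in> {..<r}" for j using that by simp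
    qed
    then have \<beta>: "?\<beta> permutes {..<r}" by (rule bij_imp_permutes) auto
    have eq: "\<rho> \<pi> \<circ> \<sigma> = reorder_tops r N (p \<sigma>) \<sigma> (\<pi> \<circ> ?\<beta>)" for \<pi>
    proof
      fix k
      show "(\<rho> \<pi> \<circ> \<sigma>) k = reorder_tops r N (p \<sigma>) \<sigma> (\<pi> \<circ> ?\<beta>) k"
      proof (cases "k \<in> tops r N \<sigma>")
        case True
        let ?j = "the_inv_into {..<r} (p \<sigma>) k"
        have j: "?j < r" using bij_betw_apply[OF bij_betw_the_inv_into[OF p[OF s]] True] by simp
        have pj: "p \<sigma> ?j = k" by (rule f_the_inv_into_f_bij_betw[OF p[OF s]]) (rule True)
        have "\<sigma> k < N" "?L \<le> \<sigma> k" using True perms_less[OF \<sigma>] by (auto simp: tops_def)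
        then show ?thesis unfolding reorder_tops_def using True j by (simp add: \<rho>_def pj)
      next
        case False
        then show ?thesis using perms_less[OF \<sigma>, of k] by (auto simp: \<rho>_def reorder_tops_def tops_def)
      qed
    qed
    show "avg (perms r) (\<lambda>\<pi>. F (\<rho> \<pi> \<circ> \<sigma>)) = avg (perms r) (\<lambda>w. F (reorder_tops r N (p \<sigma>) \<sigma> w))"
      unfolding eq by (rule avg_bij[OF bij_perms_comp_right[OF \<beta>], where F="\<lambda>w. F (reorder_tops r N (p \<sigma>) \<sigma> w)"])
  qed
  finally show ?thesis .
qed

lemma prod_le_prod_subset:
  fixes f :: "'a \<Rightarrow> real"
  assumes "finite A" "B \<subseteq> A" "\<And>x. x \<in> A \<Longrightarrow> f x \<in> {0..1}"
  shows "prod f A \<le> prod f B"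
proof -
  have "prod f A = prod f (A - B) * prod f B" by (rule prod.subset_diff[OF assms(2,1)])
  also have "\<dots> \<le> 1 * prod f B"
    using assms by (intro mult_right_mono prod_le_1 prod_nonneg) auto
  finally show ?thesis by simp
qed

lemma downward_closed_eq_lessThan:
  fixes A :: "nat set"
  assumes "finite A" "\<And>i j. i \<in> A \<Longrightarrow> j < i \<Longrightarrow> j \<in> A"
  shows "A = {..<card A}"
proof (cases "A = {}")
  case False
  have "A = {..Max A}"
  proof (intro equalityI subsetI)
    fix x assume "x \<in> {..Max A}"
    then have "x < Max A \<or> x = Max A" by auto
    then show "x \<in> A" using assms(2)[OF Max_in[OF assms(1) False]] Max_in[OF assms(1) False] by blast
  qed (use assms(1) in auto)
  then have "A = {..<Suc (Max A)}" by (simp add: lessThan_Suc_atMost)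
  then show ?thesis by (metis card_lessThan)
qed simp

text \<open>
  \<open>C'\<close> plays the small game by running \<open>C\<close> on the large one, inserting small values at the positions
  outside \<open>P\<close>. The two games differ only if the maximum arrives between the two starting times.
\<close>

lemma crop_simulation:
  fixes \<sigma> p :: "nat \<Rightarrow> nat" and m M :: nat
  defines "P \<equiv> tops (2 * m) (2 * M) \<sigma>"
  defines "H \<equiv> card {k \<in> P. k < M}"
  defines "V \<equiv> \<lambda>w k. real (reorder_tops (2 * m) (2 * M) p \<sigma> w k)"
  assumes C: "crop_algorithm C" "crop_comparison_based C" and m: "1 \<le> m" "m \<le> M"
    and p: "bij_betw p {..<2 * m} P" and p_mono: "\<And>i j. i < j \<Longrightarrow> j < 2 * m \<Longrightarrow> p i < p j"
  shows "\<exists>C'. crop_algorithm C' \<and> crop_comparison_based C' \<and>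
    (\<forall>w\<in>perms (2 * m). crop_pick C M (V w) \<le> crop_pick C' m (\<lambda>j. real (w j))
       + of_bool (\<exists>j\<in>{min m H..<max m H}. \<forall>i\<in>{min m H..<2 * m}. w i \<le> w j))"
proof -
  let ?L = "2 * M - 2 * m" and ?idx = "the_inv_into {..<2 * m} p"
  have idx: "?idx (p j) = j" if "j < 2 * m" for j
    using p that by (intro the_inv_into_f_f) (auto simp: bij_betw_def)
  have idxP: "?idx k < 2 * m \<and> p (?idx k) = k" if "k \<in> P" for k
    using bij_betw_apply[OF bij_betw_the_inv_into[OF p] that] f_the_inv_into_f_bij_betw[OF p that] by simp
  have pP: "p j \<in> P" if "j < 2 * m" for j using p that by (auto simp: bij_betw_def)
  have P_less: "k < 2 * M" if "k \<in> P" for k using that by (simp add: P_def tops_def)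
  have mono_le: "p i \<le> p j \<longleftrightarrow> i \<le> j" if "i < 2 * m" "j < 2 * m" for i j
  proof (cases i j rule: linorder_cases)
    case less
    then show ?thesis using p_mono[of i j] that by simp
  next
    case greater
    then show ?thesis using p_mono[of j i] that by simp
  qed simp
  have low: "\<sigma> k < ?L" if "k < 2 * M" "k \<notin> P" for k using that by (auto simp: P_def tops_def)

  \<comment> \<open>At positions of the large game outside \<open>P\<close>,
    \<open>\<sigma> k\<close> is below \<open>?L\<close>, so the inserted numbers are smaller than
    all entries of \<open>vs\<close> and ordered like \<open>\<sigma>\<close>.\<close>
  define ext where "ext vs k = (if k \<in> P then vs ! ?idx k else Min (set vs) + (real (\<sigma> k) - real ?L))" for vs :: "real list" and k
  \<comment> \<open>\<open>p (length vs - 1)\<close> is the position of the current value in the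
    large game; before \<open>M\<close> that game only observes, so \<open>C'\<close>
    rejects.\<close>
  define C' where "C' vs = (if vs = [] \<or> 2 * m < length vs \<or> p (length vs - 1) < M then 0
    else C (map (ext vs) [0..<Suc (p (length vs - 1))]))" for vs

  have emb: "same_comparisons (map e [0..<Suc (p j)]) (map e' [0..<Suc (p j)])"
    if j: "j < 2 * m"
      and top: "\<And>k. k \<in> P \<Longrightarrow> e k = x (?idx k)" "\<And>k. k \<in> P \<Longrightarrow> e' k = x' (?idx k)"
      and lows: "\<And>k i. k < 2 * M \<Longrightarrow> k \<notin> P \<Longrightarrow> i \<le> j \<Longrightarrow> e k < x i" "\<And>k i. k < 2 * M \<Longrightarrow> k \<notin> P \<Longrightarrow> i \<le> j \<Longrightarrow> e' k < x' i"
      and ll: "\<And>k l. k < 2 * M \<Longrightarrow> l < 2 * M \<Longrightarrow> k \<notin> P \<Longrightarrow> l \<notin> P \<Longrightarrow> e k < e l \<longleftrightarrow> e' k < e' l"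
      and xx: "\<And>i l. i \<le> j \<Longrightarrow> l \<le> j \<Longrightarrow> x i < x l \<longleftrightarrow> x' i < x' l"
    for j and e e' x x' :: "nat \<Rightarrow> real"
  proof (rule same_comparisons_map_upt)
    fix k l assume "k < Suc (p j)" "l < Suc (p j)"
    then have kl: "k \<le> p j" "l \<le> p j" by simp_all
    then have kl2: "k < 2 * M" "l < 2 * M" using P_less[OF pP[OF j]] by simp_all
    have i: "?idx k \<le> j" if "k \<in> P" "k \<le> p j" for k using idxP[OF that(1)] mono_le[of "?idx k" j] that(2) j by simp
    show "e k < e l \<longleftrightarrow> e' k < e' l"
    proof (cases "k \<in> P"; cases "l \<in> P")
      assume "k \<in> P" "l \<in> P"
      then show ?thesis using top xx[OF i i] kl by simp
    next
      assume "k \<in> P" "l \<notin> P"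
      then show ?thesis using top[of k] lows[OF kl2(2), of "?idx k"] i kl by (simp add: not_less less_imp_le less_not_sym)
    next
      assume "k \<notin> P" "l \<in> P"
      then show ?thesis using top[of l] lows[OF kl2(1), of "?idx l"] i kl by simp
    next
      assume "k \<notin> P" "l \<notin> P"
      then show ?thesis using ll kl2 by blast
    qed
  qed
  have ext_top: "ext vs k = vs ! ?idx k" if "k \<in> P" for vs k using that by (simp add: ext_def)
  have ext_low: "ext vs k < vs ! i" if "k < 2 * M" "k \<notin> P" "i \<le> length vs - 1" "vs \<noteq> []" for vs k i
  proof -
    have "i < length vs" using that(3,4) by (cases vs) auto
    then have "Min (set vs) \<le> vs ! i" by (intro Min_le) auto
    moreover have "real (\<sigma> k) < real ?L" using low[OF that(1,2)] by simp
    ultimately show ?thesis using that(2) by (simp add: ext_def)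
  qed
  have ext_ll: "ext vs k < ext vs l \<longleftrightarrow> \<sigma> k < \<sigma> l" if "k \<notin> P" "l \<notin> P" for vs k l using that by (simp add: ext_def)

  have alg: "crop_algorithm C'" using C(1) by (simp add: crop_algorithm_def C'_def)
  have cb: "crop_comparison_based C'" unfolding crop_comparison_based_def
  proof (intro allI impI)
    fix vs vs' assume s: "same_comparisons vs vs'"
    then have len: "length vs = length vs'" by (simp add: same_comparisons_def)
    show "C' vs = C' vs'"
    proof (cases "vs = [] \<or> 2 * m < length vs")
      case True
      then show ?thesis using len by (auto simp: C'_def)
    next
      case False
      let ?j = "length vs - 1"
      have ne: "vs \<noteq> []" "vs' \<noteq> []" using False len by auto
      then have j: "?j < 2 * m" "\<And>i. i \<le> ?j \<Longrightarrow> i < length vs" using False by (cases vs; auto)+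
      have "same_comparisons (map (ext vs) [0..<Suc (p ?j)]) (map (ext vs') [0..<Suc (p ?j)])"
        by (rule emb[OF j(1), where x="\<lambda>i. vs ! i" and x'="\<lambda>i. vs' ! i"])
           (use ext_top ext_low ext_ll ne len s j(2) in \<open>auto simp: same_comparisons_def\<close>)
      then have "C (map (ext vs) [0..<Suc (p ?j)]) = C (map (ext vs') [0..<Suc (p ?j)])"
        by (rule C(2)[unfolded crop_comparison_based_def, rule_format])
      then show ?thesis using ne len by (simp add: C'_def)
    qed
  qed

  have main: "crop_pick C M (V w) \<le> crop_pick C' m (\<lambda>j. real (w j))
       + of_bool (\<exists>j\<in>{min m H..<max m H}. \<forall>i\<in>{min m H..<2 * m}. w i \<le> w j)" if "w \<in> perms (2 * m)" for w
  proof (cases "\<exists>j\<in>{min m H..<max m H}. \<forall>i\<in>{min m H..<2 * m}. w i \<le> w j")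
    case True
    then have "of_bool (\<exists>j\<in>{min m H..<max m H}. \<forall>i\<in>{min m H..<2 * m}. w i \<le> w j) = (1::real)" by simp
    then show ?thesis using crop_pick_bounds[OF C(1), of M "V w"] crop_pick_bounds[OF alg, of m "\<lambda>j. real (w j)"] by simp
  next
    case False
    from that have w: "w permutes {..<2 * m}" by simp
    let ?a = "min m H" and ?b = "max m H"
    let ?w = "\<lambda>j. real (w j)"
    define q where "q k = C (map (V w) [0..<Suc k])" for k
    define q' where "q' j = C' (map ?w [0..<Suc j])" for j
    have q01: "q k \<in> {0..1}" for k using C(1) by (simp add: q_def crop_algorithm_def)
    have q'01: "q' k \<in> {0..1}" for k using alg by (simp add: q'_def crop_algorithm_def)
    have Vtop: "V w k = real ?L + ?w (?idx k)" if "k \<in> P" for k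
      using that by (simp add: V_def reorder_tops_def P_def)
    have Vlow: "V w k = real (\<sigma> k)" if "k \<notin> P" for k using that by (simp add: V_def reorder_tops_def P_def)
    have q': "q' j = (if p j < M then 0 else q (p j))" if j: "j < 2 * m" for j
    proof -
      let ?vs = "map ?w [0..<Suc j]"
      have nth: "?vs ! i = ?w i" if "i \<le> j" for i using that by (simp del: upt_Suc)
      have "same_comparisons (map (ext ?vs) [0..<Suc (p j)]) (map (V w) [0..<Suc (p j)])"
      proof (rule emb[OF j, where x="\<lambda>i. ?vs ! i" and x'="\<lambda>i. real ?L + ?w i"])
        show "ext ?vs k < ?vs ! i" if "k < 2 * M" "k \<notin> P" "i \<le> j" for k i by (rule ext_low) (use that in auto)
        show "V w k < real ?L + ?w i" if "k < 2 * M" "k \<notin> P" "i \<le> j" for k i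
        proof -
          have "real (\<sigma> k) < real ?L" using low[OF that(1,2)] by simp
          then show ?thesis unfolding Vlow[OF that(2)] by simp
        qed
        show "?vs ! i < ?vs ! l \<longleftrightarrow> real ?L + ?w i < real ?L + ?w l" if "i \<le> j" "l \<le> j" for i l
          unfolding nth[OF that(1)] nth[OF that(2)] by simp
      qed (simp_all add: ext_top Vtop Vlow ext_ll)
      then have "C (map (ext ?vs) [0..<Suc (p j)]) = q (p j)" unfolding q_def
        by (rule C(2)[unfolded crop_comparison_based_def, rule_format])
      moreover have "q' j = (if p j < M then 0 else C (map (ext ?vs) [0..<Suc (p j)]))"
        using j unfolding q'_def C'_def by simp
      ultimately show ?thesis by simp
    qed
    have pH: "p j < M \<longleftrightarrow> j < H" if "j < 2 * m" for j
    proof -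
      let ?A = "{j. j < 2 * m \<and> p j < M}"
      have "?A = {..<card ?A}" by (rule downward_closed_eq_lessThan) (auto dest: p_mono)
      moreover have "card ?A = H"
      proof -
        have "p ` ?A = {k \<in> P. k < M}"
        proof (intro equalityI subsetI)
          fix k assume "k \<in> {k \<in> P. k < M}"
          then show "k \<in> p ` ?A" using idxP[of k] by (intro image_eqI[of _ _ "?idx k"]) auto
        qed (use pP in auto)
        moreover have "inj_on p ?A" by (rule inj_on_subset[OF bij_betw_imp_inj_on[OF p]]) auto
        ultimately show ?thesis unfolding H_def using card_image[of p ?A] by simp
      qed
      ultimately show ?thesis using that by blast
    qed
    \<comment> \<open>The index \<open>J\<close> found below holds the maximum from the earlier
      start on. By \<open>False\<close> it comes after both starts, so it wins in both
      games.\<close>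
    have a: "?a < 2 * m" using m(1) by simp
    have "Max (w ` {?a..<2 * m}) \<in> w ` {?a..<2 * m}" using a by (intro Max_in) auto
    then obtain J where J: "J \<in> {?a..<2 * m}" "w J = Max (w ` {?a..<2 * m})" by auto
    have Jmax: "w i \<le> w J" if "i \<in> {?a..<2 * m}" for i unfolding J(2) using that by simp
    have Jb: "?b \<le> J"
    proof (rule ccontr)
      assume "\<not> ?b \<le> J"
      then have "J < ?b" by (rule not_le_imp_less)
      then have "J \<in> {?a..<?b}" using J(1) by auto
      then show False using False Jmax by blast
    qed
    then have J2: "J < 2 * m" "m \<le> J" "H \<le> J" using J(1) by auto
    have pJ: "M \<le> p J" "p J < 2 * M" "p J \<in> P" using pH[OF J2(1)] J2 pP P_less by auto
    have top: "V w k \<le> V w (p J)" if k: "k \<in> {M..<2 * M}" for k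
    proof (cases "k \<in> P")
      case True
      then have i: "?idx k < 2 * m" "p (?idx k) = k" using idxP by auto
      then have "H \<le> ?idx k" using pH[OF i(1)] k by auto
      then have "w (?idx k) \<le> w J" using Jmax i(1) by simp
      then show ?thesis using Vtop[OF True] Vtop[OF pJ(3)] idx[OF J2(1)] by simp
    next
      case F: False
      have "real (\<sigma> k) < real ?L" using low[of k] k F by simp
      then show ?thesis using Vlow[OF F] Vtop[OF pJ(3)] by simp
    qed
    have K: "{k. k \<in> {M..<2 * M} \<and> (\<forall>j\<in>{M..<2 * M}. V w j \<le> V w k)} = {p J}"
    proof (intro equalityI subsetI)
      fix k assume k: "k \<in> {k. k \<in> {M..<2 * M} \<and> (\<forall>j\<in>{M..<2 * M}. V w j \<le> V w k)}"
      then have ge: "V w (p J) \<le> V w k" and kM: "k \<in> {M..<2 * M}" using pJ by auto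
      have kP: "k \<in> P"
      proof (rule ccontr)
        assume F: "k \<notin> P"
        have "real (\<sigma> k) < real ?L" using low[of k] kM F by simp
        then show False using ge Vlow[OF F] Vtop[OF pJ(3)] by simp
      qed
      have "w J \<le> w (?idx k)" using ge Vtop[OF kP] Vtop[OF pJ(3)] idx[OF J2(1)] by simp
      moreover have "w (?idx k) \<le> w J" using top[OF kM] Vtop[OF kP] Vtop[OF pJ(3)] idx[OF J2(1)] by simp
      ultimately have "?idx k = J" using injD[OF permutes_inj[OF w]] by simp
      then show "k \<in> {p J}" using idxP[OF kP] by auto
    next
      fix k assume "k \<in> {p J}"
      then show "k \<in> {k. k \<in> {M..<2 * M} \<and> (\<forall>j\<in>{M..<2 * M}. V w j \<le> V w k)}" using top pJ by simp
    qed
    have "crop_pick C M (V w) = q (p J) * (\<Prod>k\<in>{M..<p J}. 1 - q k)"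
      unfolding crop_pick_def pick_max_prob_def K by (simp add: q_def)
    \<comment> \<open>Before \<open>p J\<close> the large game may also accept outside
      \<open>P\<close>, or at top values with index below \<open>m\<close>. These additional factors
      only lower its survival probability.\<close>
    also have "\<dots> \<le> q' J * (\<Prod>j\<in>{m..<J}. 1 - q' j)"
    proof -
      let ?A = "{j \<in> {m..<J}. \<not> p j < M}"
      have inj: "inj_on p ?A" by (rule inj_on_subset[OF bij_betw_imp_inj_on[OF p]]) (use J2 in auto)
      have "(\<Prod>k\<in>{M..<p J}. 1 - q k) \<le> (\<Prod>k\<in>p ` ?A. 1 - q k)"
      proof (rule prod_le_prod_subset)
        show "p ` ?A \<subseteq> {M..<p J}" using p_mono[OF _ J2(1)] by auto
        show "1 - q k \<in> {0..1}" for k using q01[of k] by simp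
      qed simp
      also have "\<dots> = (\<Prod>j\<in>?A. 1 - q (p j))" using prod.reindex[OF inj, of "\<lambda>k. 1 - q k"] by simp
      also have "\<dots> = (\<Prod>j\<in>?A. 1 - q' j)" using J2 by (intro prod.cong) (auto simp: q')
      also have "\<dots> = (\<Prod>j\<in>{m..<J}. 1 - q' j)" using J2 by (intro prod.mono_neutral_left) (auto simp: q')
      finally show ?thesis using q'[OF J2(1)] pJ(1) q01[of "p J"] by (simp add: mult_left_mono)
    qed
    also have "\<dots> \<le> crop_pick C' m ?w"
      unfolding crop_pick_def pick_max_prob_def q'_def[symmetric]
    proof (rule member_le_sum)
      show "J \<in> {k. k \<in> {m..<2 * m} \<and> (\<forall>j\<in>{m..<2 * m}. ?w j \<le> ?w k)}" using J2 Jmax by auto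
      show "0 \<le> q' k * (\<Prod>j\<in>{m..<k}. 1 - q' j)" for k
        using q'01 by (intro mult_nonneg_nonneg prod_nonneg) auto
    qed simp
    finally show ?thesis using False by simp
  qed
  show ?thesis using alg cb main by blast
qed

text \<open>For fixed positions of the top values the simulation loses at most
  \<open>\<bar>H - m\<bar> / m\<close>, because at least \<open>m\<close> indices remain from the
  earlier start on and each is equally likely to hold the maximum.\<close>

lemma crop_optimum_le_smaller:
  assumes m: "1 \<le> m" "m \<le> M"
  shows "crop_optimum M \<le> crop_optimum m + 1 / sqrt (real m)"
proof (rule crop_optimum_le)
  fix C assume C: "crop_algorithm C" "crop_comparison_based C"
  let ?T = "tops (2 * m) (2 * M)"
  define H where "H \<sigma> = card {k \<in> ?T \<sigma>. k < M}" for \<sigma>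
  have "\<exists>p. bij_betw p {..<2 * m} (?T \<sigma>) \<and> (\<forall>i j. i < j \<longrightarrow> j < 2 * m \<longrightarrow> p i < p j)" if "\<sigma> \<in> perms (2 * M)" for \<sigma>
  proof -
    have "card (?T \<sigma>) = 2 * m" using card_tops[of \<sigma> "2 * M" "2 * m"] that m by simp
    moreover have "finite (?T \<sigma>)" by (simp add: tops_def)
    then obtain p where "bij_betw p {..<card (?T \<sigma>)} (?T \<sigma>)" "\<And>i j. i < j \<Longrightarrow> j < card (?T \<sigma>) \<Longrightarrow> p i < p j"
      using enumerate_finite by blast
    ultimately show ?thesis by auto
  qed
  then obtain p where p: "\<And>\<sigma>. \<sigma> \<in> perms (2 * M) \<Longrightarrow> bij_betw (p \<sigma>) {..<2 * m} (?T \<sigma>)"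
    and p_mono: "\<And>\<sigma> i j. \<sigma> \<in> perms (2 * M) \<Longrightarrow> i < j \<Longrightarrow> j < 2 * m \<Longrightarrow> p \<sigma> i < p \<sigma> j" by metis
  let ?V = "\<lambda>\<sigma>. reorder_tops (2 * m) (2 * M) (p \<sigma>) \<sigma>"
  have one: "avg (perms (2 * m)) (\<lambda>w. crop_pick C M (\<lambda>k. real (?V \<sigma> w k)))
    \<le> crop_optimum m + \<bar>real (H \<sigma>) - real m\<bar> / real m" if s: "\<sigma> \<in> perms (2 * M)" for \<sigma>
  proof -
    let ?a = "min m (H \<sigma>)" and ?b = "max m (H \<sigma>)"
    obtain C' where C': "crop_algorithm C'" "crop_comparison_based C'"
      and le: "\<And>w. w \<in> perms (2 * m) \<Longrightarrow> crop_pick C M (\<lambda>k. real (?V \<sigma> w k)) \<le> crop_pick C' m (\<lambda>j. real (w j))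
        + of_bool (\<exists>j\<in>{?a..<?b}. \<forall>i\<in>{?a..<2 * m}. w i \<le> w j)"
      using crop_simulation[OF C m p[OF s] p_mono[OF s]] unfolding H_def[symmetric] by blast
    have "H \<sigma> \<le> card (?T \<sigma>)" unfolding H_def by (rule card_mono) (auto simp: tops_def)
    then have H: "H \<sigma> \<le> 2 * m" using card_tops[of \<sigma> "2 * M" "2 * m"] s m by simp
    have "avg (perms (2 * m)) (\<lambda>w. crop_pick C M (\<lambda>k. real (?V \<sigma> w k)))
      \<le> avg (perms (2 * m)) (\<lambda>w. crop_pick C' m (\<lambda>j. real (w j)) + of_bool (\<exists>j\<in>{?a..<?b}. \<forall>i\<in>{?a..<2 * m}. w i \<le> w j))"
      by (rule avg_mono) (rule le)
    also have "\<dots> = crop_success C' m real + avg (perms (2 * m)) (\<lambda>w. of_bool (\<exists>j\<in>{?a..<?b}. \<forall>i\<in>{?a..<2 * m}. w i \<le> w j))"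
      unfolding avg_add crop_success_eq_avg ..
    also have "\<dots> \<le> crop_optimum m + real (?b - ?a) / real (2 * m - ?a)"
      by (intro add_mono crop_success_le_optimum[OF C'] avg_early_argmax) (use m H in auto)
    also have "real (?b - ?a) / real (2 * m - ?a) \<le> real (?b - ?a) / real m"
      using m by (intro divide_left_mono) auto
    also have "real (?b - ?a) = \<bar>real (H \<sigma>) - real m\<bar>" by (simp add: min_def max_def of_nat_diff)
    finally show ?thesis by simp
  qed
  \<comment> \<open>This turns the second moment, at most \<open>m / 2\<close>, into a first moment.
    With \<open>r = sqrt m\<close> it gives three quarters of \<open>sqrt m\<close>.\<close>
  have amgm: "\<bar>x\<bar> \<le> (r + x ^ 2 / r) / 2" if "0 < r" for x r :: real
  proof -
    have "0 \<le> (\<bar>x\<bar> - r) ^ 2 / r" using that by simp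
    also have "\<dots> = x ^ 2 / r - 2 * \<bar>x\<bar> + r" using that by (simp add: power2_eq_square field_simps)
    finally show ?thesis by simp
  qed
  let ?r = "sqrt (real m)"
  have r: "0 < ?r" "?r * ?r = real m" using m by simp_all
  have "avg (perms (2 * M)) (\<lambda>\<sigma>. \<bar>real (H \<sigma>) - real m\<bar>)
    \<le> avg (perms (2 * M)) (\<lambda>\<sigma>. ?r / 2 + 1 / (2 * ?r) * (real (H \<sigma>) - real m) ^ 2)"
  proof (rule avg_mono)
    fix \<sigma>
    have "\<bar>real (H \<sigma>) - real m\<bar> \<le> (?r + (real (H \<sigma>) - real m) ^ 2 / ?r) / 2" by (rule amgm[OF r(1)])
    then show "\<bar>real (H \<sigma>) - real m\<bar> \<le> ?r / 2 + 1 / (2 * ?r) * (real (H \<sigma>) - real m) ^ 2"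
      by (simp add: add_divide_distrib)
  qed
  also have "\<dots> = ?r / 2 + 1 / (2 * ?r) * avg (perms (2 * M)) (\<lambda>\<sigma>. (real (H \<sigma>) - real m) ^ 2)"
    unfolding avg_add avg_cmult using avg_const[OF finite_perms perms_nonempty] by simp
  also have "\<dots> \<le> ?r / 2 + 1 / (2 * ?r) * (real m / 2)"
    unfolding H_def using m r(1) by (intro add_left_mono mult_left_mono avg_tops_deviation) auto
  also have "\<dots> \<le> ?r"
  proof -
    have *: "1 / (2 * ?r) * (real m / 2) = ?r / 4" using r by (simp add: field_simps)
    show ?thesis unfolding * using r(1) by simp
  qed
  finally have dev: "avg (perms (2 * M)) (\<lambda>\<sigma>. \<bar>real (H \<sigma>) - real m\<bar>) \<le> ?r" .
  have "crop_success C M real = avg (perms (2 * M)) (\<lambda>\<sigma>. avg (perms (2 * m)) (\<lambda>w. crop_pick C M (\<lambda>k. real (?V \<sigma> w k))))"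
    unfolding crop_success_eq_avg
    using avg_reorder_tops[of "2 * m" "2 * M" p "\<lambda>\<sigma>. crop_pick C M (\<lambda>k. real (\<sigma> k))"] p m by simp
  also have "\<dots> \<le> avg (perms (2 * M)) (\<lambda>\<sigma>. crop_optimum m + 1 / real m * \<bar>real (H \<sigma>) - real m\<bar>)"
    by (rule avg_mono) (use one in simp)
  also have "\<dots> = crop_optimum m + 1 / real m * avg (perms (2 * M)) (\<lambda>\<sigma>. \<bar>real (H \<sigma>) - real m\<bar>)"
    unfolding avg_add avg_cmult using avg_const[OF finite_perms perms_nonempty] by simp
  also have "\<dots> \<le> crop_optimum m + 1 / real m * ?r"
    using dev by (intro add_left_mono mult_left_mono) auto
  also have "1 / real m * ?r = 1 / ?r"
  proof -
    have "?r / (?r * ?r) = 1 / ?r" by (rule nonzero_divide_mult_cancel_left) (use r(1) in simp)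
    then show ?thesis unfolding r(2) by simp
  qed
  finally show "crop_success C M real \<le> crop_optimum m + 1 / sqrt (real m)" .
qed

text \<open>The limit is the infimum of \<open>crop_optimum n + 1 / sqrt n\<close>: a nearly optimal
  \<open>m\<close> bounds all later terms from above, and each term is at least the infimum minus
  \<open>1 / sqrt n\<close>.\<close>

lemma crop_optimum_convergent: "convergent crop_optimum"
proof -
  let ?e = "\<lambda>m. 1 / sqrt (real m)"
  have e0: "?e \<longlonglongrightarrow> 0"
    by (rule tendsto_divide_0[OF tendsto_const filterlim_at_top_imp_at_infinity])
       (rule filterlim_compose[OF sqrt_at_top filterlim_real_sequentially])
  define i where "i = (INF n\<in>{1..}. crop_optimum n + ?e n)"
  have bdd: "bdd_below ((\<lambda>n. crop_optimum n + ?e n) ` {1..})"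
    using crop_optimum_bounds by (intro bdd_belowI2[where m=0]) simp
  have low: "i \<le> crop_optimum n + ?e n" if "1 \<le> n" for n
    unfolding i_def by (rule cINF_lower[OF bdd]) (use that in simp)
  have "crop_optimum \<longlonglongrightarrow> i"
  proof (rule LIMSEQ_I)
    fix r :: real assume r: "0 < r"
    have "\<exists>m\<in>{1..}. crop_optimum m + ?e m < i + r"
      using cINF_less_iff[OF _ bdd, of "i + r"] r unfolding i_def by auto
    then obtain m where m: "1 \<le> m" "crop_optimum m + ?e m < i + r" by auto
    have "eventually (\<lambda>n. ?e n < r) sequentially" using order_tendstoD(2)[OF e0 r] .
    then obtain k where k: "\<And>n. k \<le> n \<Longrightarrow> ?e n < r" unfolding eventually_sequentially by blast
    show "\<exists>n0. \<forall>n\<ge>n0. norm (crop_optimum n - i) < r"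
    proof (intro exI[of _ "max m k"] allI impI)
      fix n assume n: "max m k \<le> n"
      have "crop_optimum n \<le> crop_optimum m + ?e m" by (rule crop_optimum_le_smaller) (use m n in auto)
      moreover have "i \<le> crop_optimum n + ?e n" using low m n by simp
      moreover have "?e n < r" using k n by simp
      ultimately show "norm (crop_optimum n - i) < r" using m by (simp add: abs_less_iff)
    qed
  qed
  then show ?thesis by (rule convergentI)
qed

text \<open>Convergence identifies \<open>lim\<close> with the actual limit, and any sufficiently
  large \<open>n\<close> is a witness.\<close>

lemma crop_optimum_less_gamma:
  assumes "0 < \<delta>"
  shows "\<exists>n\<ge>1. crop_optimum n < crop_gamma + \<delta>"
proof -
  have "crop_optimum \<longlonglongrightarrow> crop_gamma"
    unfolding crop_gamma_def using crop_optimum_convergent by (simp add: convergent_LIMSEQ_iff)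
  from order_tendstoD(2)[OF this, of "crop_gamma + \<delta>"] assms
  obtain k where "\<And>n. k \<le> n \<Longrightarrow> crop_optimum n < crop_gamma + \<delta>" unfolding eventually_sequentially by auto
  then show ?thesis by (intro exI[of _ "max 1 k"]) simp
qed

theorem theorem1:
  shows
   "((\<exists>A. googol_algorithm A \<and> googol_comparison_based A \<and>
        (\<forall>n\<ge>1. \<forall>a. googol_success A n a \<ge> 0.5009)) \<and>
     (\<exists>B. sample_algorithm B \<and> sample_comparison_based B \<and>
        (\<forall>n\<ge>1. \<forall>D. (\<forall>i<n. real_distribution (D i)) \<longrightarrow> sample_success B n D \<ge> 0.5009)))
    \<and>
    ((\<forall>B. sample_algorithm B \<and> sample_comparison_based B \<longrightarrow>
        (\<forall>\<delta>>0. \<exists>n\<ge>1. \<exists>D. (\<forall>i<n. real_distribution (D i)) \<and>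
           sample_success B n D < crop_gamma + \<delta>)) \<and>
     (\<forall>A. googol_algorithm A \<and> googol_comparison_based A \<longrightarrow>
        (\<forall>\<delta>>0. \<exists>n\<ge>1. \<exists>a. googol_success A n a < crop_gamma + \<delta>)))"
proof (intro conjI)
  show "\<exists>A. googol_algorithm A \<and> googol_comparison_based A \<and> (\<forall>n\<ge>1. \<forall>a. googol_success A n a \<ge> 0.5009)"
    using googol_rule_algorithm googol_rule_comparison_based googol_rule_success by blast
  show "\<exists>B. sample_algorithm B \<and> sample_comparison_based B \<and>
      (\<forall>n\<ge>1. \<forall>D. (\<forall>i<n. real_distribution (D i)) \<longrightarrow> sample_success B n D \<ge> 0.5009)"
    using sample_rule_algorithm sample_rule_comparison_based sample_rule_sample_success by blast
  show "\<forall>B. sample_algorithm B \<and> sample_comparison_based B \<longrightarrow>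
      (\<forall>\<delta>>0. \<exists>n\<ge>1. \<exists>D. (\<forall>i<n. real_distribution (D i)) \<and> sample_success B n D < crop_gamma + \<delta>)"
    using uniform_sample_success_le crop_optimum_less_gamma by (meson order_le_less_trans)
  show "\<forall>A. googol_algorithm A \<and> googol_comparison_based A \<longrightarrow>
      (\<forall>\<delta>>0. \<exists>n\<ge>1. \<exists>a. googol_success A n a < crop_gamma + \<delta>)"
    using ex_googol_success_le crop_optimum_less_gamma by (meson order_le_less_trans)
qed

end
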